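(* Let $\mathbb K\in\{\mathbb R,\mathbb C\}$, let $\Omega\subset\mathbb K^2$ be a nonempty connected open set with coordinates $(z,y)$, and let $f,g:\Omega\to\mathbb K$ be analytic functions with $f\not\equiv0$, $g\not\equiv0$ and such that $f_y$ and $g_{yy}$ are not both identically zero. Consider the equation $$y_{zz}+f(z,y)\,y_z+g(z,y)=0 .\qquad ( * )$$ With $S,P,Q,R,T,D$ the differential expressions in $f,g$ defined in the context, the following statements are equivalent. (I) Equation $( * )$ has a quadratic first integral of the form $I=(y_z+A(z,y))^2+B(z,y)$. (II) Equation $( * )$ admits a Lax representation $L_z=[L,M]$ with $$L=\begin{pmatrix} y_z+F&U\\ U&-y_z-F\end{pmatrix},\qquad M=\begin{pmatrix}0&\tfrac12U_y\\-\tfrac12U_y&0\end{pmatrix},$$ where $F=F(z,y)$ and $U=U(z,y)$ are nonzero functions. (III) $f$ and $g$ satisfy one of the following six sets of conditions on $\Omega$. 1) $f_y\neq0$, $S\neq0$, and $$\left(fP_yf_y-Pf_y^2+QP_y+2P_y^2-f_yP_{zy}\right)\left(2PRf-3Pf_y^2-3fP_yf_y-RP_z+f_yP_{zy}\right)$$ $$-\left(2Pf^2f_y-2P^2f_y+2PQf+4PfP_y-2Pf_yg_y-3fP_zf_y-gP_yf_y-QP_z-2P_zP_y+f_yP_{zz}\right)S=0,$$ $$S^2P_y+(4ff_y+Q)S^2-SS_zf_y+f_y(2Pf-P_z)R_yS-RP_y^2S+\left(f_yR_z-4Rff_y-6f_y^3-QR\right)P_yS$$ $$-f_yR(4Pf_y-P_{zy})S+3S_yf_y^2fP_y-S_yf_y\left(2PRf-3Pf_y^2-RP_z+P_{zy}f_y\right)=0.$$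 2) $f_y=0$, $g_{yy}\neq0$, and $$2QQ_z+2TQ_y-6Q^2f=0,$$ $$(fg-g_z)Q^5+3Q_yT(3Tf-T_z)Q^2+\left(4Tf_z-12Tf^2-Tg_y+7fT_z-T_{zz}\right)Q^4+Q_{yy}T^3Q-3Q_y^2T^3=0.$$ 3) $f_y\neq0$, $P_y\neq0$, $T\neq0$, $D\neq0$, and all of $$RP_y-f_yP_{yy}=0,\qquad Pf_y^2+fP_yf_y+RT-f_yT_y=0,$$ $$(Q_yP_y-RfP_y-TR_y)f_y-6f_y^3P_y-Rf_y^2P-R(QP_y-RT)=0,$$ $$Rf_yQP_yT_z-Q_yf_yQTP_y-RQ_zf_yTP_y-f_y^2T(3f^2+2P+g_y)RP_y+Rf_y^2fP_yT_z+2Q_yf_y^2fTP_y-4Rf_y^2QTP$$ $$-Q_yf_y^2P_yT_z-R^2f_yfT^2+Rf_y^3PT_z+RQ^2TP_y+RQTP_y^2-Q_yf_yTP_y^2-f_y^3T(5Pf+7T)R+3RQ_yf_yT^2$$ $$+2Q_yf_y^3TP-12f_y^3QTP_y-18f_y^4fTP_y+f_y^2TQ_{zy}P_y+6f_y^4P_yT_z-2R^2QT^2-6f_y^3TP_y^2-f_y^2Q_{yy}T^2$$ $$-18f_y^5TP-3Rf_yQfTP_y=0,$$ $$28f_y^5gP^2-2P_y^2\left(9PT-9Tf^2+3Tg_y+g_zP_y\right)f_y^2-4T_{zz}f_y^4P$$ $$+2P_y\left(2f^2gP_y+18PTf-6PgP_y+fP_yg_z-gP_yg_y-4T^2-3Tf^3\right)f_y^3-\left(15PTf+12PgP_y+4T^2\right)f_y^3Q$$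 $$+Rf_y^2T_z^2+(18Pf+4T)f_y^4T_z+RQ^2T^2+2T_{zz}f_y^2P_y^2-5Rf_yTP_yT_z+15Rf_y^3gTP-2f_y^2QfP_yT_z$$ $$-2Rf_yQTT_z-2T_{zz}f_y^3fP_y+2R^2f_ygT^2+TP_y(15Tf-gP_y)f_yR-12f_y^2fP_y^2T_z+2P_y(4f^2-P+g_y)f_y^3T_z$$ $$+4Q_zf_y^3TP+5f_y^3QPT_z-5f_y^2Q^2TP-2Q_yf_yT^2P_y+2RQT^2P_y$$ $$-P_y\left(3Tf^2+4fgP_y+19PT+3Tg_y+g_zP_y\right)f_y^2Q-T(Tf+gP_y)f_y^2Q_y-T_{zz}Rf_y^2T+Q_yf_y^2TT_z-Q_yf_yQT^2$$ $$+RQ_zf_yT^2+P_y(3Tf+gP_y)Q_zf_y^2-Rf_yQgTP_y+T\left(7fgP_y-2Tf^2+23PT+Tg_y+g_zP_y\right)f_y^2R$$ $$+(2Tf-gP_y)f_y^2RT_z+T_{zz}f_y^2QP_y-Q_zf_y^2P_yT_z+3R^2T^3$$ $$+\left(20PfgP_y-14PTf^2+44P^2T+4PTg_y+4PP_yg_z-4T^2f-4TgP_y\right)f_y^4=0.$$ 4) $f_z-g_y=0$. 5) $f_y\neq0$, $T\neq0$, $R\neq0$, and $$RT+4f_y^2P-2P_y^2+(2ff_y-Q)P_y=0,\qquad RP_y-f_yP_{yy}=0,$$ $$f_y\left(QP_y-4Pf_y^2-2fP_yf_y+2P_y^2\right)R_y-R\left(2RP_y^2-5PRf_y^2-3RfP_yf_y-6P_yf_y^3+Q_yP_yf_y\right)=0,$$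 $$gf_yR^2P_y+2Rf_y^3fP+(5PQ+2PP_y+2g_yP_y)Rf_y^2-8f_y^4fP_y+P_y(2Qf-2fP_y-Q_z)Rf_y-P_y^2(Q+2P_y)R$$ $$-16f_y^5P+\left(4QP_y-4PQ_y+8P_y^2\right)f_y^3-2Q_yf_y^2fP_y+Q_yP_y(Q+2P_y)f_y=0.$$ 6) $T\neq0$, $D\neq0$, $R\neq0$, and $$f_{yz}-g_{yy}=0,\qquad (2fg_y-2ff_z+f_{zz}-g_{zy})R+3(f_z-g_y)f_y^2=0,$$ $$gR^3+(3f_yg_y+3fQ+3Q_z)R^2-\left(27Qf_y^2+3ff_yQ_y+3f_yQ_{zy}+6QQ_y\right)R+6f_yQ_y(3f_y^2+Q_y)=0,$$ $$4R^2-3f_yR_y=0,\qquad 3f_y^2Q_{yy}+4QR^2-8Rf_yQ_y=0.$$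
   Context: Subscripts $z,y$ on functions of $(z,y)$ denote partial derivatives. Notation: $$S=g_{yyy}f_y+f_{yy}f_{zy}-f_{yy}g_{yy}-f_{zyy}f_y,\quad P=f_z-g_y,\quad Q=g_{yy},\quad R=f_{yy},$$ $$T=f_{zz}-g_{yz}-2ff_z+2fg_y,\qquad D=4Pf_y^2+2fP_yf_y-QP_y+RT-2P_y^2.$$ Conventions. All functions are analytic. "$X=0$" means that $X$ vanishes identically; "$X\neq0$", or "nonzero function", means that $X$ is not identically zero. Existence of first integrals and of Lax representations is local: (I) and (II) mean that the functions $A,B$ (respectively $F,U$) exist, are $\mathbb K$-valued and analytic, on some nonempty open subset of $\Omega$. First integral: $I=(y_z+A(z,y))^2+B(z,y)$ is a first integral of $( * )$ if its total derivative with respect to $z$ along $( * )$ vanishes identically, i.e. $\left(\partial_z+y_z\partial_y-(f y_z+g)\,\partial_{y_z}\right)I=0$ identically in $z,y,y_z$ regarded as independent variables. Lax representation: in $L_z=[L,M]=LM-ML$, $L_z$ is the entrywise total derivative with respect to $z$. Equation $( * )$ admits the Lax representation with given $F,U$ if $L_z=[L,M]$ holds identically in $z,y,y_z$ once $y_{zz}$ is replaced by $-f y_z-g$. *)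

theory Defs
  imports "HOL-Analysis.Analysis" "HOL-Library.Function_Algebras"
begin

text \<open>
  Analyticity of a function of two variables over a normed field (used for the reals and the
  complex numbers): near every point of \<open>X\<close> the function is the sum of a convergent double
  power series. Convergence is unconditional, which for these two fields is absolute convergence.
\<close>

definition analytic2_on :: "('a \<times> 'a \<Rightarrow> 'a::real_normed_field) \<Rightarrow> ('a \<times> 'a) set \<Rightarrow> bool"
    (infix \<open>analytic2'_on\<close> 50) where
  "h analytic2_on X \<longleftrightarrow>
    (\<forall>(z, y)\<in>X. \<exists>(c :: nat \<times> nat \<Rightarrow> 'a) r. r > 0 \<and>
      (\<forall>s t. norm s < r \<longrightarrow> norm t < r \<longrightarrow>
        ((\<lambda>(i, j). c (i, j) * s ^ i * t ^ j) has_sum h (z + s, y + t)) UNIV))"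

definition partial_z :: "('a \<times> 'a \<Rightarrow> 'a) \<Rightarrow> 'a \<times> 'a \<Rightarrow> 'a::real_normed_field" (\<open>\<partial>z\<close>) where
  "\<partial>z h = (\<lambda>(z, y). deriv (\<lambda>t. h (t, y)) z)"

definition partial_y :: "('a \<times> 'a \<Rightarrow> 'a) \<Rightarrow> 'a \<times> 'a \<Rightarrow> 'a::real_normed_field" (\<open>\<partial>y\<close>) where
  "\<partial>y h = (\<lambda>(z, y). deriv (\<lambda>t. h (z, t)) y)"

text \<open>
  The equation \<open>y_zz + f (z, y) * y_z + g (z, y) = 0\<close> on \<open>\<Omega>\<close>. A phase function \<open>H\<close> takes the
  point \<open>x = (z, y)\<close> and the independent variable \<open>v\<close> that stands for \<open>y_z\<close>.

  Inside this locale, arithmetic on functions of \<open>(z, y)\<close> is the pointwise arithmetic of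
  \<^theory>\<open>HOL-Library.Function_Algebras\<close>; in particular numerals are constant functions.
  Multiple subscripts are read from left to right: \<open>h_zy\<close> is the \<open>y\<close>-derivative of \<open>h_z\<close>.
\<close>

locale equation =
  fixes \<Omega> :: "('a::real_normed_field \<times> 'a) set"
    and f g :: "'a \<times> 'a \<Rightarrow> 'a"
begin

definition total_deriv :: "('a \<times> 'a \<Rightarrow> 'a \<Rightarrow> 'a) \<Rightarrow> 'a \<times> 'a \<Rightarrow> 'a \<Rightarrow> 'a" where
  "total_deriv H x v =
    \<partial>z (\<lambda>x. H x v) x + v * \<partial>y (\<lambda>x. H x v) x - (f x * v + g x) * deriv (H x) v"

definition first_integral_on :: "('a \<times> 'a) set \<Rightarrow> ('a \<times> 'a \<Rightarrow> 'a \<Rightarrow> 'a) \<Rightarrow> bool" where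
  "first_integral_on V H \<longleftrightarrow> (\<forall>x\<in>V. \<forall>v. total_deriv H x v = 0)"

definition has_quadratic_first_integral :: bool where
  "has_quadratic_first_integral \<longleftrightarrow>
    (\<exists>V A B. open V \<and> V \<noteq> {} \<and> V \<subseteq> \<Omega> \<and> A analytic2_on V \<and> B analytic2_on V \<and>
      first_integral_on V (\<lambda>x v. (v + A x)\<^sup>2 + B x))"

definition lax_L :: "('a \<times> 'a \<Rightarrow> 'a) \<Rightarrow> ('a \<times> 'a \<Rightarrow> 'a) \<Rightarrow> 'a \<times> 'a \<Rightarrow> 'a \<Rightarrow> 'a^2^2" where
  "lax_L F U x v = vector [vector [v + F x, U x], vector [U x, - v - F x]]"

definition lax_M :: "('a \<times> 'a \<Rightarrow> 'a) \<Rightarrow> 'a \<times> 'a \<Rightarrow> 'a \<Rightarrow> 'a^2^2" where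
  "lax_M U x v = vector [vector [0, 1/2 * \<partial>y U x], vector [- (1/2) * \<partial>y U x, 0]]"

definition lax_representation_on ::
    "('a \<times> 'a) set \<Rightarrow> ('a \<times> 'a \<Rightarrow> 'a \<Rightarrow> 'a^2^2) \<Rightarrow> ('a \<times> 'a \<Rightarrow> 'a \<Rightarrow> 'a^2^2) \<Rightarrow> bool" where
  "lax_representation_on V L M \<longleftrightarrow>
    (\<forall>x\<in>V. \<forall>v. (\<chi> i j. total_deriv (\<lambda>x v. L x v $ i $ j) x v) = L x v ** M x v - M x v ** L x v)"

definition has_lax_representation :: bool where
  "has_lax_representation \<longleftrightarrow>
    (\<exists>V F U. open V \<and> V \<noteq> {} \<and> V \<subseteq> \<Omega> \<and> F analytic2_on V \<and> U analytic2_on V \<and>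
      (\<exists>x\<in>V. F x \<noteq> 0) \<and> (\<exists>x\<in>V. U x \<noteq> 0) \<and>
      lax_representation_on V (lax_L F U) (lax_M U))"

abbreviation vanishes :: "('a \<times> 'a \<Rightarrow> 'a) \<Rightarrow> bool" where
  "vanishes h \<equiv> \<forall>x\<in>\<Omega>. h x = 0"

abbreviation nonzero :: "('a \<times> 'a \<Rightarrow> 'a) \<Rightarrow> bool" where
  "nonzero h \<equiv> \<exists>x\<in>\<Omega>. h x \<noteq> 0"

abbreviation "f_y \<equiv> \<partial>y f"
abbreviation "f_z \<equiv> \<partial>z f"
abbreviation "f_yy \<equiv> \<partial>y (\<partial>y f)"
abbreviation "f_yz \<equiv> \<partial>z (\<partial>y f)"
abbreviation "f_zy \<equiv> \<partial>y (\<partial>z f)"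
abbreviation "f_zz \<equiv> \<partial>z (\<partial>z f)"
abbreviation "f_zyy \<equiv> \<partial>y (\<partial>y (\<partial>z f))"
abbreviation "g_y \<equiv> \<partial>y g"
abbreviation "g_z \<equiv> \<partial>z g"
abbreviation "g_yy \<equiv> \<partial>y (\<partial>y g)"
abbreviation "g_yz \<equiv> \<partial>z (\<partial>y g)"
abbreviation "g_zy \<equiv> \<partial>y (\<partial>z g)"
abbreviation "g_yyy \<equiv> \<partial>y (\<partial>y (\<partial>y g))"

definition P :: "'a \<times> 'a \<Rightarrow> 'a" where
  "P = f_z - g_y"

definition Q :: "'a \<times> 'a \<Rightarrow> 'a" where
  "Q = g_yy"

definition R :: "'a \<times> 'a \<Rightarrow> 'a" where
  "R = f_yy"

definition S :: "'a \<times> 'a \<Rightarrow> 'a" where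
  "S = g_yyy*f_y + f_yy*f_zy - f_yy*g_yy - f_zyy*f_y"

definition T :: "'a \<times> 'a \<Rightarrow> 'a" where
  "T = f_zz - g_yz - 2*f*f_z + 2*f*g_y"

abbreviation "P_y \<equiv> \<partial>y P"
abbreviation "P_z \<equiv> \<partial>z P"
abbreviation "P_yy \<equiv> \<partial>y (\<partial>y P)"
abbreviation "P_zy \<equiv> \<partial>y (\<partial>z P)"
abbreviation "P_zz \<equiv> \<partial>z (\<partial>z P)"
abbreviation "Q_y \<equiv> \<partial>y Q"
abbreviation "Q_z \<equiv> \<partial>z Q"
abbreviation "Q_yy \<equiv> \<partial>y (\<partial>y Q)"
abbreviation "Q_zy \<equiv> \<partial>y (\<partial>z Q)"
abbreviation "R_y \<equiv> \<partial>y R"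
abbreviation "R_z \<equiv> \<partial>z R"
abbreviation "S_y \<equiv> \<partial>y S"
abbreviation "S_z \<equiv> \<partial>z S"
abbreviation "T_y \<equiv> \<partial>y T"
abbreviation "T_z \<equiv> \<partial>z T"
abbreviation "T_zz \<equiv> \<partial>z (\<partial>z T)"

definition D :: "'a \<times> 'a \<Rightarrow> 'a" where
  "D = 4*P*f_y^2 + 2*f*P_y*f_y - Q*P_y + R*T - 2*P_y^2"

definition condition_1 :: bool where
  "condition_1 \<longleftrightarrow>
    nonzero f_y \<and>
    nonzero S \<and>
    vanishes ((f*P_y*f_y - P*f_y^2 + Q*P_y + 2*P_y^2 - f_y*P_zy)*(2*P*R*f - 3*P*f_y^2 - 3*f*P_y*f_y - R*P_z + f_y*P_zy)
      - (2*P*f^2*f_y - 2*P^2*f_y + 2*P*Q*f + 4*P*f*P_y - 2*P*f_y*g_y - 3*f*P_z*f_y - g*P_y*f_y - Q*P_z - 2*P_z*P_y + f_y*P_zz)*S) \<and>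
    vanishes (S^2*P_y + (4*f*f_y + Q)*S^2 - S*S_z*f_y + f_y*(2*P*f - P_z)*R_y*S - R*P_y^2*S + (f_y*R_z - 4*R*f*f_y - 6*f_y^3 - Q*R)*P_y*S
      - f_y*R*(4*P*f_y - P_zy)*S + 3*S_y*f_y^2*f*P_y - S_y*f_y*(2*P*R*f - 3*P*f_y^2 - R*P_z + P_zy*f_y))"

definition condition_2 :: bool where
  "condition_2 \<longleftrightarrow>
    vanishes f_y \<and>
    nonzero g_yy \<and>
    vanishes (2*Q*Q_z + 2*T*Q_y - 6*Q^2*f) \<and>
    vanishes ((f*g - g_z)*Q^5 + 3*Q_y*T*(3*T*f - T_z)*Q^2 + (4*T*f_z - 12*T*f^2 - T*g_y + 7*f*T_z - T_zz)*Q^4 + Q_yy*T^3*Q - 3*Q_y^2*T^3)"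

definition condition_3 :: bool where
  "condition_3 \<longleftrightarrow>
    nonzero f_y \<and>
    nonzero P_y \<and>
    nonzero T \<and>
    nonzero D \<and>
    vanishes (R*P_y - f_y*P_yy) \<and>
    vanishes (P*f_y^2 + f*P_y*f_y + R*T - f_y*T_y) \<and>
    vanishes ((Q_y*P_y - R*f*P_y - T*R_y)*f_y - 6*f_y^3*P_y - R*f_y^2*P - R*(Q*P_y - R*T)) \<and>
    vanishes (R*f_y*Q*P_y*T_z - Q_y*f_y*Q*T*P_y - R*Q_z*f_y*T*P_y - f_y^2*T*(3*f^2 + 2*P + g_y)*R*P_y + R*f_y^2*f*P_y*T_z + 2*Q_y*f_y^2*f*T*P_y - 4*R*f_y^2*Q*T*P
      - Q_y*f_y^2*P_y*T_z - R^2*f_y*f*T^2 + R*f_y^3*P*T_z + R*Q^2*T*P_y + R*Q*T*P_y^2 - Q_y*f_y*T*P_y^2 - f_y^3*T*(5*P*f + 7*T)*R + 3*R*Q_y*f_y*T^2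
      + 2*Q_y*f_y^3*T*P - 12*f_y^3*Q*T*P_y - 18*f_y^4*f*T*P_y + f_y^2*T*Q_zy*P_y + 6*f_y^4*P_y*T_z - 2*R^2*Q*T^2 - 6*f_y^3*T*P_y^2 - f_y^2*Q_yy*T^2
      - 18*f_y^5*T*P - 3*R*f_y*Q*f*T*P_y) \<and>
    vanishes (28*f_y^5*g*P^2 - 2*P_y^2*(9*P*T - 9*T*f^2 + 3*T*g_y + g_z*P_y)*f_y^2 - 4*T_zz*f_y^4*P
      + 2*P_y*(2*f^2*g*P_y + 18*P*T*f - 6*P*g*P_y + f*P_y*g_z - g*P_y*g_y - 4*T^2 - 3*T*f^3)*f_y^3 - (15*P*T*f + 12*P*g*P_y + 4*T^2)*f_y^3*Q
      + R*f_y^2*T_z^2 + (18*P*f + 4*T)*f_y^4*T_z + R*Q^2*T^2 + 2*T_zz*f_y^2*P_y^2 - 5*R*f_y*T*P_y*T_z + 15*R*f_y^3*g*T*P - 2*f_y^2*Q*f*P_y*T_z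
      - 2*R*f_y*Q*T*T_z - 2*T_zz*f_y^3*f*P_y + 2*R^2*f_y*g*T^2 + T*P_y*(15*T*f - g*P_y)*f_y*R - 12*f_y^2*f*P_y^2*T_z + 2*P_y*(4*f^2 - P + g_y)*f_y^3*T_z
      + 4*Q_z*f_y^3*T*P + 5*f_y^3*Q*P*T_z - 5*f_y^2*Q^2*T*P - 2*Q_y*f_y*T^2*P_y + 2*R*Q*T^2*P_y
      - P_y*(3*T*f^2 + 4*f*g*P_y + 19*P*T + 3*T*g_y + g_z*P_y)*f_y^2*Q - T*(T*f + g*P_y)*f_y^2*Q_y - T_zz*R*f_y^2*T + Q_y*f_y^2*T*T_z - Q_y*f_y*Q*T^2
      + R*Q_z*f_y*T^2 + P_y*(3*T*f + g*P_y)*Q_z*f_y^2 - R*f_y*Q*g*T*P_y + T*(7*f*g*P_y - 2*T*f^2 + 23*P*T + T*g_y + g_z*P_y)*f_y^2*R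
      + (2*T*f - g*P_y)*f_y^2*R*T_z + T_zz*f_y^2*Q*P_y - Q_z*f_y^2*P_y*T_z + 3*R^2*T^3
      + (20*P*f*g*P_y - 14*P*T*f^2 + 44*P^2*T + 4*P*T*g_y + 4*P*P_y*g_z - 4*T^2*f - 4*T*g*P_y)*f_y^4)"

definition condition_4 :: bool where
  "condition_4 \<longleftrightarrow>
    vanishes (f_z - g_y)"

definition condition_5 :: bool where
  "condition_5 \<longleftrightarrow>
    nonzero f_y \<and>
    nonzero T \<and>
    nonzero R \<and>
    vanishes (R*T + 4*f_y^2*P - 2*P_y^2 + (2*f*f_y - Q)*P_y) \<and>
    vanishes (R*P_y - f_y*P_yy) \<and>
    vanishes (f_y*(Q*P_y - 4*P*f_y^2 - 2*f*P_y*f_y + 2*P_y^2)*R_y - R*(2*R*P_y^2 - 5*P*R*f_y^2 - 3*R*f*P_y*f_y - 6*P_y*f_y^3 + Q_y*P_y*f_y)) \<and>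
    vanishes (g*f_y*R^2*P_y + 2*R*f_y^3*f*P + (5*P*Q + 2*P*P_y + 2*g_y*P_y)*R*f_y^2 - 8*f_y^4*f*P_y + P_y*(2*Q*f - 2*f*P_y - Q_z)*R*f_y - P_y^2*(Q + 2*P_y)*R
      - 16*f_y^5*P + (4*Q*P_y - 4*P*Q_y + 8*P_y^2)*f_y^3 - 2*Q_y*f_y^2*f*P_y + Q_y*P_y*(Q + 2*P_y)*f_y)"

definition condition_6 :: bool where
  "condition_6 \<longleftrightarrow>
    nonzero T \<and>
    nonzero D \<and>
    nonzero R \<and>
    vanishes (f_yz - g_yy) \<and>
    vanishes ((2*f*g_y - 2*f*f_z + f_zz - g_zy)*R + 3*(f_z - g_y)*f_y^2) \<and>
    vanishes (g*R^3 + (3*f_y*g_y + 3*f*Q + 3*Q_z)*R^2 - (27*Q*f_y^2 + 3*f*f_y*Q_y + 3*f_y*Q_zy + 6*Q*Q_y)*R + 6*f_y*Q_y*(3*f_y^2 + Q_y)) \<and>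
    vanishes (4*R^2 - 3*f_y*R_y) \<and>
    vanishes (3*f_y^2*Q_yy + 4*Q*R^2 - 8*R*f_y*Q_y)"

definition coefficient_conditions :: bool where
  "coefficient_conditions \<longleftrightarrow>
    condition_1 \<or> condition_2 \<or> condition_3 \<or> condition_4 \<or> condition_5 \<or> condition_6"

end

end

theory Submission
  imports Defs
begin

text \<open>
  Put \<open>w = g - A_z\<close>. Comparing coefficients of \<open>y_z\<close>, the function \<open>(y_z + A)^2 + B\<close> is a first
  integral iff \<open>A_y = f\<close>, \<open>B_y = 2 w\<close> and \<open>B_z = 2 A w\<close>; hence \<open>B\<close> exists iff \<open>w_y = - P\<close> and
  \<open>w_z = f w - A P\<close>. The Lax equations are the same system with \<open>F = A\<close> and \<open>U^2 = B\<close>, where \<open>B\<close>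
  may be shifted by a constant to be nonzero. The system for \<open>(A, w)\<close> prescribes all first derivatives,
  and its integrability condition is the linear constraint \<open>P_y A - f_y w = T\<close>. The \<open>y\<close>-derivative
  of the constraint is a second linear equation for \<open>(A, w)\<close>, with determinant \<open>- S\<close> against the
  first; if \<open>S = 0\<close>, the \<open>z\<close>-derivative of the constraint gives an equation with determinant
  proportional to \<open>D\<close>. So either \<open>A\<close> is a rational function of the jets (conditions 1 and 2, and
  3 and 6 when \<open>S = 0\<close>), and the conditions say that this function solves the system, or
  \<open>S = D = 0\<close> (condition 5) and the constraint is compatible with its derivatives, so that a linear
  equation for \<open>A\<close> remains; condition 4 is the case \<open>w = 0\<close>. Identities found on a small open set
  spread to the whole domain by the identity theorem.
\<close>

section \<open>Absolutely convergent double power series\<close>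

text \<open>The real and the complex case are treated at once, over a complete real normed field, so
  all analysis is done with absolutely convergent double series. What is needed of it is closure
  under algebra and differentiation, the identity theorem, and local potentials of closed forms.
  Most of the long polynomials in the conditions are one equation of the system for
  \<open>(A, w)\<close>, or one derivative of the constraint, with \<open>A\<close> and
  \<open>w\<close> eliminated and the denominators (powers of \<open>S\<close>, \<open>Q\<close>,
  \<open>D\<close>, \<open>R\<close>, \<open>f_y\<close>) cleared. Hence the same polynomial
  identity serves twice: a solution makes the polynomial vanish, and conversely, on a small open set
  without zeros of the denominators, its vanishing returns the differential equation. The conditions
  contain fewer equations than the system. The others are recovered from equality of mixed
  derivatives, which turns the two equations for \<open>A\<close> into \<open>w_y = - P\<close>, and
  from derivatives of the linear relations, where the defect of an equation is multiplied by a
  determinant that is nonzero in the case at hand.\<close>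

definition deg2 :: "nat \<times> nat \<Rightarrow> nat" where
  "deg2 p = fst p + snd p"

definition monom2 :: "'a \<times> 'a \<Rightarrow> nat \<times> nat \<Rightarrow> 'a::comm_monoid_mult" where
  "monom2 s p = fst s ^ fst p * snd s ^ snd p"

definition bidisc :: "real \<Rightarrow> ('a \<times> 'a::real_normed_vector) set" where
  "bidisc r = {s. norm (fst s) < r \<and> norm (snd s) < r}"

text \<open>Absolute summability is demanded at the radius \<open>r\<close> itself, so that the
  weighted sum of norms is a finite bound for the whole bidisc and each rearrangement below can be
  justified by one majorant that does not depend on the point.\<close>

definition expands ::
    "('a \<times> 'a \<Rightarrow> 'a::real_normed_field) \<Rightarrow> 'a \<times> 'a \<Rightarrow> (nat \<times> nat \<Rightarrow> 'a) \<Rightarrow> real \<Rightarrow> bool" where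
  "expands h x c r \<longleftrightarrow> 0 < r \<and> (\<lambda>p. norm (c p) * r ^ deg2 p) summable_on UNIV \<and>
    (\<forall>s\<in>bidisc r. ((\<lambda>p. c p * monom2 s p) has_sum h (x + s)) UNIV)"

lemma open_bidisc: "open (bidisc r)"
proof -
  have "bidisc r = ball 0 r \<times> ball 0 r"
    by (auto simp: bidisc_def)
  then show ?thesis
    by (metis open_Times open_ball)
qed

lemma zero_in_bidisc [simp]: "0 \<in> bidisc r \<longleftrightarrow> 0 < r"
  by (auto simp: bidisc_def)

lemma norm_monom2_le:
  fixes s :: "'a::real_normed_field \<times> 'a"
  assumes "norm (fst s) \<le> r" "norm (snd s) \<le> r"
  shows "norm (monom2 s p) \<le> r ^ deg2 p"
proof -
  have "0 \<le> r" using assms(1) norm_ge_zero order_trans by blast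
  then show ?thesis
    unfolding monom2_def deg2_def norm_mult norm_power power_add
    using assms by (intro mult_mono power_mono) auto
qed

section \<open>Rearrangement of absolutely convergent sums\<close>

lemma summable_on_norm_comparison:
  fixes f :: "'k \<Rightarrow> 'a::banach"
  assumes "g summable_on A" and "\<And>x. x \<in> A \<Longrightarrow> norm (f x) \<le> g x"
  shows "f abs_summable_on A" "f summable_on A"
proof -
  show "f abs_summable_on A"
    by (rule summable_on_comparison_test[OF assms(1)]) (use assms in auto)
  then show "f summable_on A"
    by (rule abs_summable_summable)
qed

lemma abs_fubini:
  fixes f :: "'k \<times> 'l \<Rightarrow> 'a::banach"
  assumes nrm: "\<And>x. x \<in> A \<Longrightarrow> ((\<lambda>y. norm (f (x, y))) has_sum G x) (B x)"
    and G: "G summable_on A"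
    and f: "\<And>x. x \<in> A \<Longrightarrow> ((\<lambda>y. f (x, y)) has_sum g x) (B x)"
    and g: "(g has_sum v) A"
  shows "f abs_summable_on Sigma A B" and "(f has_sum v) (Sigma A B)"
proof -
  show a: "f abs_summable_on Sigma A B"
    by (rule summable_on_SigmaI[OF nrm G]) auto
  show "(f has_sum v) (Sigma A B)"
    by (rule has_sum_SigmaI[OF f g]) (use a abs_summable_summable in auto)
qed

text \<open>Products, recentering and composition all produce a sum of monomials over some index set
  \<open>K\<close> other than the exponents (pairs, or lists of exponents). Collecting the terms of
  equal exponent \<open>\<pi> k\<close> brings such a sum back to a double power series with the
  same value and radius.\<close>

lemma regroup_monomials:
  fixes e :: "'k \<Rightarrow> 'a::{real_normed_field,banach}" and \<pi> :: "'k \<Rightarrow> nat \<times> nat"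
  assumes e: "(\<lambda>k. norm (e k) * r ^ deg2 (\<pi> k)) summable_on K" and r: "0 < r"
  defines "d \<equiv> \<lambda>p. infsum e {k\<in>K. \<pi> k = p}"
  shows "(\<lambda>p. norm (d p) * r ^ deg2 p) summable_on UNIV"
    and "((\<lambda>k. e k * monom2 s (\<pi> k)) has_sum v) K \<Longrightarrow> ((\<lambda>p. d p * monom2 s p) has_sum v) UNIV"
proof -
  let ?F = "\<lambda>p. {k\<in>K. \<pi> k = p}"
  have bij: "bij_betw snd (Sigma UNIV ?F) K"
    by (rule bij_betwI[of _ _ _ "\<lambda>k. (\<pi> k, k)"]) auto
  have ne: "(\<lambda>k. norm (e k)) summable_on ?F p" for p
  proof -
    have "(\<lambda>k. norm (e k) * r ^ deg2 (\<pi> k)) summable_on ?F p"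
      by (rule summable_on_subset[OF e]) auto
    also have "?this \<longleftrightarrow> (\<lambda>k. norm (e k) * r ^ deg2 p) summable_on ?F p"
      by (rule summable_on_cong) auto
    finally show ?thesis
      using r by (simp add: summable_on_cmult_left')
  qed
  have e_sum: "(e has_sum d p) (?F p)" for p
    unfolding d_def by (rule has_sum_infsum[OF abs_summable_summable[OF ne]])
  define N where "N = (\<lambda>p. infsum (\<lambda>k. norm (e k)) (?F p))"
  have N: "((\<lambda>k. norm (e k)) has_sum N p) (?F p)" for p
    unfolding N_def using ne by (rule has_sum_infsum)
  obtain V where "((\<lambda>k. norm (e k) * r ^ deg2 (\<pi> k)) has_sum V) K"
    using e by (auto simp: summable_on_def)
  then have "((\<lambda>x. norm (e (snd x)) * r ^ deg2 (\<pi> (snd x))) has_sum V) (Sigma UNIV ?F)"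
    by (subst has_sum_reindex_bij_betw[OF bij, of "\<lambda>k. norm (e k) * r ^ deg2 (\<pi> k)"])
  then have "((\<lambda>p. N p * r ^ deg2 p) has_sum V) UNIV"
  proof (rule has_sum_SigmaD)
    fix p
    show "((\<lambda>y. norm (e (snd (p, y))) * r ^ deg2 (\<pi> (snd (p, y)))) has_sum N p * r ^ deg2 p) (?F p)"
      by (rule has_sum_cong[THEN iffD1, OF _ has_sum_cmult_left[OF N]]) auto
  qed
  then have "(\<lambda>p. N p * r ^ deg2 p) summable_on UNIV"
    by (rule has_sum_imp_summable)
  then show "(\<lambda>p. norm (d p) * r ^ deg2 p) summable_on UNIV"
  proof (rule summable_on_comparison_test)
    fix p
    show "norm (d p) * r ^ deg2 p \<le> N p * r ^ deg2 p"
      using norm_has_sum_bound[OF N e_sum] r by (intro mult_right_mono) auto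
    show "0 \<le> norm (d p) * r ^ deg2 p"
      using r by auto
  qed
  assume "((\<lambda>k. e k * monom2 s (\<pi> k)) has_sum v) K"
  then have "((\<lambda>x. e (snd x) * monom2 s (\<pi> (snd x))) has_sum v) (Sigma UNIV ?F)"
    by (subst has_sum_reindex_bij_betw[OF bij, of "\<lambda>k. e k * monom2 s (\<pi> k)"])
  then show "((\<lambda>p. d p * monom2 s p) has_sum v) UNIV"
  proof (rule has_sum_SigmaD)
    fix p
    show "((\<lambda>y. e (snd (p, y)) * monom2 s (\<pi> (snd (p, y)))) has_sum d p * monom2 s p) (?F p)"
      by (rule has_sum_cong[THEN iffD1, OF _ has_sum_cmult_left[OF e_sum]]) auto
  qed
qed

lemma expandsD:
  assumes "expands h x c r"
  shows "0 < r" "(\<lambda>p. norm (c p) * r ^ deg2 p) summable_on UNIV"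
    "s \<in> bidisc r \<Longrightarrow> ((\<lambda>p. c p * monom2 s p) has_sum h (x + s)) UNIV"
  using assms by (auto simp: expands_def)

lemma expands_shrink:
  assumes "expands h x c r" "0 < r'" "r' \<le> r"
  shows "expands h x c r'"
  unfolding expands_def
proof (intro conjI ballI)
  show "(\<lambda>p. norm (c p) * r' ^ deg2 p) summable_on UNIV"
    by (rule summable_on_comparison_test[OF expandsD(2)[OF assms(1)]])
      (use assms in \<open>auto intro!: mult_left_mono power_mono\<close>)
  fix s :: "'a \<times> 'a" assume "s \<in> bidisc r'"
  then have "s \<in> bidisc r" using assms by (auto simp: bidisc_def)
  then show "((\<lambda>p. c p * monom2 s p) has_sum h (x + s)) UNIV"
    by (rule expandsD(3)[OF assms(1)])
qed (use assms in auto)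

lemma expands_abs_summable:
  fixes h :: "'a \<times> 'a \<Rightarrow> 'a::{real_normed_field,banach}"
  assumes "expands h x c r" "norm (fst s) \<le> r" "norm (snd s) \<le> r"
  shows "(\<lambda>p. norm (c p * monom2 s p)) summable_on UNIV"
  by (rule summable_on_norm_comparison(1)[OF expandsD(2)[OF assms(1)]])
     (auto simp: norm_mult intro!: mult_left_mono norm_monom2_le assms)

lemma expands_regroup:
  fixes e :: "'k \<Rightarrow> 'a::{real_normed_field,banach}" and \<pi> :: "'k \<Rightarrow> nat \<times> nat"
  assumes "(\<lambda>k. norm (e k) * r ^ deg2 (\<pi> k)) summable_on K" "0 < r"
    and "\<And>s. s \<in> bidisc r \<Longrightarrow> ((\<lambda>k. e k * monom2 s (\<pi> k)) has_sum h (x + s)) K"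
  shows "expands h x (\<lambda>p. infsum e {k\<in>K. \<pi> k = p}) r"
  using regroup_monomials[OF assms(1,2)] assms(2,3) unfolding expands_def by auto

text \<open>Beyond a finite set \<open>F\<close> all partial sums lie within distance 1 of the
  value, and a term outside \<open>F\<close> is a difference of two of them.\<close>

lemma has_sum_bounded_terms:
  fixes f :: "'k \<Rightarrow> 'a::real_normed_vector"
  assumes "(f has_sum v) A"
  obtains M where "0 \<le> M" "\<And>k. k \<in> A \<Longrightarrow> norm (f k) \<le> M"
proof -
  from assms have "\<forall>\<^sub>F F in finite_subsets_at_top A. dist (sum f F) v < 1"
    unfolding has_sum_def by (rule tendstoD) simp
  then obtain F where F: "finite F" "F \<subseteq> A"
      "\<And>G. finite G \<Longrightarrow> F \<subseteq> G \<Longrightarrow> G \<subseteq> A \<Longrightarrow> dist (sum f G) v < 1"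
    unfolding eventually_finite_subsets_at_top by metis
  show thesis
  proof (rule that[of "2 + sum (\<lambda>k. norm (f k)) F"])
    show "0 \<le> 2 + sum (\<lambda>k. norm (f k)) F"
      by (simp add: sum_nonneg)
    fix k assume k: "k \<in> A"
    show "norm (f k) \<le> 2 + sum (\<lambda>k. norm (f k)) F"
    proof (cases "k \<in> F")
      case True
      then have "norm (f k) \<le> sum (\<lambda>k. norm (f k)) F"
        by (intro member_le_sum) (use F in auto)
      then show ?thesis by simp
    next
      case False
      have "f k = sum f (insert k F) - sum f F"
        using False F by simp
      then have "norm (f k) = dist (sum f (insert k F)) (sum f F)"
        by (simp add: dist_norm)
      also have "\<dots> \<le> dist (sum f (insert k F)) v + dist (sum f F) v"
        by (rule dist_triangle2)
      also have "\<dots> < 1 + 1"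
        using F k by (intro add_strict_mono F(3)) auto
      finally show ?thesis
        using sum_nonneg[of F "\<lambda>k. norm (f k)"] by simp
    qed
  qed
qed

lemma summable_on_geometric_deg2:
  fixes q :: real
  assumes "0 \<le> q" "q < 1"
  shows "(\<lambda>p. q ^ deg2 p) summable_on UNIV"
proof -
  have g: "((\<lambda>n. q ^ n) has_sum (1 / (1 - q))) UNIV"
    by (rule norm_summable_imp_has_sum) (use assms geometric_sums[of q] in \<open>auto simp: norm_power intro!: summable_geometric\<close>)
  have "(\<lambda>p. q ^ deg2 p) summable_on Sigma UNIV (\<lambda>_. UNIV)"
  proof (rule summable_on_SigmaI)
    show "((\<lambda>y. q ^ deg2 (x, y)) has_sum q ^ x * (1 / (1 - q))) UNIV" for x
      using has_sum_cmult_right[OF g, of "q ^ x"] by (simp add: deg2_def power_add)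
    show "(\<lambda>x. q ^ x * (1 / (1 - q))) summable_on UNIV"
      by (intro summable_on_cmult_left has_sum_imp_summable[OF g])
  qed (use assms in auto)
  then show ?thesis by simp
qed

text \<open>As in Abel's lemma, convergence at the single point with both coordinates of norm
  \<open>r / 2\<close> bounds the terms there; at \<open>r / 4\<close> the geometric factor
  \<open>(1 / 2) ^ deg2 p\<close> makes the weighted sum of norms finite.\<close>

lemma analytic2_on_iff_expands:
  fixes h :: "'a \<times> 'a \<Rightarrow> 'a::{real_normed_field,banach}"
  shows "h analytic2_on X \<longleftrightarrow> (\<forall>x\<in>X. \<exists>c r. expands h x c r)"
proof (intro iffI ballI)
  fix x assume h: "h analytic2_on X" and x: "x \<in> X"
  obtain z y where zy: "x = (z, y)" by (cases x)
  from h x zy obtain c r where r: "r > 0" and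
    c: "\<And>s t. norm s < r \<Longrightarrow> norm t < r \<Longrightarrow>
        ((\<lambda>(i, j). c (i, j) * s ^ i * t ^ j) has_sum h (z + s, y + t)) UNIV"
    unfolding analytic2_on_def by blast
  define \<rho> where "\<rho> = (of_real (r / 2) :: 'a)"
  have n\<rho>: "norm \<rho> = r / 2" using r by (simp add: \<rho>_def)
  from c[of \<rho> \<rho>] r n\<rho> have "((\<lambda>(i, j). c (i, j) * \<rho> ^ i * \<rho> ^ j) has_sum h (z + \<rho>, y + \<rho>)) UNIV"
    by simp
  then obtain M where M: "0 \<le> M" "\<And>i j. norm (c (i, j) * \<rho> ^ i * \<rho> ^ j) \<le> M"
    by (rule has_sum_bounded_terms) auto
  have cM: "norm (c p) * (r / 2) ^ deg2 p \<le> M" for p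
    using M(2)[of "fst p" "snd p"] by (simp add: norm_mult norm_power n\<rho> deg2_def power_add mult.assoc)
  have "expands h x c (r / 4)"
    unfolding expands_def
  proof (intro conjI ballI)
    show "0 < r / 4" using r by simp
    have "(\<lambda>p. M * (1 / 2) ^ deg2 p) summable_on UNIV"
      by (intro summable_on_cmult_right summable_on_geometric_deg2) auto
    then show "(\<lambda>p. norm (c p) * (r / 4) ^ deg2 p) summable_on UNIV"
    proof (rule summable_on_comparison_test)
      fix p
      have "norm (c p) * (r / 4) ^ deg2 p = (norm (c p) * (r / 2) ^ deg2 p) * (1 / 2) ^ deg2 p"
      proof -
        have "r / 4 = r / 2 * (1 / 2)" by simp
        then show ?thesis
          by (simp only: power_mult_distrib mult.assoc)
      qed
      also have "\<dots> \<le> M * (1 / 2) ^ deg2 p"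
        using cM by (intro mult_right_mono) auto
      finally show "norm (c p) * (r / 4) ^ deg2 p \<le> M * (1 / 2) ^ deg2 p" .
    qed (use r in auto)
    fix s :: "'a \<times> 'a" assume "s \<in> bidisc (r / 4)"
    then have s: "norm (fst s) < r" "norm (snd s) < r" using r by (simp_all add: bidisc_def)
    have "((\<lambda>(i, j). c (i, j) * fst s ^ i * snd s ^ j) has_sum h (z + fst s, y + snd s)) UNIV"
      by (rule c[OF s])
    moreover have "(z + fst s, y + snd s) = x + s"
      by (simp add: zy prod_eq_iff)
    ultimately show "((\<lambda>p. c p * monom2 s p) has_sum h (x + s)) UNIV"
      by (simp add: monom2_def case_prod_unfold mult.assoc)
  qed
  then show "\<exists>c r. expands h x c r" by blast
next
  assume *: "\<forall>x\<in>X. \<exists>c r. expands h x c r"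
  show "h analytic2_on X"
    unfolding analytic2_on_def
  proof (clarify)
    fix z y assume "(z, y) \<in> X"
    with * obtain c r where e: "expands h (z, y) c r" by blast
    show "\<exists>(c :: nat \<times> nat \<Rightarrow> 'a) r. r > 0 \<and>
      (\<forall>s t. norm s < r \<longrightarrow> norm t < r \<longrightarrow>
        ((\<lambda>(i, j). c (i, j) * s ^ i * t ^ j) has_sum h (z + s, y + t)) UNIV)"
    proof (intro exI[of _ c] exI[of _ r] conjI allI impI)
      show "0 < r" by (rule expandsD(1)[OF e])
      fix s t :: 'a assume "norm s < r" "norm t < r"
      then show "((\<lambda>(i, j). c (i, j) * s ^ i * t ^ j) has_sum h (z + s, y + t)) UNIV"
        using expandsD(3)[OF e, of "(s, t)"]
        by (simp add: bidisc_def monom2_def case_prod_unfold mult.assoc)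
    qed
  qed
qed

lemma expands_const: "0 < r \<Longrightarrow> expands (\<lambda>_. k) x (\<lambda>p. if p = (0, 0) then k else 0) r"
  unfolding expands_def
  by (auto intro!: has_sum_finite_neutralI[of "{(0,0)}"] has_sum_imp_summable[where S = "norm k"]
      simp: monom2_def deg2_def split: if_splits)

lemma expands_add:
  assumes "expands h x c r" "expands k x d r"
  shows "expands (\<lambda>x. h x + k x) x (\<lambda>p. c p + d p) r"
  unfolding expands_def
proof (intro conjI ballI)
  have "(\<lambda>p. norm (c p) * r ^ deg2 p + norm (d p) * r ^ deg2 p) summable_on UNIV"
    using assms by (intro summable_on_add expandsD)
  then show "(\<lambda>p. norm (c p + d p) * r ^ deg2 p) summable_on UNIV"
  proof (rule summable_on_comparison_test)
    show "norm (c p + d p) * r ^ deg2 p \<le> norm (c p) * r ^ deg2 p + norm (d p) * r ^ deg2 p" for p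
      using expandsD(1)[OF assms(1)]
      by (simp add: mult_right_mono norm_triangle_ineq flip: distrib_right)
    show "0 \<le> norm (c p + d p) * r ^ deg2 p" for p
      using expandsD(1)[OF assms(1)] by auto
  qed
  fix s :: "'a \<times> 'a" assume "s \<in> bidisc r"
  then show "((\<lambda>p. (c p + d p) * monom2 s p) has_sum h (x + s) + k (x + s)) UNIV"
    using has_sum_add[OF expandsD(3)[OF assms(1)] expandsD(3)[OF assms(2)]]
    by (simp add: distrib_right)
qed (use expandsD[OF assms(1)] in auto)

lemma expands_mult:
  fixes h :: "'a \<times> 'a \<Rightarrow> 'a::{real_normed_field,banach}"
  assumes "expands h x c r" "expands k x d r"
  shows "\<exists>e. expands (\<lambda>x. h x * k x) x e r"
proof
  \<comment> \<open>The product is summed over pairs of exponents; the exponent of a pair is the sum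
    of its components.\<close>
  let ?\<pi> = "\<lambda>q :: (nat \<times> nat) \<times> (nat \<times> nat). (fst (fst q) + fst (snd q), snd (fst q) + snd (snd q))"
  let ?K = "Sigma UNIV (\<lambda>_. UNIV) :: ((nat \<times> nat) \<times> (nat \<times> nat)) set"
  note r = expandsD(1)[OF assms(1)]
  obtain C where C: "((\<lambda>p. norm (c p) * r ^ deg2 p) has_sum C) UNIV"
    using expandsD(2)[OF assms(1)] by (auto simp: summable_on_def)
  obtain D where D: "((\<lambda>p. norm (d p) * r ^ deg2 p) has_sum D) UNIV"
    using expandsD(2)[OF assms(2)] by (auto simp: summable_on_def)
  show "expands (\<lambda>x. h x * k x) x (\<lambda>p. infsum (\<lambda>q. c (fst q) * d (snd q)) {q\<in>?K. ?\<pi> q = p}) r"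
  proof (rule expands_regroup)
    have "(\<lambda>q. (norm (c (fst q)) * r ^ deg2 (fst q)) * (norm (d (snd q)) * r ^ deg2 (snd q))) summable_on ?K"
      by (rule summable_on_SigmaI[where g = "\<lambda>p. (norm (c p) * r ^ deg2 p) * D"])
        (use r in \<open>auto intro!: has_sum_cmult_right D summable_on_cmult_left has_sum_imp_summable[OF C]\<close>)
    then show "(\<lambda>q. norm (c (fst q) * d (snd q)) * r ^ deg2 (?\<pi> q)) summable_on ?K"
      by (rule summable_on_cong[THEN iffD1, rotated])
        (simp add: norm_mult deg2_def power_add algebra_simps)
    fix s :: "'a \<times> 'a" assume s: "s \<in> bidisc r"
    then have s': "norm (fst s) \<le> r" "norm (snd s) \<le> r" by (auto simp: bidisc_def)
    have n1: "(\<lambda>p. norm (c p * monom2 s p)) summable_on UNIV"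
      by (rule expands_abs_summable[OF assms(1) s'])
    have n2: "(\<lambda>p. norm (d p * monom2 s p)) summable_on UNIV"
      by (rule expands_abs_summable[OF assms(2) s'])
    have "((\<lambda>q. (c (fst q) * monom2 s (fst q)) * (d (snd q) * monom2 s (snd q)))
        has_sum h (x + s) * k (x + s)) ?K"
    proof (rule abs_fubini(2))
      fix p :: "nat \<times> nat"
      show "((\<lambda>y. norm (c (fst (p, y)) * monom2 s (fst (p, y)) * (d (snd (p, y)) * monom2 s (snd (p, y)))))
          has_sum norm (c p * monom2 s p) * (infsum (\<lambda>p. norm (d p * monom2 s p)) UNIV)) UNIV"
        using has_sum_cmult_right[OF has_sum_infsum[OF n2], of "norm (c p * monom2 s p)"]
        by (simp add: norm_mult)
      show "((\<lambda>y. c (fst (p, y)) * monom2 s (fst (p, y)) * (d (snd (p, y)) * monom2 s (snd (p, y))))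
          has_sum (c p * monom2 s p) * k (x + s)) UNIV"
        using has_sum_cmult_right[OF expandsD(3)[OF assms(2) s]] by simp
    next
      show "(\<lambda>p. norm (c p * monom2 s p) * (infsum (\<lambda>p. norm (d p * monom2 s p)) UNIV)) summable_on UNIV"
        by (intro summable_on_cmult_left n1)
      show "((\<lambda>p. c p * monom2 s p * k (x + s)) has_sum h (x + s) * k (x + s)) UNIV"
        by (intro has_sum_cmult_left expandsD(3)[OF assms(1) s])
    qed
    then show "((\<lambda>q. c (fst q) * d (snd q) * monom2 s (?\<pi> q)) has_sum h (x + s) * k (x + s)) ?K"
      by (rule has_sum_cong[THEN iffD1, rotated])
        (simp add: monom2_def power_add algebra_simps)
  qed (use r in auto)
qed

section \<open>Recentering, derivatives and the identity theorem\<close>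

lemma has_sum_binomial2:
  fixes a b :: "'a::real_normed_field"
  shows "((\<lambda>q. of_nat (i choose fst q) * a ^ (i - fst q) * (of_nat (j choose snd q) * b ^ (j - snd q)) * monom2 s q)
    has_sum (fst s + a) ^ i * (snd s + b) ^ j) UNIV"
proof (rule has_sum_finite_neutralI[of "{..i} \<times> {..j}"])
  have "(fst s + a) ^ i * (snd s + b) ^ j =
      (\<Sum>k\<le>i. of_nat (i choose k) * fst s ^ k * a ^ (i - k)) * (\<Sum>l\<le>j. of_nat (j choose l) * snd s ^ l * b ^ (j - l))"
    by (simp only: binomial_ring)
  also have "\<dots> = (\<Sum>q\<in>{..i} \<times> {..j}. of_nat (i choose fst q) * a ^ (i - fst q) * (of_nat (j choose snd q) * b ^ (j - snd q)) * monom2 s q)"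
    by (simp add: sum_product sum.cartesian_product case_prod_unfold monom2_def algebra_simps)
  finally show "(fst s + a) ^ i * (snd s + b) ^ j = (\<Sum>q\<in>{..i} \<times> {..j}. of_nat (i choose fst q) * a ^ (i - fst q) * (of_nat (j choose snd q) * b ^ (j - snd q)) * monom2 s q)" .
next
  fix q :: "nat \<times> nat" assume "q \<in> UNIV - {..i} \<times> {..j}"
  then have "i < fst q \<or> j < snd q" by (cases q) auto
  then show "of_nat (i choose fst q) * a ^ (i - fst q) * (of_nat (j choose snd q) * b ^ (j - snd q)) * monom2 s q = 0"
    by (auto simp: binomial_eq_0)
qed auto

text \<open>Each monomial is expanded by the binomial theorem around \<open>s0\<close>; the norms
  add up to at most \<open>norm (c p) * r ^ deg2 p\<close> because \<open>norm s0 + \<rho>\<close>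
  stays below \<open>r\<close> in each coordinate. The last two conclusions say that the new
  coefficient at \<open>(1, 0)\<close> is the termwise \<open>z\<close>-derivative at
  \<open>s0\<close>, absolutely summed. This is how the series of a derivative is obtained
  later.\<close>

lemma expands_recenter:
  fixes h :: "'a \<times> 'a \<Rightarrow> 'a::{real_normed_field,banach}"
  assumes h: "expands h x c r" and \<rho>: "0 < \<rho>"
    and s0: "norm (fst s0) + \<rho> \<le> r" "norm (snd s0) + \<rho> \<le> r"
  obtains d where "expands h (x + s0) d \<rho>"
    "(\<lambda>p. norm (c p * (of_nat (fst p) * fst s0 ^ (fst p - 1) * snd s0 ^ snd p))) summable_on UNIV"
    "((\<lambda>p. c p * (of_nat (fst p) * fst s0 ^ (fst p - 1) * snd s0 ^ snd p)) has_sum d (1, 0)) UNIV"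
proof -
  note r = expandsD(1)[OF h]
  let ?K = "Sigma UNIV (\<lambda>_. UNIV) :: ((nat \<times> nat) \<times> (nat \<times> nat)) set"
  define b where "b = (\<lambda>p q :: nat \<times> nat. of_nat (fst p choose fst q) * fst s0 ^ (fst p - fst q)
      * (of_nat (snd p choose snd q) * snd s0 ^ (snd p - snd q)))"
  define e where "e = (\<lambda>k. c (fst k) * b (fst k) (snd k))"
  have b_sum: "((\<lambda>q. b p q * monom2 s q) has_sum monom2 (s0 + s) p) UNIV" for p s
    using has_sum_binomial2[of "fst p" "fst s0" "snd p" "snd s0" s]
    by (simp add: b_def monom2_def add.commute)
  have b_norm: "((\<lambda>q. norm (b p q) * \<rho> ^ deg2 q) has_sum
      (norm (fst s0) + \<rho>) ^ fst p * (norm (snd s0) + \<rho>) ^ snd p) UNIV" for p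
    using has_sum_binomial2[of "fst p" "norm (fst s0)" "snd p" "norm (snd s0)" "(\<rho>, \<rho>)"]
    by (simp add: b_def monom2_def norm_mult norm_power deg2_def power_add add.commute)
  have G: "(\<lambda>p. norm (c p) * ((norm (fst s0) + \<rho>) ^ fst p * (norm (snd s0) + \<rho>) ^ snd p)) summable_on UNIV"
  proof (rule summable_on_comparison_test[OF expandsD(2)[OF h]])
    fix p
    show "norm (c p) * ((norm (fst s0) + \<rho>) ^ fst p * (norm (snd s0) + \<rho>) ^ snd p) \<le> norm (c p) * r ^ deg2 p"
      using s0 \<rho> r unfolding deg2_def power_add by (intro mult_left_mono mult_mono power_mono) auto
    show "0 \<le> norm (c p) * ((norm (fst s0) + \<rho>) ^ fst p * (norm (snd s0) + \<rho>) ^ snd p)"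
      using \<rho> by (intro mult_nonneg_nonneg zero_le_power) auto
  qed
  have e_norm: "(\<lambda>k. norm (e k) * \<rho> ^ deg2 (snd k)) summable_on ?K"
  proof (rule summable_on_SigmaI[OF _ G])
    show "((\<lambda>y. norm (e (p, y)) * \<rho> ^ deg2 (snd (p, y))) has_sum
       norm (c p) * ((norm (fst s0) + \<rho>) ^ fst p * (norm (snd s0) + \<rho>) ^ snd p)) UNIV" for p
      using has_sum_cmult_right[OF b_norm[of p], of "norm (c p)"]
      by (simp add: e_def norm_mult mult.assoc)
  qed (use \<rho> in auto)
  have exp: "expands h (x + s0) (\<lambda>p. infsum e {k\<in>?K. snd k = p}) \<rho>"
  proof (rule expands_regroup[OF e_norm \<rho>])
    fix s :: "'a \<times> 'a" assume s: "s \<in> bidisc \<rho>"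
    have s': "s0 + s \<in> bidisc r"
      using s s0 norm_triangle_ineq[of "fst s0" "fst s"] norm_triangle_ineq[of "snd s0" "snd s"]
      by (auto simp: bidisc_def)
    have abs: "(\<lambda>k. e k * monom2 s (snd k)) abs_summable_on ?K"
      by (rule summable_on_norm_comparison(1)[OF e_norm])
        (use s in \<open>auto simp: norm_mult bidisc_def intro!: mult_left_mono norm_monom2_le\<close>)
    show "((\<lambda>k. e k * monom2 s (snd k)) has_sum h (x + s0 + s)) ?K"
    proof (rule has_sum_SigmaI)
      show "((\<lambda>y. e (p, y) * monom2 s (snd (p, y))) has_sum c p * monom2 (s0 + s) p) UNIV" for p
        using has_sum_cmult_right[OF b_sum[of p s], of "c p"] by (simp add: e_def mult.assoc)
      show "((\<lambda>p. c p * monom2 (s0 + s) p) has_sum h (x + s0 + s)) UNIV"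
        using expandsD(3)[OF h s'] by (simp add: add.assoc)
    qed (use abs in \<open>rule abs_summable_summable\<close>)
  qed
  \<comment> \<open>The terms that contribute to the coefficient at \<open>(1, 0)\<close>: exactly
    one from each original monomial \<open>p\<close>.\<close>
  let ?F = "{k\<in>?K. snd k = (1, 0)}"
  have bij: "bij_betw (\<lambda>p. (p, (1, 0))) UNIV ?F"
    by (rule bij_betwI[of _ _ _ fst]) auto
  have "(\<lambda>k. norm (e k) * \<rho> ^ deg2 (snd k)) summable_on ?F"
    by (rule summable_on_subset[OF e_norm]) auto
  also have "?this \<longleftrightarrow> (\<lambda>k. norm (e k) * \<rho>) summable_on ?F"
    by (rule summable_on_cong) (auto simp: deg2_def)
  finally have "(\<lambda>k. norm (e k)) summable_on ?F"
    using \<rho> by (simp add: summable_on_cmult_left')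
  then have n10: "(\<lambda>p. norm (e (p, (1, 0)))) summable_on UNIV"
    using summable_on_reindex_bij_betw[OF bij, of "\<lambda>k. norm (e k)"] by blast
  have e10: "e (p, (1, 0)) = c p * (of_nat (fst p) * fst s0 ^ (fst p - 1) * snd s0 ^ snd p)" for p
    by (simp add: e_def b_def)
  have "infsum e ?F = infsum (\<lambda>p. e (p, (1, 0))) UNIV"
    by (rule infsum_reindex_bij_betw[OF bij, symmetric])
  then have "((\<lambda>p. e (p, (1, 0))) has_sum infsum e ?F) UNIV"
    using has_sum_infsum[OF abs_summable_summable[OF n10]] by simp
  with exp n10 show thesis
    unfolding e10 by (rule that)
qed

lemma expands_center:
  assumes "expands h x c r"
  shows "h x = c (0, 0)"
proof -
  have "((\<lambda>p. c p * monom2 0 p) has_sum c (0, 0)) UNIV"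
    by (rule has_sum_finite_neutralI[of "{(0, 0)}"]) (auto simp: monom2_def)
  moreover have "((\<lambda>p. c p * monom2 0 p) has_sum h (x + 0)) UNIV"
    by (rule expandsD(3)[OF assms]) (simp add: expandsD(1)[OF assms])
  ultimately show ?thesis
    using has_sum_unique by fastforce
qed

lemma expands_cong:
  assumes "expands h x c r" "\<And>s. s \<in> bidisc r \<Longrightarrow> h (x + s) = k (x + s)"
  shows "expands k x c r"
  using assms unfolding expands_def by simp

lemma expands_swap:
  assumes "expands h x c r"
  shows "expands (h \<circ> prod.swap) (prod.swap x) (c \<circ> prod.swap) r"
  unfolding expands_def
proof (intro conjI ballI)
  show "0 < r" by (rule expandsD[OF assms])
  have bij: "bij_betw prod.swap (UNIV :: (nat \<times> nat) set) UNIV"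
    by (rule bij_swap)
  show "(\<lambda>p. norm ((c \<circ> prod.swap) p) * r ^ deg2 p) summable_on UNIV"
    using expandsD(2)[OF assms] summable_on_reindex_bij_betw[OF bij, of "\<lambda>p. norm (c p) * r ^ deg2 p"]
    by (simp add: deg2_def add.commute)
  fix s :: "'a \<times> 'a" assume "s \<in> bidisc r"
  then have "prod.swap s \<in> bidisc r" by (auto simp: bidisc_def)
  from expandsD(3)[OF assms this]
  show "((\<lambda>p. (c \<circ> prod.swap) p * monom2 s p) has_sum (h \<circ> prod.swap) (prod.swap x + s)) UNIV"
    using has_sum_reindex_bij_betw[OF bij, of "\<lambda>p. c p * monom2 (prod.swap s) p"]
    by (simp add: monom2_def mult.commute prod.swap_def plus_prod_def)
qed

lemma partial_y_swap: "\<partial>y h x = \<partial>z (h \<circ> prod.swap) (prod.swap x)"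
  by (cases x) (simp add: partial_y_def partial_z_def)

text \<open>On the line where \<open>y\<close> is fixed only the terms with second exponent 0
  survive, and a one-variable power series may be differentiated termwise at its centre.\<close>

lemma expands_DERIV_z:
  fixes h :: "'a \<times> 'a \<Rightarrow> 'a::{real_normed_field,banach}"
  assumes h: "expands h x c r"
  shows "((\<lambda>t. h (t, snd x)) has_field_derivative c (1, 0)) (at (fst x))"
proof -
  note r = expandsD(1)[OF h]
  have sums: "(\<lambda>i. c (i, 0) * t ^ i) sums h (fst x + t, snd x)" if "norm t < r" for t
  proof -
    have "((\<lambda>p. c p * monom2 (t, 0) p) has_sum h (x + (t, 0))) UNIV"
      using expandsD(3)[OF h, of "(t, 0)"] that r by (simp add: bidisc_def)
    also have "?this \<longleftrightarrow> ((\<lambda>p. c p * monom2 (t, 0) p) has_sum h (x + (t, 0))) (range (\<lambda>i. (i, 0)))"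
      by (rule has_sum_cong_neutral) (auto simp: monom2_def)
    also have "\<dots> \<longleftrightarrow> ((\<lambda>i. c (i, 0) * t ^ i) has_sum h (x + (t, 0))) UNIV"
      by (subst has_sum_reindex) (auto simp: inj_on_def o_def monom2_def)
    finally show ?thesis
      by (auto dest!: has_sum_imp_sums simp: plus_prod_def)
  qed
  have "((\<lambda>t. \<Sum>i. c (i, 0) * t ^ i) has_field_derivative (\<Sum>i. diffs (\<lambda>i. c (i, 0)) i * 0 ^ i)) (at 0)"
    by (rule termdiffs_strong'[where K = r]) (use sums r in \<open>auto simp: sums_iff\<close>)
  then have "((\<lambda>t. \<Sum>i. c (i, 0) * t ^ i) has_field_derivative c (1, 0)) (at 0)"
    by (simp add: diffs_def)
  then have "((\<lambda>t. h (fst x + t, snd x)) has_field_derivative c (1, 0)) (at 0)"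
  proof (rule has_field_derivative_transform_within_open[of _ _ _ "ball 0 r"])
    show "(\<Sum>i. c (i, 0) * t ^ i) = h (fst x + t, snd x)" if "t \<in> ball 0 r" for t
      using sums[of t] that by (simp add: sums_iff)
  qed (use r in auto)
  then show ?thesis
    using DERIV_shift[of "\<lambda>t. h (t, snd x)" "c (1, 0)" 0 "fst x"] by (simp add: add.commute)
qed

lemma expands_partial_z_center:
  fixes h :: "'a \<times> 'a \<Rightarrow> 'a::{real_normed_field,banach}"
  assumes h: "expands h x c r"
  shows "\<partial>z h x = c (1, 0)"
  using DERIV_imp_deriv[OF expands_DERIV_z[OF h]] by (simp add: partial_z_def case_prod_unfold)

lemma expands_partial_z:
  fixes h :: "'a \<times> 'a \<Rightarrow> 'a::{real_normed_field,banach}"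
  assumes h: "expands h x c r" and r': "0 < r'" "r' < r"
  shows "expands (\<partial>z h) x (\<lambda>p. of_nat (Suc (fst p)) * c (Suc (fst p), snd p)) r'"
proof -
  let ?D = "\<lambda>s p. c p * (of_nat (fst p) * fst s ^ (fst p - 1) * snd s ^ snd p)"
  let ?c = "\<lambda>p. of_nat (Suc (fst p)) * c (Suc (fst p), snd p)"
  let ?S = "\<lambda>p :: nat \<times> nat. (Suc (fst p), snd p)"
  have inj: "inj ?S" by (auto simp: inj_on_def prod_eq_iff)
  \<comment> \<open>The differentiated terms with first exponent 0 vanish, so the series can be
    reindexed by the lowered exponent.\<close>
  have shift: "(f has_sum v) UNIV \<longleftrightarrow> ((\<lambda>p. f (?S p)) has_sum v) UNIV"
    if "\<And>j. f (0, j) = 0" for f :: "nat \<times> nat \<Rightarrow> 'b::{topological_comm_monoid_add}" and v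
  proof -
    have "(f has_sum v) UNIV \<longleftrightarrow> (f has_sum v) (range ?S)"
    proof (rule has_sum_cong_neutral)
      fix p assume "p \<in> UNIV - range ?S"
      then have "fst p = 0" by (cases p; cases "fst p") (auto simp: image_iff)
      then show "f p = 0" using that by (cases p) auto
    qed auto
    then show ?thesis
      by (simp add: has_sum_reindex[OF inj] o_def)
  qed
  show ?thesis
    unfolding expands_def
  proof (intro conjI ballI)
    show "0 < r'" by fact
    \<comment> \<open>At this point the absolute sum of the differentiated terms is, after
      reindexing, the weighted coefficient sum at radius \<open>r'\<close>.\<close>
    define s where "s = (of_real r' :: 'a, of_real r' :: 'a)"
    obtain d where "(\<lambda>p. norm (?D s p)) summable_on UNIV"
      by (rule expands_recenter[OF h, of "r - r'" s]) (use r' in \<open>auto simp: s_def\<close>)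
    then have "(\<lambda>p. norm (?D s (?S p))) summable_on UNIV"
      unfolding summable_on_def by (subst shift[symmetric]) auto
    then show "(\<lambda>p. norm (?c p) * r' ^ deg2 p) summable_on UNIV"
      by (rule summable_on_cong[THEN iffD1, rotated])
        (use r' in \<open>simp add: s_def norm_mult norm_power deg2_def power_add algebra_simps del: of_nat_Suc\<close>)
  next
    fix s :: "'a \<times> 'a" assume s: "s \<in> bidisc r'"
    obtain d where d: "expands h (x + s) d (r - r')" and "(?D s has_sum d (1, 0)) UNIV"
      by (rule expands_recenter[OF h, of "r - r'" s]) (use r' s in \<open>auto simp: bidisc_def\<close>)
    then have "((\<lambda>p. ?D s (?S p)) has_sum d (1, 0)) UNIV"
      by (subst shift[symmetric]) auto
    then show "((\<lambda>p. ?c p * monom2 s p) has_sum \<partial>z h (x + s)) UNIV"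
      unfolding expands_partial_z_center[OF d]
      by (simp add: monom2_def algebra_simps del: of_nat_Suc)
  qed
qed

lemma expands_partial_y:
  fixes h :: "'a \<times> 'a \<Rightarrow> 'a::{real_normed_field,banach}"
  assumes h: "expands h x c r" and r': "0 < r'" "r' < r"
  shows "expands (\<partial>y h) x (\<lambda>p. of_nat (Suc (snd p)) * c (fst p, Suc (snd p))) r'"
proof -
  have "\<partial>y h = \<partial>z (h \<circ> prod.swap) \<circ> prod.swap"
    by (rule ext) (simp add: partial_y_swap)
  then show ?thesis
    using expands_swap[OF expands_partial_z[OF expands_swap[OF h] r']] by (simp add: o_def)
qed

text \<open>Passing to a partial derivative lowers an exponent by one and multiplies the coefficient
  by a positive integer, so induction on both exponents reduces the claim to the constant
  coefficient, which is the value at the centre.\<close>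

lemma expands_unique:
  fixes h :: "'a \<times> 'a \<Rightarrow> 'a::{real_normed_field,banach}"
  assumes "expands h x c r" "expands h x d r'"
  shows "c = d"
proof
  fix p :: "nat \<times> nat"
  have half: "expands h x c (min r r')" "expands h x d (min r r')"
    using assms by (auto intro: expands_shrink simp: expandsD)
  have "c (i, j) = d (i, j)" if "expands h x c \<rho>" "expands h x d \<rho>" for c d h \<rho> and i j
    using that
  proof (induction i arbitrary: h c d \<rho>)
    case 0
    then show ?case
    proof (induction j arbitrary: h c d \<rho>)
      case 0
      then show ?case by (metis expands_center)
    next
      case (Suc j)
      have \<rho>: "0 < \<rho> / 2" "\<rho> / 2 < \<rho>" using expandsD(1)[OF Suc.prems(1)] by auto
      from Suc.IH[OF expands_partial_y[OF Suc.prems(1) \<rho>] expands_partial_y[OF Suc.prems(2) \<rho>]]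
      show ?case by (simp del: of_nat_Suc)
    qed
  next
    case (Suc i)
    have \<rho>: "0 < \<rho> / 2" "\<rho> / 2 < \<rho>" using expandsD(1)[OF Suc.prems(1)] by auto
    from Suc.IH[OF expands_partial_z[OF Suc.prems(1) \<rho>] expands_partial_z[OF Suc.prems(2) \<rho>]]
    show ?case by (simp del: of_nat_Suc)
  qed
  from this[OF half] show "c p = d p" by (cases p) auto
qed

lemma open_contains_bidisc:
  fixes V :: "('a \<times> 'a::real_normed_vector) set"
  assumes "open V" "x \<in> V"
  obtains \<rho> where "0 < \<rho>" "\<And>s. s \<in> bidisc \<rho> \<Longrightarrow> x + s \<in> V"
proof -
  obtain A B where AB: "open A" "open B" "x \<in> A \<times> B" "A \<times> B \<subseteq> V"
    by (rule open_prod_elim[OF assms])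
  obtain a where a: "a > 0" "ball (fst x) a \<subseteq> A"
    using AB by (metis mem_Times_iff open_contains_ball)
  obtain b where b: "b > 0" "ball (snd x) b \<subseteq> B"
    using AB by (metis mem_Times_iff open_contains_ball)
  show thesis
  proof (rule that[of "min a b"])
    fix s :: "'a \<times> 'a" assume "s \<in> bidisc (min a b)"
    then have "fst x + fst s \<in> A" "snd x + snd s \<in> B"
      using a b by (auto simp: bidisc_def dist_norm subset_iff)
    then show "x + s \<in> V" using AB by (auto simp: plus_prod_def)
  qed (use a b in auto)
qed

lemma open_translated_bidisc: "open ((+) x ` bidisc r)"
  by (rule open_translation[OF open_bidisc])

lemma expands_at_near:
  fixes h :: "'a \<times> 'a \<Rightarrow> 'a::{real_normed_field,banach}"
  assumes "expands h x c r" "s \<in> bidisc r"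
  shows "\<exists>d \<rho>. expands h (x + s) d \<rho>"
  by (rule expands_recenter[OF assms(1), of "min (r - norm (fst s)) (r - norm (snd s))" s])
    (use assms(2) in \<open>auto simp: bidisc_def\<close>)

text \<open>The interior \<open>Z\<close> of the zero set is relatively closed in
  \<open>\<Omega>\<close>: near a limit point \<open>x\<close> of \<open>Z\<close> a point
  \<open>x + s\<close> of \<open>Z\<close> lies so close that the expansion recentred at
  \<open>x + s\<close> still reaches \<open>x\<close>. Its coefficients vanish by uniqueness, so
  \<open>x\<close> is in \<open>Z\<close>.\<close>

theorem analytic2_identity:
  fixes h :: "'a \<times> 'a \<Rightarrow> 'a::{real_normed_field,banach}"
  assumes h: "h analytic2_on \<Omega>" and \<Omega>: "connected \<Omega>"
    and V: "open V" "V \<noteq> {}" "V \<subseteq> \<Omega>" and zero: "\<forall>x\<in>V. h x = 0"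
  shows "\<forall>x\<in>\<Omega>. h x = 0"
proof -
  define Z where "Z = interior {x. h x = 0}"
  have cl: "x \<in> Z" if x: "x \<in> \<Omega>" "x \<in> closure Z" for x
  proof -
    obtain c r where e: "expands h x c r"
      using h x by (auto simp: analytic2_on_iff_expands)
    have r: "0 < r" by (rule expandsD[OF e])
    then have "x \<in> (+) x ` bidisc (r / 2)"
      by (auto intro!: image_eqI[of _ _ 0])
    with x(2) have "(+) x ` bidisc (r / 2) \<inter> Z \<noteq> {}"
      using open_Int_closure_eq_empty[OF open_translated_bidisc, of x "r / 2" Z] by blast
    then obtain s where s: "s \<in> bidisc (r / 2)" "x + s \<in> Z" by auto
    obtain d where d: "expands h (x + s) d (r / 2)"
      by (rule expands_recenter[OF e, of "r / 2" s]) (use s r in \<open>auto simp: bidisc_def\<close>)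
    obtain \<rho> where \<rho>: "0 < \<rho>" "\<And>t. t \<in> bidisc \<rho> \<Longrightarrow> x + s + t \<in> Z"
      by (rule open_contains_bidisc[OF _ s(2)]) (auto simp: Z_def)
    have "expands h (x + s) (\<lambda>p. if p = (0, 0) then 0 else 0) \<rho>"
      by (rule expands_cong[OF expands_const[OF \<rho>(1)]])
         (use \<rho>(2) in \<open>auto simp: Z_def dest: interior_subset[THEN subsetD]\<close>)
    from expands_unique[OF d this] have d0: "d p = 0" for p by simp
    have "h (x + s + t) = 0" if "t \<in> bidisc (r / 2)" for t
      using expandsD(3)[OF d that] d0 by (simp add: has_sum_iff)
    then have "(+) (x + s) ` bidisc (r / 2) \<subseteq> {x. h x = 0}" by auto
    then have "(+) (x + s) ` bidisc (r / 2) \<subseteq> Z"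
      unfolding Z_def by (rule interior_maximal[OF _ open_translated_bidisc])
    moreover have "x \<in> (+) (x + s) ` bidisc (r / 2)"
      by (rule image_eqI[of _ _ "- s"]) (use s in \<open>auto simp: bidisc_def\<close>)
    ultimately show ?thesis by blast
  qed
  have "Z \<inter> \<Omega> = {} \<or> (- closure Z) \<inter> \<Omega> = {}"
  proof (rule connectedD[OF \<Omega>])
    show "open Z" by (simp add: Z_def)
    show "open (- closure Z)" by (simp add: open_Compl)
    show "Z \<inter> - closure Z \<inter> \<Omega> = {}" using closure_subset by blast
    show "\<Omega> \<subseteq> Z \<union> - closure Z" using cl by blast
  qed
  moreover have "V \<subseteq> Z"
    unfolding Z_def by (rule interior_maximal) (use V zero in auto)
  ultimately have "(- closure Z) \<inter> \<Omega> = {}" using V by blast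
  then have "\<Omega> \<subseteq> Z" using cl by blast
  then show ?thesis
    unfolding Z_def using interior_subset by blast
qed

section \<open>Composition, reciprocals and potentials\<close>

text \<open>Indexing the n-th power of a sum by lists of length n avoids multinomial coefficients;
  the factors of a product appear in the order of the list.\<close>

lemma has_sum_lists_prod:
  fixes g :: "'p \<Rightarrow> 'a::{real_normed_field,banach}"
  assumes N: "((\<lambda>p. norm (g p)) has_sum N) UNIV" and v: "(g has_sum v) UNIV"
  shows "((\<lambda>l. norm (prod_list (map g l))) has_sum N ^ n) {l. length l = n}"
    and "((\<lambda>l. prod_list (map g l)) has_sum v ^ n) {l. length l = n}"
proof -
  have "((\<lambda>l. norm (prod_list (map g l))) has_sum N ^ n) {l. length l = n} \<and>
      ((\<lambda>l. prod_list (map g l)) has_sum v ^ n) {l. length l = n}"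
  proof (induction n)
    case 0
    show ?case by (auto intro!: has_sum_finiteI)
  next
    case (Suc n)
    let ?L = "\<lambda>n. {l :: 'p list. length l = n}"
    let ?f = "\<lambda>q. g (fst q) * prod_list (map g (snd q))"
    have bij: "bij_betw (\<lambda>q. fst q # snd q) (Sigma UNIV (\<lambda>_. ?L n)) (?L (Suc n))"
      by (rule bij_betwI[of _ _ _ "\<lambda>l. (hd l, tl l)"]) (auto simp: length_Suc_conv)
    have f: "((\<lambda>l. ?f (p, l)) has_sum g p * v ^ n) (?L n)" for p
      using has_sum_cmult_right Suc by fastforce
    have nf: "((\<lambda>l. norm (?f (p, l))) has_sum norm (g p) * N ^ n) (?L n)" for p
      using has_sum_cmult_right[OF conjunct1[OF Suc], of "norm (g p)"] by (simp add: norm_mult)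
    have gv: "((\<lambda>p. g p * v ^ n) has_sum v * v ^ n) UNIV"
      by (rule has_sum_cmult_left[OF v])
    have gN: "((\<lambda>p. norm (g p) * N ^ n) has_sum N * N ^ n) UNIV"
      by (rule has_sum_cmult_left[OF N])
    have "?f abs_summable_on Sigma UNIV (\<lambda>_. ?L n)" "(?f has_sum v * v ^ n) (Sigma UNIV (\<lambda>_. ?L n))"
      by (rule abs_fubini[OF nf has_sum_imp_summable[OF gN] f gv])+
    moreover from this(1) have "((\<lambda>q. norm (?f q)) has_sum N * N ^ n) (Sigma UNIV (\<lambda>_. ?L n))"
      by (intro has_sum_SigmaI[OF nf gN])
    ultimately show ?case
      using has_sum_reindex_bij_betw[OF bij, of "\<lambda>l. prod_list (map g l)"]
        has_sum_reindex_bij_betw[OF bij, of "\<lambda>l. norm (prod_list (map g l))"]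
      by simp
  qed
  then show "((\<lambda>l. norm (prod_list (map g l))) has_sum N ^ n) {l. length l = n}"
    and "((\<lambda>l. prod_list (map g l)) has_sum v ^ n) {l. length l = n}" by auto
qed

lemma has_sum_power_series_lists:
  fixes g :: "'p \<Rightarrow> 'a::{real_normed_field,banach}"
  assumes N: "((\<lambda>p. norm (g p)) has_sum N) UNIV" and v: "(g has_sum v) UNIV"
    and a: "(\<lambda>n. norm (a n) * N ^ n) summable_on UNIV" and w: "((\<lambda>n. a n * v ^ n) has_sum w) UNIV"
  shows "(\<lambda>l. norm (a (length l) * prod_list (map g l))) summable_on UNIV"
    and "((\<lambda>l. a (length l) * prod_list (map g l)) has_sum w) UNIV"
proof -
  let ?f = "\<lambda>q. a (fst q) * prod_list (map g (snd q))"
  let ?S = "Sigma UNIV (\<lambda>n. {l :: 'p list. length l = n})"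
  have bij: "bij_betw (\<lambda>l. (length l, l)) UNIV ?S"
    by (rule bij_betwI[of _ _ _ snd]) auto
  have f: "((\<lambda>l. ?f (n, l)) has_sum a n * v ^ n) {l. length l = n}" for n
    using has_sum_cmult_right[OF has_sum_lists_prod(2)[OF N v, of n], of "a n"] by simp
  have nf: "((\<lambda>l. norm (?f (n, l))) has_sum norm (a n) * N ^ n) {l. length l = n}" for n
    using has_sum_cmult_right[OF has_sum_lists_prod(1)[OF N v, of n], of "norm (a n)"] by (simp add: norm_mult)
  have "?f abs_summable_on ?S" "(?f has_sum w) ?S"
    by (rule abs_fubini[OF nf a f w])+
  then show "(\<lambda>l. norm (a (length l) * prod_list (map g l))) summable_on UNIV"
    and "((\<lambda>l. a (length l) * prod_list (map g l)) has_sum w) UNIV"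
    using has_sum_reindex_bij_betw[OF bij, of ?f] summable_on_reindex_bij_betw[OF bij, of "\<lambda>x. norm (?f x)"]
    by simp_all
qed

lemma monom2_sum_list:
  "monom2 s (sum_list (map fst l), sum_list (map snd l)) = prod_list (map (monom2 s) l)"
  by (induction l) (auto simp: monom2_def power_add algebra_simps)

lemma prod_list_map_mult:
  "prod_list (map (\<lambda>x. f x * g x) l) = prod_list (map f l) * (prod_list (map g l) :: 'a::comm_monoid_mult)"
  by (induction l) (auto simp: algebra_simps)

lemma norm_prod_list:
  "norm (prod_list (map f l)) = prod_list (map (\<lambda>x. norm (f x :: 'a::real_normed_field)) l)"
  by (induction l) (auto simp: norm_mult)

text \<open>Substituting the series of \<open>k\<close> into that of \<open>\<phi>\<close> gives one
  term for each list of exponents: the length selects the coefficient of \<open>\<phi>\<close>, the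
  entries select coefficients of \<open>k\<close>. Absolute convergence needs the norm sum
  \<open>N\<close> of \<open>k\<close>, not merely its values, inside the disc of
  \<open>\<phi>\<close>.\<close>

lemma expands_compose:
  fixes k :: "'a \<times> 'a \<Rightarrow> 'a::{real_normed_field,banach}"
  assumes k: "expands k x c r" and N: "((\<lambda>p. norm (c p) * r ^ deg2 p) has_sum N) UNIV"
    and a: "(\<lambda>n. norm (a n) * N ^ n) summable_on UNIV"
    and \<phi>: "\<And>u. norm u \<le> N \<Longrightarrow> ((\<lambda>n. a n * u ^ n) has_sum \<phi> u) UNIV"
  shows "\<exists>d. expands (\<lambda>x. \<phi> (k x)) x d r"
proof
  note r = expandsD(1)[OF k]
  let ?\<pi> = "\<lambda>l :: (nat \<times> nat) list. (sum_list (map fst l), sum_list (map snd l))"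
  let ?e = "\<lambda>l. a (length l) * prod_list (map c l)"
  have deg: "r ^ deg2 (?\<pi> l) = prod_list (map (\<lambda>p. r ^ deg2 p) l)" for l
    using monom2_sum_list[of "(r, r)" l] by (simp add: monom2_def[abs_def] deg2_def power_add)
  have N0: "0 \<le> N" by (rule has_sum_nonneg[OF N]) (use r in auto)
  show "expands (\<lambda>x. \<phi> (k x)) x (\<lambda>p. infsum ?e {l\<in>UNIV. ?\<pi> l = p}) r"
  proof (rule expands_regroup)
    let ?g = "\<lambda>p. norm (c p) * r ^ deg2 p"
    have N': "((\<lambda>p. norm (?g p)) has_sum N) UNIV"
      using N r by simp
    have "(\<lambda>l. norm (norm (a (length l)) * prod_list (map ?g l))) summable_on UNIV"
      by (rule has_sum_power_series_lists(1)[OF N' N, of "\<lambda>n. norm (a n)"])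
        (use a in \<open>auto intro: has_sum_infsum\<close>)
    then show "(\<lambda>l. norm (?e l) * r ^ deg2 (?\<pi> l)) summable_on UNIV"
    proof (rule summable_on_comparison_test)
      show "norm (?e l) * r ^ deg2 (?\<pi> l) \<le> norm (norm (a (length l)) * prod_list (map ?g l))" for l
        unfolding deg real_norm_def
        by (rule order_trans[OF _ abs_ge_self]) (simp add: norm_mult norm_prod_list prod_list_map_mult mult.assoc)
    qed (use r in auto)
    fix s :: "'a \<times> 'a" assume s: "s \<in> bidisc r"
    then have s': "norm (fst s) \<le> r" "norm (snd s) \<le> r" by (auto simp: bidisc_def)
    note v = expandsD(3)[OF k s]
    define M where "M = infsum (\<lambda>p. norm (c p * monom2 s p)) UNIV"
    have M: "((\<lambda>p. norm (c p * monom2 s p)) has_sum M) UNIV"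
      unfolding M_def by (rule has_sum_infsum[OF expands_abs_summable[OF k s']])
    have MN: "M \<le> N"
      by (rule has_sum_mono[OF M N]) (auto simp: norm_mult intro!: mult_left_mono norm_monom2_le s')
    have M0: "0 \<le> M" by (rule has_sum_nonneg[OF M]) auto
    have w: "((\<lambda>n. a n * k (x + s) ^ n) has_sum \<phi> (k (x + s))) UNIV"
      by (rule \<phi>) (use norm_has_sum_bound[OF M v] MN in simp)
    have aM: "(\<lambda>n. norm (a n) * M ^ n) summable_on UNIV"
      by (rule summable_on_comparison_test[OF a]) (use MN M0 in \<open>auto intro!: mult_left_mono power_mono\<close>)
    from has_sum_power_series_lists(2)[OF M v aM w]
    show "((\<lambda>l. ?e l * monom2 s (?\<pi> l)) has_sum \<phi> (k (x + s))) UNIV"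
      by (simp add: prod_list_map_mult monom2_sum_list mult.assoc)
  qed (use r in auto)
qed

text \<open>Without a constant term each weighted coefficient carries a factor
  \<open>\<rho> / r\<close> when the radius shrinks, so the norm sum is of order
  \<open>\<rho>\<close>. This makes the inner series of a composition small enough, and it also
  supplies continuity.\<close>

lemma expands_small:
  fixes c :: "nat \<times> nat \<Rightarrow> 'a::{real_normed_field,banach}"
  assumes "(\<lambda>p. norm (c p) * r ^ deg2 p) summable_on UNIV" "0 < r" "c (0, 0) = 0"
  obtains C where "0 \<le> C"
    "\<And>\<rho>. 0 < \<rho> \<Longrightarrow> \<rho> \<le> r \<Longrightarrow> \<exists>N \<le> \<rho> * C. ((\<lambda>p. norm (c p) * \<rho> ^ deg2 p) has_sum N) UNIV"
proof -
  obtain N where N: "((\<lambda>p. norm (c p) * r ^ deg2 p) has_sum N) UNIV"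
    using assms(1) by (auto simp: summable_on_def)
  have N0: "0 \<le> N" by (rule has_sum_nonneg[OF N]) (use assms in auto)
  show thesis
  proof (rule that[of "N / r"])
    fix \<rho> assume \<rho>: "0 < \<rho>" "\<rho> \<le> r"
    have le: "norm (c p) * \<rho> ^ deg2 p \<le> \<rho> / r * (norm (c p) * r ^ deg2 p)" for p
    proof (cases "deg2 p")
      case 0
      then have "p = (0, 0)" by (cases p) (auto simp: deg2_def)
      then show ?thesis using assms by simp
    next
      case (Suc n)
      have "\<rho> ^ deg2 p = \<rho> * \<rho> ^ n" by (simp add: Suc)
      also have "\<dots> \<le> \<rho> * r ^ n" using \<rho> by (intro mult_left_mono power_mono) auto
      also have "\<dots> = \<rho> / r * r ^ deg2 p" using assms by (simp add: Suc)
      finally have "norm (c p) * \<rho> ^ deg2 p \<le> norm (c p) * (\<rho> / r * r ^ deg2 p)"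
        by (rule mult_left_mono) auto
      then show ?thesis by (simp add: algebra_simps)
    qed
    have S: "((\<lambda>p. \<rho> / r * (norm (c p) * r ^ deg2 p)) has_sum \<rho> / r * N) UNIV"
      by (rule has_sum_cmult_right[OF N])
    have "(\<lambda>p. norm (c p) * \<rho> ^ deg2 p) summable_on UNIV"
      by (rule summable_on_comparison_test[OF has_sum_imp_summable[OF S] le]) (use \<rho> in auto)
    then obtain M where M: "((\<lambda>p. norm (c p) * \<rho> ^ deg2 p) has_sum M) UNIV"
      by (auto simp: summable_on_def)
    have "M \<le> \<rho> / r * N"
      by (rule has_sum_mono[OF M S le])
    then show "\<exists>N'\<le>\<rho> * (N / r). ((\<lambda>p. norm (c p) * \<rho> ^ deg2 p) has_sum N') UNIV"
      using M by auto
  qed (use N0 assms in auto)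
qed

lemma expands_minus_center:
  assumes "expands h x c r"
  shows "expands (\<lambda>y. h y - h x) x (\<lambda>p. c p + (if p = (0, 0) then - h x else 0)) r"
  using expands_add[OF assms expands_const[OF expandsD(1)[OF assms], of "- h x"]] by simp

lemma analytic2_compose_at:
  fixes h :: "'a \<times> 'a \<Rightarrow> 'a::{real_normed_field,banach}"
  assumes h: "expands h x c r" and \<rho>: "0 < \<rho>"
    and a: "(\<lambda>n. norm (a n) * \<rho> ^ n) summable_on UNIV"
    and \<phi>: "\<And>u. norm u \<le> \<rho> \<Longrightarrow> ((\<lambda>n. a n * u ^ n) has_sum \<phi> (h x + u)) UNIV"
  shows "\<exists>d r'. expands (\<lambda>y. \<phi> (h y)) x d r'"
proof -
  note r = expandsD(1)[OF h]
  define c' where "c' = (\<lambda>p. c p + (if p = (0, 0) then - h x else 0))"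
  have k: "expands (\<lambda>y. h y - h x) x c' r"
    unfolding c'_def by (rule expands_minus_center[OF h])
  have c0: "c' (0, 0) = 0"
    using expands_center[OF h] by (simp add: c'_def)
  obtain C where C: "0 \<le> C"
    "\<And>\<rho>. 0 < \<rho> \<Longrightarrow> \<rho> \<le> r \<Longrightarrow> \<exists>N \<le> \<rho> * C. ((\<lambda>p. norm (c' p) * \<rho> ^ deg2 p) has_sum N) UNIV"
    by (rule expands_small[OF expandsD(2)[OF k] r c0]) blast
  \<comment> \<open>Chosen so that the norm sum of \<open>h - h x\<close> is at most
    \<open>r' * C \<le> \<rho>\<close>; the summand 1 keeps the denominator positive if
    \<open>C = 0\<close>.\<close>
  define r' where "r' = min r (\<rho> / (C + 1))"
  have r': "0 < r'" "r' \<le> r" using r \<rho> C(1) by (auto simp: r'_def)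
  have "r' * C \<le> \<rho> / (C + 1) * C"
    using C(1) by (intro mult_right_mono) (auto simp: r'_def)
  also have "\<dots> \<le> \<rho>" using C(1) \<rho> by (simp add: field_simps)
  finally have r'C: "r' * C \<le> \<rho>" .
  obtain N where N: "N \<le> \<rho>" "((\<lambda>p. norm (c' p) * r' ^ deg2 p) has_sum N) UNIV"
    using C(2)[OF r'] r'C order_trans by blast
  have N0: "0 \<le> N" by (rule has_sum_nonneg[OF N(2)]) (use r' in auto)
  have "\<exists>d. expands (\<lambda>y. \<phi> (h x + (h y - h x))) x d r'"
    by (rule expands_compose[OF expands_shrink[OF k r'] N(2), of a "\<lambda>u. \<phi> (h x + u)"])
       (use N N0 \<phi> in \<open>auto intro!: summable_on_comparison_test[OF a] mult_left_mono power_mono\<close>)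
  then show ?thesis by auto
qed

section \<open>Closure properties and derivatives of analytic functions\<close>

lemma analytic2_subset: "h analytic2_on X \<Longrightarrow> Y \<subseteq> X \<Longrightarrow> h analytic2_on Y"
  unfolding analytic2_on_def by blast

lemma analytic2_const: "(\<lambda>_. k :: 'a::{real_normed_field,banach}) analytic2_on X"
  unfolding analytic2_on_iff_expands using expands_const[OF zero_less_one] by blast

lemma analytic2_add:
  fixes h k :: "'a \<times> 'a \<Rightarrow> 'a::{real_normed_field,banach}"
  assumes "h analytic2_on X" "k analytic2_on X"
  shows "(\<lambda>x. h x + k x) analytic2_on X"
  unfolding analytic2_on_iff_expands
proof
  fix x assume "x \<in> X"
  then obtain c r d r' where "expands h x c r" "expands k x d r'"
    using assms unfolding analytic2_on_iff_expands by meson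
  then have "expands (\<lambda>x. h x + k x) x (\<lambda>p. c p + d p) (min r r')"
    by (intro expands_add) (auto intro: expands_shrink simp: expandsD(1))
  then show "\<exists>c r. expands (\<lambda>x. h x + k x) x c r" by blast
qed

lemma analytic2_mult:
  fixes h k :: "'a \<times> 'a \<Rightarrow> 'a::{real_normed_field,banach}"
  assumes "h analytic2_on X" "k analytic2_on X"
  shows "(\<lambda>x. h x * k x) analytic2_on X"
  unfolding analytic2_on_iff_expands
proof
  fix x assume "x \<in> X"
  then obtain c r d r' where "expands h x c r" "expands k x d r'"
    using assms unfolding analytic2_on_iff_expands by meson
  then have "\<exists>e. expands (\<lambda>x. h x * k x) x e (min r r')"
    by (intro expands_mult) (auto intro: expands_shrink simp: expandsD(1))
  then show "\<exists>c r. expands (\<lambda>x. h x * k x) x c r" by blast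
qed

lemma analytic2_inverse:
  fixes h :: "'a \<times> 'a \<Rightarrow> 'a::{real_normed_field,banach}"
  assumes h: "h analytic2_on X" and nz: "\<And>x. x \<in> X \<Longrightarrow> h x \<noteq> 0"
  shows "(\<lambda>x. inverse (h x)) analytic2_on X"
  unfolding analytic2_on_iff_expands
proof
  fix x assume x: "x \<in> X"
  then obtain c r where e: "expands h x c r"
    using h unfolding analytic2_on_iff_expands by meson
  \<comment> \<open>The geometric series of \<open>1 / (h x + u)\<close> in \<open>u\<close>; for
    \<open>norm u \<le> norm (h x) / 2\<close> its ratio has norm at most 1/2.\<close>
  let ?a = "\<lambda>n. inverse (h x) * (- inverse (h x)) ^ n"
  have hx: "h x \<noteq> 0" by (rule nz[OF x])
  show "\<exists>c r. expands (\<lambda>x. inverse (h x)) x c r"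
  proof (rule analytic2_compose_at[OF e, of "norm (h x) / 2" ?a])
    show "0 < norm (h x) / 2" using hx by simp
    have "(\<lambda>n. (1 / 2 :: real) ^ n) summable_on UNIV"
      by (rule summable_nonneg_imp_summable_on) (auto intro!: summable_geometric)
    then have "(\<lambda>n. norm (inverse (h x)) * (1 / 2) ^ n) summable_on UNIV"
      by (rule summable_on_cmult_right)
    then show "(\<lambda>n. norm (?a n) * (norm (h x) / 2) ^ n) summable_on UNIV"
      by (rule summable_on_cong[THEN iffD1, rotated])
        (use hx in \<open>simp add: norm_mult norm_power norm_inverse power_divide power_inverse\<close>)
    fix u :: 'a assume u: "norm u \<le> norm (h x) / 2"
    define q where "q = - (inverse (h x) * u)"
    have "norm q \<le> 1 / 2" using u hx by (simp add: q_def norm_mult norm_inverse norm_divide field_simps)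
    then have q: "norm q < 1" by simp
    have "((\<lambda>n. q ^ n) has_sum 1 / (1 - q)) UNIV"
      by (rule norm_summable_imp_has_sum) (use q in \<open>auto simp: norm_power intro!: summable_geometric geometric_sums\<close>)
    then have "((\<lambda>n. inverse (h x) * q ^ n) has_sum inverse (h x) * (1 / (1 - q))) UNIV"
      by (rule has_sum_cmult_right)
    moreover have "inverse (h x) * (1 / (1 - q)) = inverse (h x + u)"
      using hx by (simp add: q_def field_simps)
    moreover have "(\<lambda>n. ?a n * u ^ n) = (\<lambda>n. inverse (h x) * q ^ n)"
      unfolding q_def by (simp add: mult.assoc flip: power_mult_distrib)
    ultimately show "((\<lambda>n. ?a n * u ^ n) has_sum inverse (h x + u)) UNIV" by metis
  qed
qed

lemma analytic2_exp:
  fixes h :: "'a \<times> 'a \<Rightarrow> 'a::{real_normed_field,banach}"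
  assumes h: "h analytic2_on X"
  shows "(\<lambda>x. exp (h x)) analytic2_on X"
  unfolding analytic2_on_iff_expands
proof
  fix x assume x: "x \<in> X"
  then obtain c r where e: "expands h x c r"
    using h unfolding analytic2_on_iff_expands by meson
  have s: "summable (\<lambda>n. norm (u ^ n /\<^sub>R fact n))" for u :: 'a
    by (rule summable_norm_exp)
  show "\<exists>c r. expands (\<lambda>x. exp (h x)) x c r"
  proof (rule analytic2_compose_at[OF e, of 1 "\<lambda>n. exp (h x) * (1 /\<^sub>R fact n)"])
    have "(\<lambda>n. norm ((1 :: 'a) ^ n /\<^sub>R fact n)) summable_on UNIV"
      by (rule summable_nonneg_imp_summable_on[OF s]) auto
    then have "(\<lambda>n. norm (exp (h x)) * norm ((1 :: 'a) ^ n /\<^sub>R fact n)) summable_on UNIV"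
      by (rule summable_on_cmult_right)
    then show "(\<lambda>n. norm (exp (h x) * (1 /\<^sub>R fact n)) * 1 ^ n) summable_on UNIV"
      by (simp add: norm_mult mult.commute)
    fix u :: 'a
    have "((\<lambda>n. u ^ n /\<^sub>R fact n) has_sum exp u) UNIV"
      by (rule norm_summable_imp_has_sum[OF s exp_converges])
    from has_sum_cmult_right[OF this, of "exp (h x)"]
    show "((\<lambda>n. exp (h x) * (1 /\<^sub>R fact n) * u ^ n) has_sum exp (h x + u)) UNIV"
      by (simp add: exp_add)
  qed auto
qed

lemma analytic2_partial_z:
  fixes h :: "'a \<times> 'a \<Rightarrow> 'a::{real_normed_field,banach}"
  assumes "h analytic2_on X"
  shows "\<partial>z h analytic2_on X"
  unfolding analytic2_on_iff_expands
proof
  fix x assume "x \<in> X"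
  then obtain c r where e: "expands h x c r"
    using assms unfolding analytic2_on_iff_expands by meson
  have "0 < r / 2" "r / 2 < r" using expandsD(1)[OF e] by auto
  from expands_partial_z[OF e this] show "\<exists>c r. expands (\<partial>z h) x c r" by blast
qed

lemma analytic2_partial_y:
  fixes h :: "'a \<times> 'a \<Rightarrow> 'a::{real_normed_field,banach}"
  assumes "h analytic2_on X"
  shows "\<partial>y h analytic2_on X"
  unfolding analytic2_on_iff_expands
proof
  fix x assume "x \<in> X"
  then obtain c r where e: "expands h x c r"
    using assms unfolding analytic2_on_iff_expands by meson
  have "0 < r / 2" "r / 2 < r" using expandsD(1)[OF e] by auto
  from expands_partial_y[OF e this] show "\<exists>c r. expands (\<partial>y h) x c r" by blast
qed

lemma analytic2_DERIV_z:
  fixes h :: "'a \<times> 'a \<Rightarrow> 'a::{real_normed_field,banach}"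
  assumes "h analytic2_on X" "x \<in> X"
  shows "((\<lambda>t. h (t, snd x)) has_field_derivative \<partial>z h x) (at (fst x))"
proof -
  obtain c r where e: "expands h x c r"
    using assms unfolding analytic2_on_iff_expands by meson
  show ?thesis
    using expands_DERIV_z[OF e] by (simp add: expands_partial_z_center[OF e])
qed

lemma analytic2_DERIV_y:
  fixes h :: "'a \<times> 'a \<Rightarrow> 'a::{real_normed_field,banach}"
  assumes "h analytic2_on X" "x \<in> X"
  shows "((\<lambda>t. h (fst x, t)) has_field_derivative \<partial>y h x) (at (snd x))"
proof -
  obtain c r where e: "expands h x c r"
    using assms unfolding analytic2_on_iff_expands by meson
  show ?thesis
    using expands_DERIV_z[OF expands_swap[OF e]] expands_partial_z_center[OF expands_swap[OF e]]
    by (simp add: partial_y_swap)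
qed

lemma partial_commute:
  fixes h :: "'a \<times> 'a \<Rightarrow> 'a::{real_normed_field,banach}"
  assumes "h analytic2_on X" "x \<in> X"
  shows "\<partial>z (\<partial>y h) x = \<partial>y (\<partial>z h) x"
proof -
  obtain c r where e: "expands h x c r"
    using assms unfolding analytic2_on_iff_expands by meson
  have r: "0 < r / 2" "r / 2 < r" "0 < r / 4" "r / 4 < r / 2" using expandsD(1)[OF e] by auto
  have "\<partial>z (\<partial>y h) x = c (1, 1)"
    using expands_center[OF expands_partial_z[OF expands_partial_y[OF e r(1,2)] r(3,4)]] by simp
  also have "\<dots> = \<partial>y (\<partial>z h) x"
    using expands_center[OF expands_partial_y[OF expands_partial_z[OF e r(1,2)] r(3,4)]] by simp
  finally show ?thesis .
qed

lemma analytic2_nonzero_near: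
  fixes h :: "'a \<times> 'a \<Rightarrow> 'a::{real_normed_field,banach}"
  assumes h: "h analytic2_on V" and V: "open V" "x \<in> V" and nz: "h x \<noteq> 0"
  obtains W where "open W" "x \<in> W" "W \<subseteq> V" "\<And>y. y \<in> W \<Longrightarrow> h y \<noteq> 0"
proof -
  obtain c r where h: "expands h x c r"
    using h V unfolding analytic2_on_iff_expands by meson
  note r = expandsD(1)[OF h]
  define c' where "c' = (\<lambda>p. c p + (if p = (0, 0) then - h x else 0))"
  have k: "expands (\<lambda>y. h y - h x) x c' r"
    unfolding c'_def by (rule expands_minus_center[OF h])
  have c0: "c' (0, 0) = 0"
    using expands_center[OF h] by (simp add: c'_def)
  obtain C where C: "0 \<le> C"
    "\<And>\<rho>. 0 < \<rho> \<Longrightarrow> \<rho> \<le> r \<Longrightarrow> \<exists>N \<le> \<rho> * C. ((\<lambda>p. norm (c' p) * \<rho> ^ deg2 p) has_sum N) UNIV"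
    by (rule expands_small[OF expandsD(2)[OF k] r c0]) blast
  obtain \<delta> where \<delta>: "0 < \<delta>" "\<And>s. s \<in> bidisc \<delta> \<Longrightarrow> x + s \<in> V"
    using open_contains_bidisc[OF V] by blast
  define r' where "r' = min (min r \<delta>) (norm (h x) / (C + 1))"
  have r': "0 < r'" "r' \<le> r" "r' \<le> \<delta>" using r \<delta> nz C(1) by (auto simp: r'_def)
  have "r' * C \<le> norm (h x) / (C + 1) * C"
    using C(1) by (intro mult_right_mono) (auto simp: r'_def)
  also have "\<dots> < norm (h x)" using C(1) nz by (simp add: field_simps)
  finally have r'C: "r' * C < norm (h x)" .
  obtain N where N: "N < norm (h x)" "((\<lambda>p. norm (c' p) * r' ^ deg2 p) has_sum N) UNIV"
    using C(2)[OF r'(1,2)] r'C le_less_trans by blast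
  have k': "expands (\<lambda>y. h y - h x) x c' r'"
    by (rule expands_shrink[OF k r'(1,2)])
  show thesis
  proof (rule that[of "(+) x ` bidisc r'"])
    show "open ((+) x ` bidisc r')" by (rule open_translated_bidisc)
    show "x \<in> (+) x ` bidisc r'" using r' by (auto intro!: image_eqI[of _ _ 0])
    show "(+) x ` bidisc r' \<subseteq> V" using r' \<delta>(2) by (auto simp: bidisc_def)
    fix y assume "y \<in> (+) x ` bidisc r'"
    then obtain s where s: "s \<in> bidisc r'" "y = x + s" by auto
    then have s': "norm (fst s) \<le> r'" "norm (snd s) \<le> r'" by (auto simp: bidisc_def)
    have M: "((\<lambda>p. norm (c' p * monom2 s p)) has_sum infsum (\<lambda>p. norm (c' p * monom2 s p)) UNIV) UNIV"
      by (rule has_sum_infsum[OF expands_abs_summable[OF k' s']])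
    have "norm (h y - h x) \<le> infsum (\<lambda>p. norm (c' p * monom2 s p)) UNIV"
      using norm_has_sum_bound[OF M expandsD(3)[OF k' s(1)]] s by simp
    also have "\<dots> \<le> N"
      by (rule has_sum_mono[OF M N(2)]) (auto simp: norm_mult intro!: mult_left_mono norm_monom2_le s')
    finally show "h y \<noteq> 0" using N(1) by auto
  qed
qed

lemma partial_cong_open:
  assumes "open V" "\<And>y. y \<in> V \<Longrightarrow> h y = k y" "x \<in> V"
  shows "\<partial>z h x = \<partial>z k x" "\<partial>y h x = \<partial>y k x"
proof -
  obtain z y where x: "x = (z, y)" by (cases x)
  have "open ((\<lambda>t. (t, y)) -` V)" "open ((\<lambda>t. (z, t)) -` V)"
    by (intro open_vimage assms continuous_intros)+
  then have "\<forall>\<^sub>F t in nhds z. (t, y) \<in> V" "\<forall>\<^sub>F t in nhds y. (z, t) \<in> V"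
    using assms(3) x by (auto dest!: eventually_nhds_in_open)
  then show "\<partial>z h x = \<partial>z k x" "\<partial>y h x = \<partial>y k x"
    unfolding partial_z_def partial_y_def x
    by (auto intro!: deriv_cong_ev elim!: eventually_mono simp: assms(2))
qed

text \<open>The closed form with \<open>y\<close>-component \<open>f\<close> and
  \<open>z\<close>-component \<open>k\<close> is integrated on coefficients: closedness says that
  the two ways to read off a coefficient of \<open>H\<close> agree.\<close>

theorem analytic2_potential:
  fixes f k :: "'a \<times> 'a \<Rightarrow> 'a::{real_normed_field,banach}"
  assumes V: "open V" "x \<in> V" and f: "f analytic2_on V" and k: "k analytic2_on V"
    and fk: "\<And>y. y \<in> V \<Longrightarrow> \<partial>z f y = \<partial>y k y"
  obtains W H where "open W" "x \<in> W" "W \<subseteq> V" "H analytic2_on W" "H x = 0"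
    "\<And>y. y \<in> W \<Longrightarrow> \<partial>y H y = f y" "\<And>y. y \<in> W \<Longrightarrow> \<partial>z H y = k y"
proof -
  obtain c r1 d r2 where "expands f x c r1" "expands k x d r2"
    using f k V unfolding analytic2_on_iff_expands by meson
  moreover obtain \<delta> where \<delta>: "0 < \<delta>" "\<And>s. s \<in> bidisc \<delta> \<Longrightarrow> x + s \<in> V"
    using open_contains_bidisc[OF V] by blast
  moreover define r where "r = min \<delta> (min r1 r2)"
  ultimately have f: "expands f x c r" and k: "expands k x d r" and r: "0 < r" "r \<le> \<delta>"
    by (auto intro: expands_shrink simp: expandsD(1))
  have r2: "0 < r / 2" "r / 2 < r" using r by auto
  have "expands (\<partial>y k) x (\<lambda>p. of_nat (Suc (fst p)) * c (Suc (fst p), snd p)) (r / 2)"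
    by (rule expands_cong[OF expands_partial_z[OF f r2]])
       (use fk \<delta>(2) r in \<open>auto simp: bidisc_def\<close>)
  from expands_unique[OF this expands_partial_y[OF k r2]]
  have cd: "of_nat (Suc i) * c (Suc i, j) = of_nat (Suc j) * d (i, Suc j)" for i j
    by (auto dest: fun_cong[of _ _ "(i, j)"])
  \<comment> \<open>Coefficients come from integrating \<open>f\<close> in \<open>y\<close> where
    the second exponent is positive, and from \<open>k\<close> on the axis where it is 0. The free
    constant is set to 0.\<close>
  define a where "a = (\<lambda>(i, j). case j of Suc j' \<Rightarrow> c (i, j') / of_nat j
      | 0 \<Rightarrow> (case i of Suc i' \<Rightarrow> d (i', 0) / of_nat i | 0 \<Rightarrow> 0))"
  \<comment> \<open>\<open>N\<close> and \<open>N'\<close> are the weighted norms of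
    \<open>c\<close> and \<open>d\<close> with one exponent raised. Since integration raises the
    degree by one, \<open>r * (N p + N' p)\<close> majorizes the coefficients of
    \<open>H\<close>.\<close>
  define N where "N = (\<lambda>(i, j). case j of Suc j' \<Rightarrow> norm (c (i, j')) * r ^ deg2 (i, j') | 0 \<Rightarrow> 0)"
  define N' where "N' = (\<lambda>(i, j). case i of Suc i' \<Rightarrow> norm (d (i', j)) * r ^ deg2 (i', j) | 0 \<Rightarrow> 0)"
  have "N summable_on range (\<lambda>(i, j). (i, Suc j))"
    by (subst summable_on_reindex)
      (use expandsD(2)[OF f] in \<open>auto simp: inj_on_def N_def o_def case_prod_unfold\<close>)
  also have "?this \<longleftrightarrow> N summable_on UNIV"
    by (rule summable_on_cong_neutral) (auto simp: N_def image_iff split: nat.splits)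
  finally have N: "N summable_on UNIV" .
  have "N' summable_on range (\<lambda>(i, j). (Suc i, j))"
    by (subst summable_on_reindex)
      (use expandsD(2)[OF k] in \<open>auto simp: inj_on_def N'_def o_def case_prod_unfold\<close>)
  also have "?this \<longleftrightarrow> N' summable_on UNIV"
    by (rule summable_on_cong_neutral) (auto simp: N'_def image_iff split: nat.splits)
  finally have N': "N' summable_on UNIV" .
  have inv_le: "u / (1 + real n) \<le> u" if "0 \<le> u" for u and n :: nat
    using that by (simp add: field_simps)
  have "(\<lambda>p. r * (N p + N' p)) summable_on UNIV"
    by (intro summable_on_cmult_right summable_on_add N N')
  then have a_sum: "(\<lambda>p. norm (a p) * r ^ deg2 p) summable_on UNIV"
  proof (rule summable_on_comparison_test)
    fix p :: "nat \<times> nat"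
    obtain i j where p: "p = (i, j)" by (cases p)
    have nn: "0 \<le> N p" "0 \<le> N' p" using r by (auto simp: N_def N'_def p split: nat.splits)
    show "norm (a p) * r ^ deg2 p \<le> r * (N p + N' p)"
    proof (cases j)
      case (Suc j')
      have "norm (a p) \<le> norm (c (i, j'))"
        using inv_le[of "norm (c (i, j'))" j'] by (simp add: a_def p Suc norm_divide del: of_nat_Suc) simp
      then have "norm (a p) * r ^ deg2 p \<le> norm (c (i, j')) * r ^ deg2 p"
        using r by (intro mult_right_mono) auto
      also have "\<dots> = r * N p" by (simp add: p Suc N_def deg2_def)
      finally show ?thesis using nn r by (simp add: distrib_left add_increasing2)
    next
      case 0
      show ?thesis
      proof (cases i)
        case (Suc i')
        have "norm (a p) \<le> norm (d (i', 0))"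
          using inv_le[of "norm (d (i', 0))" i'] by (simp add: a_def p Suc 0 norm_divide del: of_nat_Suc) simp
        then have "norm (a p) * r ^ deg2 p \<le> norm (d (i', 0)) * r ^ deg2 p"
          using r by (intro mult_right_mono) auto
        also have "\<dots> = r * N' p" by (simp add: p Suc 0 N'_def deg2_def)
        finally show ?thesis using nn r by (simp add: distrib_left add_increasing)
      qed (use nn r in \<open>simp add: a_def p 0\<close>)
    qed
  qed (use r in auto)
  define H where "H = (\<lambda>y. infsum (\<lambda>p. a p * monom2 (y - x) p) UNIV)"
  have H: "expands H x a r"
    unfolding expands_def
  proof (intro conjI ballI r(1) a_sum)
    fix s :: "'a \<times> 'a" assume s: "s \<in> bidisc r"
    have "(\<lambda>p. a p * monom2 s p) summable_on UNIV"
      by (rule summable_on_norm_comparison(2)[OF a_sum])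
         (use s in \<open>auto simp: norm_mult bidisc_def intro!: mult_left_mono norm_monom2_le\<close>)
    then show "((\<lambda>p. a p * monom2 s p) has_sum H (x + s)) UNIV"
      by (auto simp: H_def intro: has_sum_infsum)
  qed
  have "(\<lambda>p. of_nat (Suc (snd p)) * a (fst p, Suc (snd p))) = c"
    by (auto simp: a_def fun_eq_iff simp del: of_nat_Suc)
  then have Hy: "expands (\<partial>y H) x c (r / 2)"
    using expands_partial_y[OF H r2] by simp
  have "of_nat (Suc i) * a (Suc i, j) = d (i, j)" for i j
    using cd[of i] by (cases j) (auto simp: a_def field_simps simp del: of_nat_Suc)
  then have "(\<lambda>p. of_nat (Suc (fst p)) * a (Suc (fst p), snd p)) = d"
    by (auto simp: fun_eq_iff simp del: of_nat_Suc)
  then have Hz: "expands (\<partial>z H) x d (r / 2)"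
    using expands_partial_z[OF H r2] by simp
  show thesis
  proof (rule that[of "(+) x ` bidisc (r / 2)" H])
    show "open ((+) x ` bidisc (r / 2))" by (rule open_translated_bidisc)
    show "x \<in> (+) x ` bidisc (r / 2)" using r2 by (auto intro!: image_eqI[of _ _ 0])
    show "(+) x ` bidisc (r / 2) \<subseteq> V" using r2 r \<delta>(2) by (auto simp: bidisc_def)
    show "H analytic2_on (+) x ` bidisc (r / 2)"
      unfolding analytic2_on_iff_expands
      using expands_at_near[OF expands_shrink[OF H, of "r / 2"]] r2 by auto
    show "H x = 0"
      using expands_center[OF H] by (simp add: a_def)
    fix y assume "y \<in> (+) x ` bidisc (r / 2)"
    then obtain s where s: "s \<in> bidisc (r / 2)" "y = x + s" by auto
    then have s': "s \<in> bidisc r" using r by (auto simp: bidisc_def)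
    show "\<partial>y H y = f y"
      using has_sum_unique[OF expandsD(3)[OF Hy s(1)] expandsD(3)[OF f s']] s by simp
    show "\<partial>z H y = k y"
      using has_sum_unique[OF expandsD(3)[OF Hz s(1)] expandsD(3)[OF k s']] s by simp
  qed
qed

section \<open>Jets of the coefficients\<close>

lemma analytic2_fun [simp]:
  fixes h k :: "'a \<times> 'a \<Rightarrow> 'a::{real_normed_field,banach}"
  assumes "h analytic2_on V" "k analytic2_on V"
  shows "(h + k) analytic2_on V" "(h * k) analytic2_on V" "(h - k) analytic2_on V"
proof -
  show "(h + k) analytic2_on V" "(h * k) analytic2_on V"
    using analytic2_add[OF assms] analytic2_mult[OF assms] by (simp_all add: plus_fun_def times_fun_def)
  have m: "(\<lambda>x. (- 1) * k x) analytic2_on V" if "k analytic2_on V" for k :: "'a \<times> 'a \<Rightarrow> 'a"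
    by (rule analytic2_mult[OF analytic2_const that])
  from analytic2_add[OF assms(1) m[OF assms(2)]] show "(h - k) analytic2_on V"
    by (simp add: fun_diff_def)
qed

lemma analytic2_fun_uminus [simp]:
  fixes h :: "'a \<times> 'a \<Rightarrow> 'a::{real_normed_field,banach}"
  assumes "h analytic2_on V"
  shows "(- h) analytic2_on V"
  using analytic2_mult[OF analytic2_const assms, of "- 1"] by (simp add: fun_Compl_def)

lemma analytic2_fun_const [simp]:
  "(numeral n :: 'a \<times> 'a \<Rightarrow> 'a::{real_normed_field,banach}) analytic2_on V"
  "(1 :: 'a \<times> 'a \<Rightarrow> 'a) analytic2_on V" "(0 :: 'a \<times> 'a \<Rightarrow> 'a) analytic2_on V"
  using analytic2_const by (simp_all add: numeral_fun one_fun_def zero_fun_def)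

lemma analytic2_fun_power [simp]:
  fixes h :: "'a \<times> 'a \<Rightarrow> 'a::{real_normed_field,banach}"
  shows "h analytic2_on V \<Longrightarrow> (h ^ n) analytic2_on V"
  by (induction n) simp_all

lemma power_fun_apply [simp]: "(h ^ n) x = (h x :: 'b::monoid_mult) ^ n"
  by (induction n) simp_all

lemma partial_const [simp]:
  "\<partial>z (numeral n :: 'a \<times> 'a \<Rightarrow> 'a::real_normed_field) = 0" "\<partial>y (numeral n :: 'a \<times> 'a \<Rightarrow> 'a) = 0"
  "\<partial>z (1 :: 'a \<times> 'a \<Rightarrow> 'a) = 0" "\<partial>y (1 :: 'a \<times> 'a \<Rightarrow> 'a) = 0"
  "\<partial>z (0 :: 'a \<times> 'a \<Rightarrow> 'a) = 0" "\<partial>y (0 :: 'a \<times> 'a \<Rightarrow> 'a) = 0"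
  by (simp_all add: partial_z_def partial_y_def fun_eq_iff numeral_fun)

lemma partial_rules:
  fixes h k :: "'a \<times> 'a \<Rightarrow> 'a::{real_normed_field,banach}"
  assumes "h analytic2_on V" "k analytic2_on V" "x \<in> V"
  shows "\<partial>z (h + k) x = \<partial>z h x + \<partial>z k x" "\<partial>y (h + k) x = \<partial>y h x + \<partial>y k x"
    "\<partial>z (h - k) x = \<partial>z h x - \<partial>z k x" "\<partial>y (h - k) x = \<partial>y h x - \<partial>y k x"
    "\<partial>z (h * k) x = \<partial>z h x * k x + h x * \<partial>z k x" "\<partial>y (h * k) x = \<partial>y h x * k x + h x * \<partial>y k x"
proof -
  note hz = analytic2_DERIV_z[OF assms(1,3)] and kz = analytic2_DERIV_z[OF assms(2,3)]
    and hy = analytic2_DERIV_y[OF assms(1,3)] and ky = analytic2_DERIV_y[OF assms(2,3)]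
  have z: "\<partial>z H x = d" if "((\<lambda>t. H (t, snd x)) has_field_derivative d) (at (fst x))" for H d
    using DERIV_imp_deriv[OF that] by (simp add: partial_z_def case_prod_unfold)
  have y: "\<partial>y H x = d" if "((\<lambda>t. H (fst x, t)) has_field_derivative d) (at (snd x))" for H d
    using DERIV_imp_deriv[OF that] by (simp add: partial_y_def case_prod_unfold)
  show "\<partial>z (h + k) x = \<partial>z h x + \<partial>z k x" by (rule z) (auto intro!: derivative_eq_intros hz kz)
  show "\<partial>z (h - k) x = \<partial>z h x - \<partial>z k x" by (rule z) (auto intro!: derivative_eq_intros hz kz)
  show "\<partial>z (h * k) x = \<partial>z h x * k x + h x * \<partial>z k x"
    by (rule z) (use DERIV_mult[OF hz kz] in \<open>simp add: algebra_simps\<close>)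
  show "\<partial>y (h + k) x = \<partial>y h x + \<partial>y k x" by (rule y) (auto intro!: derivative_eq_intros hy ky)
  show "\<partial>y (h - k) x = \<partial>y h x - \<partial>y k x" by (rule y) (auto intro!: derivative_eq_intros hy ky)
  show "\<partial>y (h * k) x = \<partial>y h x * k x + h x * \<partial>y k x"
    by (rule y) (use DERIV_mult[OF hy ky] in \<open>simp add: algebra_simps\<close>)
qed

lemma partial_uminus:
  fixes h :: "'a \<times> 'a \<Rightarrow> 'a::{real_normed_field,banach}"
  assumes "h analytic2_on V" "x \<in> V"
  shows "\<partial>z (- h) x = - \<partial>z h x" "\<partial>y (- h) x = - \<partial>y h x"
  using partial_rules(3,4)[of 0 V h x] assms by simp_all

lemma partial_fun_const [simp]:
  "\<partial>z (\<lambda>_. c :: 'a::real_normed_field) = 0" "\<partial>y (\<lambda>_. c :: 'a::real_normed_field) = 0"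
  by (simp_all add: partial_z_def partial_y_def fun_eq_iff)

lemma partial_exp:
  fixes h :: "'a \<times> 'a \<Rightarrow> 'a::{real_normed_field,banach}"
  assumes "h analytic2_on V" "x \<in> V"
  shows "\<partial>z (\<lambda>x. exp (h x)) x = exp (h x) * \<partial>z h x" "\<partial>y (\<lambda>x. exp (h x)) x = exp (h x) * \<partial>y h x"
proof -
  have "((\<lambda>t. exp (h (t, snd x))) has_field_derivative exp (h x) * \<partial>z h x) (at (fst x))"
    by (rule derivative_eq_intros analytic2_DERIV_z[OF assms] refl)+ simp
  from DERIV_imp_deriv[OF this] show "\<partial>z (\<lambda>x. exp (h x)) x = exp (h x) * \<partial>z h x"
    by (simp add: partial_z_def case_prod_unfold)
  have "((\<lambda>t. exp (h (fst x, t))) has_field_derivative exp (h x) * \<partial>y h x) (at (snd x))"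
    by (rule derivative_eq_intros analytic2_DERIV_y[OF assms] refl)+ simp
  from DERIV_imp_deriv[OF this] show "\<partial>y (\<lambda>x. exp (h x)) x = exp (h x) * \<partial>y h x"
    by (simp add: partial_y_def case_prod_unfold)
qed

lemmas fun_apply = plus_fun_apply times_fun_apply minus_apply uminus_apply numeral_fun_apply
  power_fun_apply one_fun_apply zero_fun_apply

text \<open>Brings jet relations into the form \<open>... = 0\<close> in which they are handed to
  \<open>algebra\<close>.\<close>

lemma eq_diff0: "a = b \<Longrightarrow> a - b = (0 :: 'a::ab_group_add)"
  by simp

lemmas analytic2_partial [simp] = analytic2_partial_y analytic2_partial_z
lemmas analytic2_intros = analytic2_fun analytic2_fun_uminus
  analytic2_fun_const analytic2_fun_power analytic2_partial

section \<open>Differentiating identities on open sets, and relations between jets\<close>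

locale open_region =
  fixes V :: "('a \<times> 'a::{real_normed_field,banach}) set"
  assumes open_V: "open V"
begin

lemmas partial_rules_V [simp] = partial_rules[where V = V] partial_uminus[where V = V]

text \<open>Equality at a point cannot be differentiated, equality on the open set \<open>V\<close>
  can. Relations that will be differentiated are therefore kept as \<open>\<doteq>\<close>.\<close>

definition agree :: "('a \<times> 'a \<Rightarrow> 'a) \<Rightarrow> ('a \<times> 'a \<Rightarrow> 'a) \<Rightarrow> bool" (infix \<open>\<doteq>\<close> 50) where
  "h \<doteq> k \<longleftrightarrow> (\<forall>x\<in>V. h x = k x)"

lemma agreeI: "(\<And>x. x \<in> V \<Longrightarrow> h x = k x) \<Longrightarrow> h \<doteq> k"
  by (simp add: agree_def)

lemma agreeD: "h \<doteq> k \<Longrightarrow> x \<in> V \<Longrightarrow> h x = k x"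
  by (simp add: agree_def)

lemma agree_partial:
  assumes "h \<doteq> k" "x \<in> V"
  shows agree_z: "\<partial>z h x = \<partial>z k x" and agree_y: "\<partial>y h x = \<partial>y k x"
  by (rule partial_cong_open[OF open_V]; use assms in \<open>simp add: agree_def\<close>)+

lemma commute_V:
  assumes "h analytic2_on V" "x \<in> V"
  shows "\<partial>z (\<partial>y h) x = \<partial>y (\<partial>z h) x"
  by (rule partial_commute[OF assms])

lemma commute2_V:
  assumes "h analytic2_on V" "x \<in> V"
  shows "\<partial>z (\<partial>y (\<partial>y h)) x = \<partial>y (\<partial>y (\<partial>z h)) x"
proof -
  have "\<partial>z (\<partial>y (\<partial>y h)) x = \<partial>y (\<partial>z (\<partial>y h)) x"
    by (rule commute_V) (use assms in simp_all)
  also have "\<dots> = \<partial>y (\<partial>y (\<partial>z h)) x"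
    by (rule agree_y[OF agreeI]) (use assms in \<open>simp_all add: commute_V\<close>)
  finally show ?thesis .
qed

end

locale analytic_equation = equation \<Omega> f g
  for \<Omega> :: "('a::{real_normed_field,banach} \<times> 'a) set" and f g +
  assumes open_\<Omega>: "open \<Omega>" and connected_\<Omega>: "connected \<Omega>" and nonempty_\<Omega>: "\<Omega> \<noteq> {}"
    and f_analytic: "f analytic2_on \<Omega>" and g_analytic: "g analytic2_on \<Omega>"
    and f_nonzero: "nonzero f"
    and fy_gyy_nonzero: "\<not> (vanishes f_y \<and> vanishes g_yy)"

locale region = analytic_equation \<Omega> f g + open_region V
  for \<Omega> :: "('a::{real_normed_field,banach} \<times> 'a) set" and f g and V :: "('a \<times> 'a) set" +
  assumes V_sub: "V \<subseteq> \<Omega>" and V_nonempty: "V \<noteq> {}"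
begin

lemma coefficients_analytic [simp]:
  "f analytic2_on V" "g analytic2_on V" "P analytic2_on V" "Q analytic2_on V" "R analytic2_on V"
  "S analytic2_on V" "T analytic2_on V" "D analytic2_on V"
proof -
  show fg [simp]: "f analytic2_on V" "g analytic2_on V"
    using f_analytic g_analytic V_sub by (auto intro: analytic2_subset)
  show PQR [simp]: "P analytic2_on V" "Q analytic2_on V" "R analytic2_on V"
    by (simp_all add: P_def Q_def R_def)
  show T [simp]: "T analytic2_on V" by (simp add: T_def)
  show "S analytic2_on V" "D analytic2_on V" by (simp_all add: S_def D_def)
qed

text \<open>Rewriting rules towards a normal form: mixed derivatives are expressed by
  \<open>P\<close>, \<open>Q\<close>, \<open>R\<close>, \<open>T\<close> and few further jets, which
  are then treated as independent variables in polynomial identities. In particular \<open>S\<close>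
  is the determinant \<open>R * P_y - f_y * P_yy\<close>, and \<open>T\<close> is
  \<open>P_z - 2 * f * P\<close>.\<close>

lemma jets:
  assumes [simp]: "x \<in> V"
  shows fz: "f_z x = P x + g_y x"
    and fyz: "f_yz x = P_y x + Q x"
    and fyy: "f_yy x = R x" and gyy: "g_yy x = Q x"
    and Pz: "P_z x = T x + 2 * f x * P x"
    and Rz: "R_z x = P_yy x + Q_y x"
    and S_eq: "S x = R x * P_y x - f_y x * P_yy x"
    and D_eq: "D x = 4 * P x * (f_y x)\<^sup>2 + 2 * f x * P_y x * f_y x - Q x * P_y x + R x * T x - 2 * (P_y x)\<^sup>2"
proof -
  show "f_z x = P x + g_y x" by (simp add: P_def)
  show "f_yz x = P_y x + Q x" by (simp add: P_def Q_def commute_V)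
  show "f_yy x = R x" "g_yy x = Q x" by (simp_all add: R_def Q_def)
  show "P_z x = T x + 2 * f x * P x" by (simp add: P_def T_def algebra_simps)
  have Py: "P_y \<doteq> f_zy - g_yy" by (simp add: P_def agree_def)
  have P_yy: "P_yy x = f_zyy x - g_yyy x" and P_y: "P_y x = f_zy x - g_yy x"
    using agree_y[OF Py assms] agreeD[OF Py assms] by simp_all
  show "R_z x = P_yy x + Q_y x" "S x = R x * P_y x - f_y x * P_yy x"
    unfolding P_yy P_y by (simp_all add: R_def Q_def S_def commute2_V algebra_simps)
  show "D x = 4 * P x * (f_y x)\<^sup>2 + 2 * f x * P_y x * f_y x - Q x * P_y x + R x * T x - 2 * (P_y x)\<^sup>2"
    by (simp add: D_def)
qed

lemma jets2:
  assumes [simp]: "x \<in> V"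
  shows Pzy: "P_zy x = T_y x + 2 * f_y x * P x + 2 * f x * P_y x"
    and Pyz: "\<partial>z P_y x = P_zy x"
    and Pzz: "P_zz x = T_z x + 2 * (P x + g_y x) * P x + 2 * f x * P_z x"
    and gyz: "g_yz x = g_zy x"
    and Tyz: "\<partial>z T_y x = \<partial>y T_z x"
    and Qyz: "\<partial>z Q_y x = Q_zy x"
    and Pyyz: "\<partial>z P_yy x = \<partial>y P_zy x"
    and Pzyy: "\<partial>y P_zy x = \<partial>y T_y x + 2 * R x * P x + 4 * f_y x * P_y x + 2 * f x * P_yy x"
    and Sz: "S_z x = R_z x * P_y x + R x * P_zy x - (P_y x + Q x) * P_yy x - f_y x * \<partial>y P_zy x"
proof -
  have Pz': "P_z \<doteq> T + 2 * f * P" by (simp add: Pz agree_def)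
  have Pzy': "P_zy y = T_y y + 2 * f_y y * P y + 2 * f y * P_y y" if "y \<in> V" for y
    using agree_y[OF Pz' that] that by (simp add: algebra_simps)
  then show "P_zy x = T_y x + 2 * f_y x * P x + 2 * f x * P_y x"
    by simp
  show "P_zz x = T_z x + 2 * (P x + g_y x) * P x + 2 * f x * P_z x"
    using agree_z[OF Pz' assms] by (simp add: fz algebra_simps)
  show "\<partial>z P_y x = P_zy x" "g_yz x = g_zy x" "\<partial>z T_y x = \<partial>y T_z x" "\<partial>z Q_y x = Q_zy x"
    by (simp_all add: commute_V)
  show Pyyz: "\<partial>z P_yy x = \<partial>y P_zy x"
    by (simp add: commute2_V)
  have "P_zy \<doteq> T_y + 2 * f_y * P + 2 * f * P_y" by (rule agreeI) (simp add: Pzy')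
  from agree_y[OF this assms]
  show "\<partial>y P_zy x = \<partial>y T_y x + 2 * R x * P x + 4 * f_y x * P_y x + 2 * f x * P_yy x"
    by (simp add: fyy algebra_simps)
  have "S \<doteq> R * P_y - f_y * P_yy" by (rule agreeI) (simp add: S_eq)
  from agree_z[OF this assms]
  show "S_z x = R_z x * P_y x + R x * P_zy x - (P_y x + Q x) * P_yy x - f_y x * \<partial>y P_zy x"
    by (simp add: fyz commute_V[of P] Pyyz algebra_simps)
qed

lemma vanishes_from_V:
  assumes "h analytic2_on \<Omega>" "\<And>x. x \<in> V \<Longrightarrow> h x = 0"
  shows "vanishes h"
  by (rule analytic2_identity[OF assms(1) connected_\<Omega> open_V V_nonempty V_sub]) (use assms in blast)

lemma \<Omega>_analytic [simp]:
  "f analytic2_on \<Omega>" "g analytic2_on \<Omega>" "P analytic2_on \<Omega>" "Q analytic2_on \<Omega>" "R analytic2_on \<Omega>"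
  "S analytic2_on \<Omega>" "T analytic2_on \<Omega>" "D analytic2_on \<Omega>"
proof -
  interpret O: region \<Omega> f g \<Omega> by unfold_locales (auto simp: open_\<Omega> nonempty_\<Omega>)
  show "f analytic2_on \<Omega>" "g analytic2_on \<Omega>" "P analytic2_on \<Omega>" "Q analytic2_on \<Omega>" "R analytic2_on \<Omega>"
    "S analytic2_on \<Omega>" "T analytic2_on \<Omega>" "D analytic2_on \<Omega>" by (rule O.coefficients_analytic)+
qed

text \<open>A function that is nonzero somewhere on \<open>\<Omega>\<close> cannot vanish on all of
  \<open>V\<close> by the identity theorem, so a denominator may be assumed to have no zeros after
  shrinking.\<close>

lemma shrink_to_nonzero:
  assumes h: "h analytic2_on \<Omega>" and nz: "nonzero h"
  obtains W where "region \<Omega> f g W" "W \<subseteq> V" "\<And>x. x \<in> W \<Longrightarrow> h x \<noteq> 0"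
proof -
  obtain x where x: "x \<in> V" "h x \<noteq> 0"
    using vanishes_from_V[OF h] nz by blast
  have "h analytic2_on V" by (rule analytic2_subset[OF h V_sub])
  then obtain W where W: "open W" "x \<in> W" "W \<subseteq> V" "\<And>y. y \<in> W \<Longrightarrow> h y \<noteq> 0"
    using analytic2_nonzero_near[of h V x] open_V x by metis
  have "region \<Omega> f g W"
    by unfold_locales (use W V_sub in auto)
  then show thesis using W that by blast
qed

end

section \<open>The overdetermined system for a first integral\<close>

locale solution = region \<Omega> f g V
  for \<Omega> :: "('a::{real_normed_field,banach} \<times> 'a) set" and f g and V :: "('a \<times> 'a) set" +
  fixes A w :: "'a \<times> 'a \<Rightarrow> 'a"
  assumes A_analytic [simp]: "A analytic2_on V" and w_analytic [simp]: "w analytic2_on V"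
    and Ay_agree: "\<partial>y A \<doteq> f" and Az_agree: "\<partial>z A \<doteq> g - w"
    and wy_agree: "\<partial>y w \<doteq> - P" and wz_agree: "\<partial>z w \<doteq> f * w - A * P"
begin

lemma restrict_solution:
  assumes "region \<Omega> f g W" "W \<subseteq> V"
  shows "solution \<Omega> f g W A w"
proof -
  interpret W: region \<Omega> f g W by fact
  show ?thesis
    by unfold_locales
      (use assms(2) Ay_agree Az_agree wy_agree wz_agree in
        \<open>auto simp: agree_def W.agree_def intro: analytic2_subset[OF A_analytic] analytic2_subset[OF w_analytic]\<close>)
qed

lemma shrink_solution_to_nonzero:
  assumes "h analytic2_on \<Omega>" "nonzero h"
  obtains W where "solution \<Omega> f g W A w" "\<And>x. x \<in> W \<Longrightarrow> h x \<noteq> 0"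
  using shrink_to_nonzero[OF assms] restrict_solution by metis

lemma Aw:
  assumes "x \<in> V"
  shows Ay: "\<partial>y A x = f x" and Az: "\<partial>z A x = g x - w x"
    and wy: "\<partial>y w x = - P x" and wz: "\<partial>z w x = f x * w x - A x * P x"
  using agreeD[OF Ay_agree assms] agreeD[OF Az_agree assms] agreeD[OF wy_agree assms]
    agreeD[OF wz_agree assms] by simp_all

text \<open>Equality of the mixed derivatives of \<open>w\<close>: the first derivatives of
  \<open>A\<close> and \<open>w\<close> that arise are replaced by the system itself, which leaves a
  relation without derivatives of \<open>A\<close> and \<open>w\<close>.\<close>

lemma constraint: "P_y * A - f_y * w \<doteq> T"
proof (rule agreeI)
  fix x assume x [simp]: "x \<in> V"
  have "\<partial>z (\<partial>y w) x = \<partial>y (\<partial>z w) x" by (rule commute_V) simp_all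
  then show "(P_y * A - f_y * w) x = T x"
    using agree_z[OF wy_agree x] agree_y[OF wz_agree x]
    by (simp add: Aw Pz algebra_simps)
qed

lemma constraint_y:
  assumes [simp]: "x \<in> V"
  shows "P_yy x * A x - R x * w x = T_y x - f x * P_y x - P x * f_y x"
  using agree_y[OF constraint, of x] by (simp add: Aw fyy algebra_simps)

lemma constraint_z:
  assumes [simp]: "x \<in> V"
  shows "(P_zy x + P x * f_y x) * A x - (2 * P_y x + Q x + f x * f_y x) * w x = T_z x - g x * P_y x"
  using agree_z[OF constraint, of x] by (simp add: Aw fyz Pyz algebra_simps)

text \<open>The constraint and its \<open>y\<close>-derivative solve to \<open>S * A = ...\<close>
  when \<open>w\<close> is eliminated. The first equation of the condition inserts this into the
  \<open>z\<close>-derivative of the constraint, the second inserts it into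
  \<open>A_y = f\<close>.\<close>

lemma condition_1_of_solution:
  assumes "nonzero f_y" "nonzero S"
  shows condition_1
proof -
  have SA: "S * A \<doteq> R * T - f_y * (T_y - f * P_y - P * f_y)"
  proof (rule agreeI)
    fix x assume x [simp]: "x \<in> V"
    show "(S * A) x = (R * T - f_y * (T_y - f * P_y - P * f_y)) x"
      unfolding fun_apply S_eq[OF x]
      using agreeD[OF constraint x, unfolded fun_apply, THEN eq_diff0] constraint_y[OF x, THEN eq_diff0] by algebra
  qed
  have a: "vanishes ((f*P_y*f_y - P*f_y^2 + Q*P_y + 2*P_y^2 - f_y*P_zy)*(2*P*R*f - 3*P*f_y^2 - 3*f*P_y*f_y - R*P_z + f_y*P_zy)
      - (2*P*f^2*f_y - 2*P^2*f_y + 2*P*Q*f + 4*P*f*P_y - 2*P*f_y*g_y - 3*f*P_z*f_y - g*P_y*f_y - Q*P_z - 2*P_z*P_y + f_y*P_zz)*S)"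
  proof (rule vanishes_from_V)
    fix x assume x [simp]: "x \<in> V"
    have 1: "S x * A x = - (2*P x*R x*f x - 3*P x*(f_y x)^2 - 3*f x*P_y x*f_y x - R x*P_z x + f_y x*P_zy x)"
      using agreeD[OF SA x] by (simp add: Pz Pzy power2_eq_square algebra_simps)
    have 2: "- (f x*P_y x*f_y x - P x*(f_y x)^2 + Q x*P_y x + 2*(P_y x)^2 - f_y x*P_zy x) * A x
      = 2*P x*(f x)^2*f_y x - 2*(P x)^2*f_y x + 2*P x*Q x*f x + 4*P x*f x*P_y x - 2*P x*f_y x*g_y x - 3*f x*P_z x*f_y x - g x*P_y x*f_y x - Q x*P_z x - 2*P_z x*P_y x + f_y x*P_zz x"
      using agreeD[OF constraint x, unfolded fun_apply, THEN eq_diff0] constraint_z[OF x, THEN eq_diff0]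
      unfolding Pz[OF x] Pzz[OF x] by algebra
    from 1[THEN eq_diff0] 2[THEN eq_diff0] show "((f*P_y*f_y - P*f_y^2 + Q*P_y + 2*P_y^2 - f_y*P_zy)*(2*P*R*f - 3*P*f_y^2 - 3*f*P_y*f_y - R*P_z + f_y*P_zy)
      - (2*P*f^2*f_y - 2*P^2*f_y + 2*P*Q*f + 4*P*f*P_y - 2*P*f_y*g_y - 3*f*P_z*f_y - g*P_y*f_y - Q*P_z - 2*P_z*P_y + f_y*P_zz)*S) x = 0"
      unfolding fun_apply by algebra
  qed (intro analytic2_intros \<Omega>_analytic)
  have b: "vanishes (S^2*P_y + (4*f*f_y + Q)*S^2 - S*S_z*f_y + f_y*(2*P*f - P_z)*R_y*S - R*P_y^2*S + (f_y*R_z - 4*R*f*f_y - 6*f_y^3 - Q*R)*P_y*S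
      - f_y*R*(4*P*f_y - P_zy)*S + 3*S_y*f_y^2*f*P_y - S_y*f_y*(2*P*R*f - 3*P*f_y^2 - R*P_z + P_zy*f_y))"
  proof (rule vanishes_from_V)
    fix x assume x [simp]: "x \<in> V"
    have SA': "S x * A x = R x * T x - f_y x * (T_y x - f x * P_y x - P x * f_y x)"
      using agreeD[OF SA x] by simp
    have SAy: "S_y x * A x + S x * f x = R_y x * T x + R x * T_y x - R x * (T_y x - f x * P_y x - P x * f_y x)
       - f_y x * (\<partial>y T_y x - f_y x * P_y x - f x * P_yy x - P_y x * f_y x - P x * R x)"
      using agree_y[OF SA x] by (simp add: Aw fyy algebra_simps)
    show "(S^2*P_y + (4*f*f_y + Q)*S^2 - S*S_z*f_y + f_y*(2*P*f - P_z)*R_y*S - R*P_y^2*S + (f_y*R_z - 4*R*f*f_y - 6*f_y^3 - Q*R)*P_y*S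
      - f_y*R*(4*P*f_y - P_zy)*S + 3*S_y*f_y^2*f*P_y - S_y*f_y*(2*P*R*f - 3*P*f_y^2 - R*P_z + P_zy*f_y)) x = 0"
      unfolding fun_apply
      using SA'[THEN eq_diff0] SAy[THEN eq_diff0] Sz[OF x, THEN eq_diff0] S_eq[OF x, THEN eq_diff0]
      unfolding Pzyy[OF x] Pz[OF x] Pzy[OF x] by algebra
  qed (intro analytic2_intros \<Omega>_analytic)
  show ?thesis unfolding condition_1_def using assms a b by blast
qed

text \<open>If \<open>f_y = 0\<close>, then \<open>f_yz = P_y + Q\<close> forces
  \<open>P_y = - Q\<close>, and the constraint alone gives \<open>T = - Q * A\<close>. Its
  \<open>y\<close>-derivative together with \<open>A_y = f\<close> is the first equation of the
  condition; the second is \<open>w_z = f * w - A * P\<close> with denominators cleared.\<close>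

lemma condition_2_of_solution:
  assumes fy: "vanishes f_y"
  shows condition_2
proof -
  have fy0: "f_y \<doteq> 0" using fy V_sub by (auto simp: agree_def)
  have fy0' [simp]: "f_y x = 0" "f_yz x = 0" "f_yy x = 0" if "x \<in> V" for x
    using agreeD[OF fy0 that] agree_z[OF fy0 that] agree_y[OF fy0 that] by simp_all
  have Py: "P_y \<doteq> - Q"
  proof (rule agreeI)
    fix x assume "x \<in> V"
    then show "P_y x = (- Q) x" using fyz[of x] by (simp add: eq_neg_iff_add_eq_0)
  qed
  have T: "T \<doteq> - (Q * A)"
    using constraint agreeD[OF Py] by (auto simp: agree_def)
  have Qz: "Q_z \<doteq> 3 * f * Q + Q_y * A"
  proof (rule agreeI)
    fix x assume x [simp]: "x \<in> V"
    show "Q_z x = (3 * f * Q + Q_y * A) x"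
      using agree_z[OF Py x] agree_y[OF T x] agreeD[OF Py x] Pzy[OF x] Pyz[OF x]
      by (simp add: Aw algebra_simps)
  qed
  have a: "vanishes (2*Q*Q_z + 2*T*Q_y - 6*Q^2*f)"
  proof (rule vanishes_from_V)
    show "(2*Q*Q_z + 2*T*Q_y - 6*Q^2*f) x = 0" if "x \<in> V" for x
      using agreeD[OF Qz that] agreeD[OF T that] by (simp add: power2_eq_square algebra_simps)
  qed (intro analytic2_intros \<Omega>_analytic)
  have b: "vanishes ((f*g - g_z)*Q^5 + 3*Q_y*T*(3*T*f - T_z)*Q^2 + (4*T*f_z - 12*T*f^2 - T*g_y + 7*f*T_z - T_zz)*Q^4 + Q_yy*T^3*Q - 3*Q_y^2*T^3)"
  proof (rule vanishes_from_V)
    fix x assume x [simp]: "x \<in> V"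
    have T': "T x = - Q x * A x" using agreeD[OF T x] by simp
    have Qz': "Q_z x = 3 * f x * Q x + Q_y x * A x" using agreeD[OF Qz x] by simp
    have Qzy: "Q_zy x = 4 * f x * Q_y x + Q_yy x * A x"
      using agree_y[OF Qz x] by (simp add: Aw)
    have Qzz: "\<partial>z Q_z x = 3 * (P x + g_y x) * Q x + 3 * f x * Q_z x + Q_zy x * A x + Q_y x * (g x - w x)"
      using agree_z[OF Qz x] by (simp add: Aw fz Qyz algebra_simps)
    have Tz: "T_z \<doteq> - (Q_z * A) - Q * (g - w)"
      by (rule agreeI) (simp add: agree_z[OF T] Aw)
    then have Tz': "T_z x = - (Q_z x * A x) - Q x * (g x - w x)"
      by (auto dest: agreeD[OF _ x])
    have Tzz: "T_zz x = - (\<partial>z Q_z x * A x) - 2 * Q_z x * (g x - w x) - Q x * (g_z x - (f x * w x - A x * P x))"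
      using agree_z[OF Tz x] by (simp add: Aw algebra_simps)
    show "((f*g - g_z)*Q^5 + 3*Q_y*T*(3*T*f - T_z)*Q^2 + (4*T*f_z - 12*T*f^2 - T*g_y + 7*f*T_z - T_zz)*Q^4 + Q_yy*T^3*Q - 3*Q_y^2*T^3) x = 0"
      unfolding fun_apply Tzz Tz' T' Qzz Qzy Qz' fz[OF x] by algebra
  qed (intro analytic2_intros \<Omega>_analytic)
  have "nonzero g_yy" using fy fy_gyy_nonzero by blast
  then show ?thesis unfolding condition_2_def using fy a b by blast
qed

end

section \<open>The degenerate case \<open>S = 0\<close>\<close>

text \<open>The fourth equation of condition 3 is a combination of the third one and its \<open>z\<close>-derivative.\<close>

lemma fourth_polynomial:
  fixes f f_y f_z f_yz R P T Q :: "'a::field_char_0"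
  assumes j: "P_y = p * f_y" "T = t * f_y" "P_yy = R * p"
    "P_zy = 3 * P * f_y + 3 * f * (p * f_y) + R * t"
    "R_z = R * p + Q_y" "R_yz = R_y * p + Q_yy"
    "P_z = t * f_y + 2 * f * P" "f_yz = p * f_y + Q" "f_z = P + g_y"
  shows "(R*f_y*Q*P_y*T_z - Q_y*f_y*Q*T*P_y - R*Q_z*f_y*T*P_y - f_y^2*T*(3*f^2 + 2*P + g_y)*R*P_y + R*f_y^2*f*P_y*T_z + 2*Q_y*f_y^2*f*T*P_y - 4*R*f_y^2*Q*T*P
      - Q_y*f_y^2*P_y*T_z - R^2*f_y*f*T^2 + R*f_y^3*P*T_z + R*Q^2*T*P_y + R*Q*T*P_y^2 - Q_y*f_y*T*P_y^2 - f_y^3*T*(5*P*f + 7*T)*R + 3*R*Q_y*f_y*T^2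
      + 2*Q_y*f_y^3*T*P - 12*f_y^3*Q*T*P_y - 18*f_y^4*f*T*P_y + f_y^2*T*Q_zy*P_y + 6*f_y^4*P_y*T_z - 2*R^2*Q*T^2 - 6*f_y^3*T*P_y^2 - f_y^2*Q_yy*T^2
      - 18*f_y^5*T*P - 3*R*f_y*Q*f*T*P_y)
    = f_y * T * ((Q_zy * P_y + Q_y * P_zy - R_z * f * P_y - R * f_z * P_y - R * f * P_zy - T_z * R_y - T * R_yz) * f_y
    + (Q_y * P_y - R * f * P_y - T * R_y) * f_yz - 18 * f_y^2 * f_yz * P_y - 6 * f_y^3 * P_zy
    - R_z * f_y^2 * P - 2 * R * f_y * f_yz * P - R * f_y^2 * P_z
    - R_z * (Q * P_y - R * T) - R * (Q_z * P_y + Q * P_zy - R_z * T - R * T_z))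
    - (2 * P_y * T + Q * T + T_z * f_y) *
    ((Q_y * P_y - R * f * P_y - T * R_y) * f_y - 6 * f_y^3 * P_y - R * f_y^2 * P - R * (Q * P_y - R * T))"
  unfolding j by algebra

text \<open>For \<open>A = N / D\<close> and \<open>w = (P_y * A - T) / f_y\<close> the right-hand side is
  \<open>- D^2 * f_y * (A_z - g + w)\<close>.\<close>

lemma fifth_polynomial:
  fixes f f_y f_z f_yz R P T Q g :: "'a::field_char_0"
  assumes j: "P_y = p * f_y" "T = t * f_y" "P_zy = 3 * P * f_y + 3 * f * (p * f_y) + R * t"
    "R_z = R * p + Q_y" "P_z = t * f_y + 2 * f * P" "f_yz = p * f_y + Q" "f_z = P + g_y"
    and N: "N = f_y * (T_z - g * P_y) - (2 * P_y + Q + f * f_y) * T"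
    and N_z: "N_z = f_yz * (T_z - g * P_y) + f_y * (T_zz - g_z * P_y - g * P_zy)
      - (2 * P_zy + Q_z + f_z * f_y + f * f_yz) * T - (2 * P_y + Q + f * f_y) * T_z"
    and D: "D = 4 * P * f_y^2 + 2 * f * P_y * f_y - Q * P_y + R * T - 2 * P_y^2"
    and D_z: "D_z = 4 * P_z * f_y^2 + 8 * P * f_y * f_yz + 2 * f_z * P_y * f_y + 2 * f * P_zy * f_y
      + 2 * f * P_y * f_yz - Q_z * P_y - Q * P_zy + R_z * T + R * T_z - 4 * P_y * P_zy"
  shows "(28*f_y^5*g*P^2 - 2*P_y^2*(9*P*T - 9*T*f^2 + 3*T*g_y + g_z*P_y)*f_y^2 - 4*T_zz*f_y^4*P
      + 2*P_y*(2*f^2*g*P_y + 18*P*T*f - 6*P*g*P_y + f*P_y*g_z - g*P_y*g_y - 4*T^2 - 3*T*f^3)*f_y^3 - (15*P*T*f + 12*P*g*P_y + 4*T^2)*f_y^3*Q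
      + R*f_y^2*T_z^2 + (18*P*f + 4*T)*f_y^4*T_z + R*Q^2*T^2 + 2*T_zz*f_y^2*P_y^2 - 5*R*f_y*T*P_y*T_z + 15*R*f_y^3*g*T*P - 2*f_y^2*Q*f*P_y*T_z
      - 2*R*f_y*Q*T*T_z - 2*T_zz*f_y^3*f*P_y + 2*R^2*f_y*g*T^2 + T*P_y*(15*T*f - g*P_y)*f_y*R - 12*f_y^2*f*P_y^2*T_z + 2*P_y*(4*f^2 - P + g_y)*f_y^3*T_z
      + 4*Q_z*f_y^3*T*P + 5*f_y^3*Q*P*T_z - 5*f_y^2*Q^2*T*P - 2*Q_y*f_y*T^2*P_y + 2*R*Q*T^2*P_y
      - P_y*(3*T*f^2 + 4*f*g*P_y + 19*P*T + 3*T*g_y + g_z*P_y)*f_y^2*Q - T*(T*f + g*P_y)*f_y^2*Q_y - T_zz*R*f_y^2*T + Q_y*f_y^2*T*T_z - Q_y*f_y*Q*T^2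
      + R*Q_z*f_y*T^2 + P_y*(3*T*f + g*P_y)*Q_z*f_y^2 - R*f_y*Q*g*T*P_y + T*(7*f*g*P_y - 2*T*f^2 + 23*P*T + T*g_y + g_z*P_y)*f_y^2*R
      + (2*T*f - g*P_y)*f_y^2*R*T_z + T_zz*f_y^2*Q*P_y - Q_z*f_y^2*P_y*T_z + 3*R^2*T^3
      + (20*P*f*g*P_y - 14*P*T*f^2 + 44*P^2*T + 4*P*T*g_y + 4*P*P_y*g_z - 4*T^2*f - 4*T*g*P_y)*f_y^4)
    = D^2 * f_y * g - D * (P_y * N - T * D) - f_y * (N_z * D - N * D_z)"
  unfolding N N_z D D_z j by algebra

text \<open>\<open>A\<close> and \<open>w\<close> do not occur, because the converse direction works
  here before a solution exists. The last assumption is what the \<open>y\<close>-derivative of the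
  constraint reduces to when its left-hand side is proportional to that of the constraint: the
  right-hand sides must be proportional too.\<close>

locale degenerate = region \<Omega> f g V
  for \<Omega> :: "('a::{real_normed_field,banach} \<times> 'a) set" and f g and V :: "('a \<times> 'a) set" +
  assumes f_y_nonzero: "\<And>x. x \<in> V \<Longrightarrow> f_y x \<noteq> 0"
    and S_zero: "R * P_y - f_y * P_yy \<doteq> 0"
    and constraint_y_compatible: "P*f_y^2 + f*P_y*f_y + R*T - f_y*T_y \<doteq> 0"
begin

text \<open>With \<open>p = P_y / f_y\<close> and \<open>t = T / f_y\<close> at a point, all relations between the jets are in
  solved polynomial form.\<close>

lemma solved_jets:
  assumes x [simp]: "x \<in> V"
  obtains p t where "P_y x = p * f_y x" "T x = t * f_y x" "P_yy x = R x * p"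
    "T_y x = P x * f_y x + f x * (p * f_y x) + R x * t"
    "P_zy x = 3 * P x * f_y x + 3 * f x * (p * f_y x) + R x * t"
    "\<partial>y T_y x = 2 * P x * R x + 2 * p * (f_y x)^2 + 2 * f x * R x * p + R_y x * t"
    "\<partial>y P_zy x = 4 * P x * R x + 6 * p * (f_y x)^2 + 4 * f x * R x * p + R_y x * t"
    "R_z x = R x * p + Q_y x" "\<partial>y P_yy x = R_y x * p" "\<partial>z R_y x = R_y x * p + Q_yy x"
    "P_z x = t * f_y x + 2 * f x * P x" "f_yz x = p * f_y x + Q x"
proof -
  note nz = f_y_nonzero[OF x]
  obtain p where Py: "P_y x = p * f_y x" using nz by (metis nonzero_eq_divide_eq)
  obtain t where Tt: "T x = t * f_y x" using nz by (metis nonzero_eq_divide_eq)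
  have Pyy: "P_yy x = R x * p"
    using agreeD[OF S_zero x] nz by (simp add: Py)
  have "f_y x * T_y x = f_y x * (P x * f_y x + f x * (p * f_y x) + R x * t)"
    using agreeD[OF constraint_y_compatible x] by (simp add: Py Tt power2_eq_square algebra_simps)
  then have Ty: "T_y x = P x * f_y x + f x * (p * f_y x) + R x * t" using nz by simp
  have Pzy': "P_zy x = 3 * P x * f_y x + 3 * f x * (p * f_y x) + R x * t"
    unfolding Pzy[OF x] Ty Py by algebra
  have "P_y x * (f_y x)^2 + 2 * P x * f_y x * R x + f x * P_yy x * f_y x + f x * P_y x * R x + f_y x * P_y x * f_y x
      + R_y x * T x - f_y x * \<partial>y T_y x = 0"
    using agree_y[OF constraint_y_compatible x] by (simp add: fyy power2_eq_square algebra_simps)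
  then have "f_y x * \<partial>y T_y x = f_y x * (2 * P x * R x + 2 * p * (f_y x)^2 + 2 * f x * R x * p + R_y x * t)"
    unfolding Pyy Py Tt by algebra
  then have Tyy: "\<partial>y T_y x = 2 * P x * R x + 2 * p * (f_y x)^2 + 2 * f x * R x * p + R_y x * t"
    using nz by simp
  have Pzyy': "\<partial>y P_zy x = 4 * P x * R x + 6 * p * (f_y x)^2 + 4 * f x * R x * p + R_y x * t"
    unfolding Pzyy[OF x] Tyy Pyy Py by algebra
  have Rz': "R_z x = R x * p + Q_y x" using Rz[OF x] Pyy by simp
  have "R_y x * P_y x + R x * P_yy x - R x * P_yy x - f_y x * \<partial>y P_yy x = 0"
    using agree_y[OF S_zero x] by (simp add: fyy algebra_simps)
  then have Pyyy: "\<partial>y P_yy x = R_y x * p" using nz by (simp add: Py)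
  have "R_z \<doteq> P_yy + Q_y" by (rule agreeI) (simp add: Rz)
  from agree_y[OF this x] have Ryz: "\<partial>z R_y x = R_y x * p + Q_yy x"
    unfolding Pyyy[symmetric] by (simp add: commute_V)
  have "P_z x = t * f_y x + 2 * f x * P x" "f_yz x = p * f_y x + Q x"
    using Pz[OF x] fyz[OF x] by (simp_all add: Py Tt)
  then show thesis
    by (rule that[OF Py Tt Pyy Ty Pzy' Tyy Pzyy' Rz' Pyyy Ryz])
qed

text \<open>This is the \<open>z\<close>-derivative of \<open>R * P_y - f_y * P_yy = 0\<close>, with
  the third derivative of \<open>P\<close> taken from the \<open>y\<close>-derivative of the
  compatibility relation.\<close>

lemma condition_3_third: "((Q_y*P_y - R*f*P_y - T*R_y)*f_y - 6*f_y^3*P_y - R*f_y^2*P - R*(Q*P_y - R*T)) \<doteq> 0"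
proof (rule agreeI)
  fix x assume x [simp]: "x \<in> V"
  obtain p t where j: "P_y x = p * f_y x" "T x = t * f_y x" "P_yy x = R x * p"
    "P_zy x = 3 * P x * f_y x + 3 * f x * (p * f_y x) + R x * t"
    "\<partial>y P_zy x = 4 * P x * R x + 6 * p * (f_y x)^2 + 4 * f x * R x * p + R_y x * t"
    "R_z x = R x * p + Q_y x"
    by (rule solved_jets[OF x])
  have "R_z x * P_y x + R x * P_zy x - (P_y x + Q x) * P_yy x - f_y x * \<partial>y P_zy x = 0"
    using agree_z[OF S_zero x] by (simp add: Pyz Pyyz fyz algebra_simps)
  then show "((Q_y*P_y - R*f*P_y - T*R_y)*f_y - 6*f_y^3*P_y - R*f_y^2*P - R*(Q*P_y - R*T)) x = 0 x"
    unfolding fun_apply j by algebra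
qed

lemma condition_3_fourth: "x \<in> V \<Longrightarrow> (R*f_y*Q*P_y*T_z - Q_y*f_y*Q*T*P_y - R*Q_z*f_y*T*P_y - f_y^2*T*(3*f^2 + 2*P + g_y)*R*P_y + R*f_y^2*f*P_y*T_z + 2*Q_y*f_y^2*f*T*P_y - 4*R*f_y^2*Q*T*P
      - Q_y*f_y^2*P_y*T_z - R^2*f_y*f*T^2 + R*f_y^3*P*T_z + R*Q^2*T*P_y + R*Q*T*P_y^2 - Q_y*f_y*T*P_y^2 - f_y^3*T*(5*P*f + 7*T)*R + 3*R*Q_y*f_y*T^2
      + 2*Q_y*f_y^3*T*P - 12*f_y^3*Q*T*P_y - 18*f_y^4*f*T*P_y + f_y^2*T*Q_zy*P_y + 6*f_y^4*P_y*T_z - 2*R^2*Q*T^2 - 6*f_y^3*T*P_y^2 - f_y^2*Q_yy*T^2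
      - 18*f_y^5*T*P - 3*R*f_y*Q*f*T*P_y) x = 0"
proof -
  assume x [simp]: "x \<in> V"
  obtain p t where j: "P_y x = p * f_y x" "T x = t * f_y x" "P_yy x = R x * p"
    "P_zy x = 3 * P x * f_y x + 3 * f x * (p * f_y x) + R x * t"
    "R_z x = R x * p + Q_y x" "\<partial>z R_y x = R_y x * p + Q_yy x"
    "P_z x = t * f_y x + 2 * f x * P x" "f_yz x = p * f_y x + Q x"
    by (rule solved_jets[OF x])
  define e3 where "e3 = (Q_y x * P_y x - R x * f x * P_y x - T x * R_y x) * f_y x - 6 * (f_y x)^3 * P_y x
    - R x * (f_y x)^2 * P x - R x * (Q x * P_y x - R x * T x)"
  define e3z where "e3z =
    (Q_zy x * P_y x + Q_y x * P_zy x - R_z x * f x * P_y x - R x * f_z x * P_y x - R x * f x * P_zy x - T_z x * R_y x - T x * \<partial>z R_y x) * f_y x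
    + (Q_y x * P_y x - R x * f x * P_y x - T x * R_y x) * f_yz x - 18 * (f_y x)^2 * f_yz x * P_y x - 6 * (f_y x)^3 * P_zy x
    - R_z x * (f_y x)^2 * P x - 2 * R x * f_y x * f_yz x * P x - R x * (f_y x)^2 * P_z x
    - R_z x * (Q x * P_y x - R x * T x) - R x * (Q_z x * P_y x + Q x * P_zy x - R_z x * T x - R x * T_z x)"
  have e3: "e3 = 0" using agreeD[OF condition_3_third x] by (simp add: e3_def)
  have e3z: "e3z = 0"
    using agree_z[OF condition_3_third x]
    by (simp add: e3z_def Pyz Qyz power2_eq_square power3_eq_cube algebra_simps)
  \<comment> \<open>The multipliers are the coefficients of \<open>R_y\<close> in the third equation
    and in its \<open>z\<close>-derivative, up to sign, so that \<open>R_y\<close> cancels.\<close>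
  have "(R*f_y*Q*P_y*T_z - Q_y*f_y*Q*T*P_y - R*Q_z*f_y*T*P_y - f_y^2*T*(3*f^2 + 2*P + g_y)*R*P_y + R*f_y^2*f*P_y*T_z + 2*Q_y*f_y^2*f*T*P_y - 4*R*f_y^2*Q*T*P
      - Q_y*f_y^2*P_y*T_z - R^2*f_y*f*T^2 + R*f_y^3*P*T_z + R*Q^2*T*P_y + R*Q*T*P_y^2 - Q_y*f_y*T*P_y^2 - f_y^3*T*(5*P*f + 7*T)*R + 3*R*Q_y*f_y*T^2
      + 2*Q_y*f_y^3*T*P - 12*f_y^3*Q*T*P_y - 18*f_y^4*f*T*P_y + f_y^2*T*Q_zy*P_y + 6*f_y^4*P_y*T_z - 2*R^2*Q*T^2 - 6*f_y^3*T*P_y^2 - f_y^2*Q_yy*T^2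
      - 18*f_y^5*T*P - 3*R*f_y*Q*f*T*P_y) x
    = f_y x * T x * e3z - (2 * P_y x * T x + Q x * T x + T_z x * f_y x) * e3"
    unfolding fun_apply e3_def e3z_def by (rule fourth_polynomial[OF j fz[OF x]])
  then show "(R*f_y*Q*P_y*T_z - Q_y*f_y*Q*T*P_y - R*Q_z*f_y*T*P_y - f_y^2*T*(3*f^2 + 2*P + g_y)*R*P_y + R*f_y^2*f*P_y*T_z + 2*Q_y*f_y^2*f*T*P_y - 4*R*f_y^2*Q*T*P
      - Q_y*f_y^2*P_y*T_z - R^2*f_y*f*T^2 + R*f_y^3*P*T_z + R*Q^2*T*P_y + R*Q*T*P_y^2 - Q_y*f_y*T*P_y^2 - f_y^3*T*(5*P*f + 7*T)*R + 3*R*Q_y*f_y*T^2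
      + 2*Q_y*f_y^3*T*P - 12*f_y^3*Q*T*P_y - 18*f_y^4*f*T*P_y + f_y^2*T*Q_zy*P_y + 6*f_y^4*P_y*T_z - 2*R^2*Q*T^2 - 6*f_y^3*T*P_y^2 - f_y^2*Q_yy*T^2
      - 18*f_y^5*T*P - 3*R*f_y*Q*f*T*P_y) x = 0" by (simp add: e3 e3z)
qed

text \<open>Eliminating \<open>w\<close> between the constraint and its \<open>z\<close>-derivative
  gives an equation for \<open>A\<close> with right-hand side \<open>N\<close>. The coefficient of
  \<open>A\<close> becomes \<open>D\<close> once \<open>P_zy\<close> is rewritten by the
  compatibility relation.\<close>

definition N :: "'a \<times> 'a \<Rightarrow> 'a" where
  "N = f_y*(T_z - g*P_y) - (2*P_y + Q + f*f_y)*T"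

lemma N_analytic [simp]: "N analytic2_on V"
  by (simp add: N_def)

lemma condition_3_fifth:
  assumes x [simp]: "x \<in> V"
  shows "(28*f_y^5*g*P^2 - 2*P_y^2*(9*P*T - 9*T*f^2 + 3*T*g_y + g_z*P_y)*f_y^2 - 4*T_zz*f_y^4*P
      + 2*P_y*(2*f^2*g*P_y + 18*P*T*f - 6*P*g*P_y + f*P_y*g_z - g*P_y*g_y - 4*T^2 - 3*T*f^3)*f_y^3 - (15*P*T*f + 12*P*g*P_y + 4*T^2)*f_y^3*Q
      + R*f_y^2*T_z^2 + (18*P*f + 4*T)*f_y^4*T_z + R*Q^2*T^2 + 2*T_zz*f_y^2*P_y^2 - 5*R*f_y*T*P_y*T_z + 15*R*f_y^3*g*T*P - 2*f_y^2*Q*f*P_y*T_z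
      - 2*R*f_y*Q*T*T_z - 2*T_zz*f_y^3*f*P_y + 2*R^2*f_y*g*T^2 + T*P_y*(15*T*f - g*P_y)*f_y*R - 12*f_y^2*f*P_y^2*T_z + 2*P_y*(4*f^2 - P + g_y)*f_y^3*T_z
      + 4*Q_z*f_y^3*T*P + 5*f_y^3*Q*P*T_z - 5*f_y^2*Q^2*T*P - 2*Q_y*f_y*T^2*P_y + 2*R*Q*T^2*P_y
      - P_y*(3*T*f^2 + 4*f*g*P_y + 19*P*T + 3*T*g_y + g_z*P_y)*f_y^2*Q - T*(T*f + g*P_y)*f_y^2*Q_y - T_zz*R*f_y^2*T + Q_y*f_y^2*T*T_z - Q_y*f_y*Q*T^2
      + R*Q_z*f_y*T^2 + P_y*(3*T*f + g*P_y)*Q_z*f_y^2 - R*f_y*Q*g*T*P_y + T*(7*f*g*P_y - 2*T*f^2 + 23*P*T + T*g_y + g_z*P_y)*f_y^2*R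
      + (2*T*f - g*P_y)*f_y^2*R*T_z + T_zz*f_y^2*Q*P_y - Q_z*f_y^2*P_y*T_z + 3*R^2*T^3
      + (20*P*f*g*P_y - 14*P*T*f^2 + 44*P^2*T + 4*P*T*g_y + 4*P*P_y*g_z - 4*T^2*f - 4*T*g*P_y)*f_y^4) x
    = (D x)^2 * f_y x * g x - D x * (P_y x * N x - T x * D x) - f_y x * (\<partial>z N x * D x - N x * \<partial>z D x)"
proof -
  obtain p t where j: "P_y x = p * f_y x" "T x = t * f_y x"
    "P_zy x = 3 * P x * f_y x + 3 * f x * (p * f_y x) + R x * t"
    "R_z x = R x * p + Q_y x"
    "P_z x = t * f_y x + 2 * f x * P x" "f_yz x = p * f_y x + Q x"
    by (rule solved_jets[OF x])
  have N: "N x = f_y x * (T_z x - g x * P_y x) - (2 * P_y x + Q x + f x * f_y x) * T x"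
    by (simp add: N_def)
  have Nz: "\<partial>z N x = f_yz x * (T_z x - g x * P_y x) + f_y x * (T_zz x - g_z x * P_y x - g x * P_zy x)
    - (2 * P_zy x + Q_z x + f_z x * f_y x + f x * f_yz x) * T x - (2 * P_y x + Q x + f x * f_y x) * T_z x"
    by (simp add: N_def Pyz algebra_simps)
  have Dz: "\<partial>z D x = 4 * P_z x * (f_y x)^2 + 8 * P x * f_y x * f_yz x + 2 * f_z x * P_y x * f_y x + 2 * f x * P_zy x * f_y x
    + 2 * f x * P_y x * f_yz x - Q_z x * P_y x - Q x * P_zy x + R_z x * T x + R x * T_z x - 4 * P_y x * P_zy x"
    by (simp add: D_def Pyz power2_eq_square algebra_simps)
  show ?thesis
    unfolding fun_apply by (rule fifth_polynomial[OF j fz[OF x] N Nz D_eq[OF x] Dz])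
qed

end

text \<open>The compatibility expression equals \<open>S * A\<close>, by the elimination that is
  used for condition 1.\<close>

lemma (in solution) degenerate_of_solution:
  assumes fy: "\<And>x. x \<in> V \<Longrightarrow> f_y x \<noteq> 0" and S: "\<And>x. x \<in> V \<Longrightarrow> S x = 0"
  shows "degenerate \<Omega> f g V"
proof
  show "f_y x \<noteq> 0" if "x \<in> V" for x by (rule fy[OF that])
  show "R * P_y - f_y * P_yy \<doteq> 0"
    by (rule agreeI) (use S in \<open>simp add: S_eq\<close>)
  show "P*f_y^2 + f*P_y*f_y + R*T - f_y*T_y \<doteq> 0"
  proof (rule agreeI)
    fix x assume x [simp]: "x \<in> V"
    show "(P*f_y^2 + f*P_y*f_y + R*T - f_y*T_y) x = 0 x"
      unfolding fun_apply
      using agreeD[OF constraint x, unfolded fun_apply, THEN eq_diff0] constraint_y[OF x, THEN eq_diff0]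
        S[OF x] S_eq[OF x, THEN eq_diff0] by algebra
  qed
qed

locale degenerate_solution = degenerate \<Omega> f g V + solution \<Omega> f g V A w
  for \<Omega> :: "('a::{real_normed_field,banach} \<times> 'a) set" and f g and V :: "('a \<times> 'a) set"
    and A w :: "'a \<times> 'a \<Rightarrow> 'a"
begin

lemma solved:
  assumes x [simp]: "x \<in> V"
  obtains p t where "P_y x = p * f_y x" "T x = t * f_y x" "P_yy x = R x * p"
    "T_y x = P x * f_y x + f x * (p * f_y x) + R x * t"
    "P_zy x = 3 * P x * f_y x + 3 * f x * (p * f_y x) + R x * t"
    "w x = p * A x - t"
proof -
  obtain p t where j: "P_y x = p * f_y x" "T x = t * f_y x" "P_yy x = R x * p"
    "T_y x = P x * f_y x + f x * (p * f_y x) + R x * t"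
    "P_zy x = 3 * P x * f_y x + 3 * f x * (p * f_y x) + R x * t"
    by (rule solved_jets[OF x])
  have "f_y x * w x = f_y x * (p * A x - t)"
    using agreeD[OF constraint x] by (simp add: j algebra_simps)
  then have "w x = p * A x - t" using f_y_nonzero[OF x] by simp
  with j show thesis by (rule that)
qed

lemma DA: "D * A \<doteq> N"
proof (rule agreeI)
  fix x assume x [simp]: "x \<in> V"
  obtain p t where j: "P_y x = p * f_y x" "T x = t * f_y x" "P_yy x = R x * p"
    "T_y x = P x * f_y x + f x * (p * f_y x) + R x * t"
    "P_zy x = 3 * P x * f_y x + 3 * f x * (p * f_y x) + R x * t"
    "w x = p * A x - t"
    by (rule solved[OF x])
  have "T_z x = g x * P_y x + ((P_zy x + P x * f_y x) * A x - (2 * P_y x + Q x + f x * f_y x) * w x)"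
    using constraint_z[OF x] by simp
  then show "(D * A) x = N x"
    unfolding N_def fun_apply D_eq[OF x] j by algebra
qed

text \<open>If \<open>T = 0\<close>, the constraint and the compatibility relation give
  \<open>f * w + P * A = 0\<close>; the \<open>y\<close>-derivative of this, compared with the
  constraint, forces \<open>w = 0\<close>, hence \<open>P = - w_y = 0\<close>. If
  \<open>R = 0\<close>, then \<open>S = 0\<close> gives \<open>P_yy = 0\<close>, and the solved
  forms of its \<open>z\<close>-derivative and of \<open>P_zy\<close> force first
  \<open>P_y = 0\<close> and then \<open>P = 0\<close>.\<close>

lemma P_nonzero_imp:
  assumes P: "nonzero P"
  shows "nonzero T" and "nonzero R"
proof -
  show "nonzero T"
  proof (rule ccontr)
    assume "\<not> nonzero T"
    then have T0: "T x = 0" if "x \<in> V" for x using that V_sub by auto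
    have fw: "f * w + P * A \<doteq> 0"
    proof (rule agreeI)
      fix x assume x [simp]: "x \<in> V"
      have "f_y x * (P x * f_y x + f x * P_y x) = 0"
        using agreeD[OF constraint_y_compatible x] agree_y[OF agreeI[of T 0] x] T0
        by (simp add: power2_eq_square algebra_simps)
      then have "P x * f_y x + f x * P_y x = 0" using f_y_nonzero[OF x] by simp
      moreover have "P_y x * A x - f_y x * w x = 0" using agreeD[OF constraint x] T0 by simp
      ultimately have "f_y x * (f x * w x + P x * A x) = 0" by algebra
      then show "(f * w + P * A) x = 0 x" using f_y_nonzero[OF x] by simp
    qed
    have "w \<doteq> 0"
    proof (rule agreeI)
      fix x assume x [simp]: "x \<in> V"
      have "f_y x * w x + P_y x * A x = 0" using agree_y[OF fw x] by (simp add: Aw algebra_simps)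
      moreover have "P_y x * A x = f_y x * w x" using agreeD[OF constraint x] T0 by simp
      ultimately have "2 * (f_y x * w x) = 0" by (simp only: mult_2)
      then show "w x = 0 x" using f_y_nonzero[OF x] by simp
    qed
    from agree_y[OF this] have "P x = 0" if "x \<in> V" for x using that by (simp add: Aw)
    then show False using vanishes_from_V[of P] P by auto
  qed
  show "nonzero R"
  proof (rule ccontr)
    assume "\<not> nonzero R"
    then have R: "R \<doteq> 0" using V_sub by (auto simp: agree_def)
    then have R0 [simp]: "R x = 0" "R_y x = 0" if "x \<in> V" for x
      using that agreeD[OF R] agree_y[OF R] by auto
    have Pyy: "P_yy \<doteq> 0"
      by (rule agreeI) (use agreeD[OF S_zero] f_y_nonzero in auto)
    have Py: "P_y \<doteq> 0"
    proof (rule agreeI)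
      fix x assume x [simp]: "x \<in> V"
      obtain p t where "P_y x = p * f_y x"
        "\<partial>y P_zy x = 4 * P x * R x + 6 * p * (f_y x)^2 + 4 * f x * R x * p + R_y x * t"
        by (rule solved_jets[OF x])
      then show "P_y x = 0 x"
        using agree_z[OF Pyy x] f_y_nonzero[OF x] Pyyz[OF x] by simp
    qed
    have "P x = 0" if x [simp]: "x \<in> V" for x
    proof -
      obtain p t where "P_y x = p * f_y x"
        "P_zy x = 3 * P x * f_y x + 3 * f x * (p * f_y x) + R x * t"
        by (rule solved_jets[OF x])
      then show "P x = 0"
        using agree_z[OF Py x] agreeD[OF Py x] f_y_nonzero[OF x] Pyz[OF x] by simp
    qed
    then show False using vanishes_from_V[of P] P by auto
  qed
qed

lemma condition_3_of_solution:
  assumes "nonzero f_y" "nonzero P_y" "nonzero T" "nonzero D"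
  shows condition_3
proof -
  have "vanishes (R*P_y - f_y*P_yy)"
    by (rule vanishes_from_V[rotated], use agreeD[OF S_zero] in simp) (intro analytic2_intros \<Omega>_analytic)
  moreover have "vanishes (P*f_y^2 + f*P_y*f_y + R*T - f_y*T_y)"
    by (rule vanishes_from_V[rotated], use agreeD[OF constraint_y_compatible] in simp) (intro analytic2_intros \<Omega>_analytic)
  moreover have "vanishes ((Q_y*P_y - R*f*P_y - T*R_y)*f_y - 6*f_y^3*P_y - R*f_y^2*P - R*(Q*P_y - R*T))"
    by (rule vanishes_from_V[rotated], use agreeD[OF condition_3_third] in simp) (intro analytic2_intros \<Omega>_analytic)
  moreover have "vanishes (R*f_y*Q*P_y*T_z - Q_y*f_y*Q*T*P_y - R*Q_z*f_y*T*P_y - f_y^2*T*(3*f^2 + 2*P + g_y)*R*P_y + R*f_y^2*f*P_y*T_z + 2*Q_y*f_y^2*f*T*P_y - 4*R*f_y^2*Q*T*P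
      - Q_y*f_y^2*P_y*T_z - R^2*f_y*f*T^2 + R*f_y^3*P*T_z + R*Q^2*T*P_y + R*Q*T*P_y^2 - Q_y*f_y*T*P_y^2 - f_y^3*T*(5*P*f + 7*T)*R + 3*R*Q_y*f_y*T^2
      + 2*Q_y*f_y^3*T*P - 12*f_y^3*Q*T*P_y - 18*f_y^4*f*T*P_y + f_y^2*T*Q_zy*P_y + 6*f_y^4*P_y*T_z - 2*R^2*Q*T^2 - 6*f_y^3*T*P_y^2 - f_y^2*Q_yy*T^2
      - 18*f_y^5*T*P - 3*R*f_y*Q*f*T*P_y)"
    by (rule vanishes_from_V[OF _ condition_3_fourth]) (intro analytic2_intros \<Omega>_analytic)
  moreover have "vanishes (28*f_y^5*g*P^2 - 2*P_y^2*(9*P*T - 9*T*f^2 + 3*T*g_y + g_z*P_y)*f_y^2 - 4*T_zz*f_y^4*P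
      + 2*P_y*(2*f^2*g*P_y + 18*P*T*f - 6*P*g*P_y + f*P_y*g_z - g*P_y*g_y - 4*T^2 - 3*T*f^3)*f_y^3 - (15*P*T*f + 12*P*g*P_y + 4*T^2)*f_y^3*Q
      + R*f_y^2*T_z^2 + (18*P*f + 4*T)*f_y^4*T_z + R*Q^2*T^2 + 2*T_zz*f_y^2*P_y^2 - 5*R*f_y*T*P_y*T_z + 15*R*f_y^3*g*T*P - 2*f_y^2*Q*f*P_y*T_z
      - 2*R*f_y*Q*T*T_z - 2*T_zz*f_y^3*f*P_y + 2*R^2*f_y*g*T^2 + T*P_y*(15*T*f - g*P_y)*f_y*R - 12*f_y^2*f*P_y^2*T_z + 2*P_y*(4*f^2 - P + g_y)*f_y^3*T_z
      + 4*Q_z*f_y^3*T*P + 5*f_y^3*Q*P*T_z - 5*f_y^2*Q^2*T*P - 2*Q_y*f_y*T^2*P_y + 2*R*Q*T^2*P_y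
      - P_y*(3*T*f^2 + 4*f*g*P_y + 19*P*T + 3*T*g_y + g_z*P_y)*f_y^2*Q - T*(T*f + g*P_y)*f_y^2*Q_y - T_zz*R*f_y^2*T + Q_y*f_y^2*T*T_z - Q_y*f_y*Q*T^2
      + R*Q_z*f_y*T^2 + P_y*(3*T*f + g*P_y)*Q_z*f_y^2 - R*f_y*Q*g*T*P_y + T*(7*f*g*P_y - 2*T*f^2 + 23*P*T + T*g_y + g_z*P_y)*f_y^2*R
      + (2*T*f - g*P_y)*f_y^2*R*T_z + T_zz*f_y^2*Q*P_y - Q_z*f_y^2*P_y*T_z + 3*R^2*T^3
      + (20*P*f*g*P_y - 14*P*T*f^2 + 44*P^2*T + 4*P*T*g_y + 4*P*P_y*g_z - 4*T^2*f - 4*T*g*P_y)*f_y^4)"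
  proof (rule vanishes_from_V)
    fix x assume x [simp]: "x \<in> V"
    have N: "N x = D x * A x" and Nz: "\<partial>z N x = \<partial>z D x * A x + D x * (g x - w x)"
      using agreeD[OF DA x] agree_z[OF DA x] by (simp_all add: Aw)
    have "P_y x * A x - f_y x * w x - T x = 0" using agreeD[OF constraint x] by simp
    then show "(28*f_y^5*g*P^2 - 2*P_y^2*(9*P*T - 9*T*f^2 + 3*T*g_y + g_z*P_y)*f_y^2 - 4*T_zz*f_y^4*P
      + 2*P_y*(2*f^2*g*P_y + 18*P*T*f - 6*P*g*P_y + f*P_y*g_z - g*P_y*g_y - 4*T^2 - 3*T*f^3)*f_y^3 - (15*P*T*f + 12*P*g*P_y + 4*T^2)*f_y^3*Q
      + R*f_y^2*T_z^2 + (18*P*f + 4*T)*f_y^4*T_z + R*Q^2*T^2 + 2*T_zz*f_y^2*P_y^2 - 5*R*f_y*T*P_y*T_z + 15*R*f_y^3*g*T*P - 2*f_y^2*Q*f*P_y*T_z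
      - 2*R*f_y*Q*T*T_z - 2*T_zz*f_y^3*f*P_y + 2*R^2*f_y*g*T^2 + T*P_y*(15*T*f - g*P_y)*f_y*R - 12*f_y^2*f*P_y^2*T_z + 2*P_y*(4*f^2 - P + g_y)*f_y^3*T_z
      + 4*Q_z*f_y^3*T*P + 5*f_y^3*Q*P*T_z - 5*f_y^2*Q^2*T*P - 2*Q_y*f_y*T^2*P_y + 2*R*Q*T^2*P_y
      - P_y*(3*T*f^2 + 4*f*g*P_y + 19*P*T + 3*T*g_y + g_z*P_y)*f_y^2*Q - T*(T*f + g*P_y)*f_y^2*Q_y - T_zz*R*f_y^2*T + Q_y*f_y^2*T*T_z - Q_y*f_y*Q*T^2
      + R*Q_z*f_y*T^2 + P_y*(3*T*f + g*P_y)*Q_z*f_y^2 - R*f_y*Q*g*T*P_y + T*(7*f*g*P_y - 2*T*f^2 + 23*P*T + T*g_y + g_z*P_y)*f_y^2*R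
      + (2*T*f - g*P_y)*f_y^2*R*T_z + T_zz*f_y^2*Q*P_y - Q_z*f_y^2*P_y*T_z + 3*R^2*T^3
      + (20*P*f*g*P_y - 14*P*T*f^2 + 44*P^2*T + 4*P*T*g_y + 4*P*P_y*g_z - 4*T^2*f - 4*T*g*P_y)*f_y^4) x = 0"
      unfolding condition_3_fifth[OF x] N Nz by algebra
  qed (intro analytic2_intros \<Omega>_analytic)
  ultimately show ?thesis
    unfolding condition_3_def using assms by blast
qed

text \<open>With \<open>D = 0\<close> the relation \<open>D * A = N\<close> gives
  \<open>N = 0\<close>. The third equation is \<open>D_y = 0\<close> after elimination of
  \<open>T_y\<close> by compatibility and of \<open>R * T\<close> by \<open>D = 0\<close>; the
  fourth is \<open>D_z = 0\<close> with \<open>T_z\<close> eliminated by \<open>N = 0\<close> and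
  \<open>T\<close> by \<open>D = 0\<close>.\<close>

lemma condition_5_of_solution:
  assumes "nonzero f_y" "nonzero T" "nonzero R" and D: "vanishes D"
  shows condition_5
proof -
  have D': "D \<doteq> 0" using D V_sub by (auto simp: agree_def)
  have 1: "vanishes (R*T + 4*f_y^2*P - 2*P_y^2 + (2*f*f_y - Q)*P_y)"
  proof (rule vanishes_from_V)
    fix x assume x [simp]: "x \<in> V"
    show "(R*T + 4*f_y^2*P - 2*P_y^2 + (2*f*f_y - Q)*P_y) x = 0"
      unfolding fun_apply
      using agreeD[OF D' x, unfolded fun_apply] D_eq[OF x, THEN eq_diff0] by algebra
  qed (intro analytic2_intros \<Omega>_analytic)
  have 2: "vanishes (R*P_y - f_y*P_yy)"
    by (rule vanishes_from_V[rotated], use agreeD[OF S_zero] in simp) (intro analytic2_intros \<Omega>_analytic)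
  have 3: "vanishes (f_y*(Q*P_y - 4*P*f_y^2 - 2*f*P_y*f_y + 2*P_y^2)*R_y - R*(2*R*P_y^2 - 5*P*R*f_y^2 - 3*R*f*P_y*f_y - 6*P_y*f_y^3 + Q_y*P_y*f_y))"
  proof (rule vanishes_from_V)
    fix x assume x [simp]: "x \<in> V"
    obtain p t where j: "P_y x = p * f_y x" "T x = t * f_y x" "P_yy x = R x * p"
      "T_y x = P x * f_y x + f x * (p * f_y x) + R x * t"
      "P_zy x = 3 * P x * f_y x + 3 * f x * (p * f_y x) + R x * t"
      by (rule solved[OF x])
    have D0: "4 * P x * (f_y x)\<^sup>2 + 2 * f x * P_y x * f_y x - Q x * P_y x + R x * T x - 2 * (P_y x)\<^sup>2 = 0"
      using agreeD[OF D' x] D_eq[OF x] by simp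
    have Dy: "4 * P_y x * (f_y x)^2 + 8 * P x * f_y x * R x + 2 * f_y x * P_y x * f_y x + 2 * f x * P_yy x * f_y x
      + 2 * f x * P_y x * R x - Q_y x * P_y x - Q x * P_yy x + R_y x * T x + R x * T_y x - 4 * P_y x * P_yy x = 0"
      using agree_y[OF D' x] by (simp add: D_def fyy power2_eq_square algebra_simps)
    show "(f_y*(Q*P_y - 4*P*f_y^2 - 2*f*P_y*f_y + 2*P_y^2)*R_y - R*(2*R*P_y^2 - 5*P*R*f_y^2 - 3*R*f*P_y*f_y - 6*P_y*f_y^3 + Q_y*P_y*f_y)) x = 0"
      unfolding fun_apply using D0 Dy unfolding j by algebra
  qed (intro analytic2_intros \<Omega>_analytic)
  have 4: "vanishes (g*f_y*R^2*P_y + 2*R*f_y^3*f*P + (5*P*Q + 2*P*P_y + 2*g_y*P_y)*R*f_y^2 - 8*f_y^4*f*P_y + P_y*(2*Q*f - 2*f*P_y - Q_z)*R*f_y - P_y^2*(Q + 2*P_y)*R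
      - 16*f_y^5*P + (4*Q*P_y - 4*P*Q_y + 8*P_y^2)*f_y^3 - 2*Q_y*f_y^2*f*P_y + Q_y*P_y*(Q + 2*P_y)*f_y)"
  proof (rule vanishes_from_V)
    fix x assume x [simp]: "x \<in> V"
    obtain p t where j: "P_y x = p * f_y x" "T x = t * f_y x"
      "P_zy x = 3 * P x * f_y x + 3 * f x * (p * f_y x) + R x * t"
      "R_z x = R x * p + Q_y x"
      "P_z x = t * f_y x + 2 * f x * P x" "f_yz x = p * f_y x + Q x"
      by (rule solved_jets[OF x])
    have D0: "4 * P x * (f_y x)\<^sup>2 + 2 * f x * P_y x * f_y x - Q x * P_y x + R x * T x - 2 * (P_y x)\<^sup>2 = 0"
      using agreeD[OF D' x] D_eq[OF x] by simp
    have Dz: "4 * P_z x * (f_y x)^2 + 8 * P x * f_y x * f_yz x + 2 * f_z x * P_y x * f_y x + 2 * f x * P_zy x * f_y x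
    + 2 * f x * P_y x * f_yz x - Q_z x * P_y x - Q x * P_zy x + R_z x * T x + R x * T_z x - 4 * P_y x * P_zy x = 0"
      using agree_z[OF D' x] by (simp add: D_def Pyz power2_eq_square algebra_simps)
    have N0: "f_y x * (T_z x - g x * P_y x) - (2 * P_y x + Q x + f x * f_y x) * T x = 0"
      using agreeD[OF DA x] agreeD[OF D' x] by (simp add: N_def)
    show "(g*f_y*R^2*P_y + 2*R*f_y^3*f*P + (5*P*Q + 2*P*P_y + 2*g_y*P_y)*R*f_y^2 - 8*f_y^4*f*P_y + P_y*(2*Q*f - 2*f*P_y - Q_z)*R*f_y - P_y^2*(Q + 2*P_y)*R
      - 16*f_y^5*P + (4*Q*P_y - 4*P*Q_y + 8*P_y^2)*f_y^3 - 2*Q_y*f_y^2*f*P_y + Q_y*P_y*(Q + 2*P_y)*f_y) x = 0"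
      unfolding fun_apply using D0 Dz N0 unfolding j fz[OF x] by algebra
  qed (intro analytic2_intros \<Omega>_analytic)
  show ?thesis
    unfolding condition_5_def using assms 1 2 3 4 by blast
qed

end

text \<open>If \<open>P_y = 0\<close>, the solved form of \<open>P_zy = 0\<close> and the constraint
  combine to \<open>R * w = 3 * P * f_y\<close>. Its \<open>y\<close>-derivative gives the relation
  for \<open>R_y\<close>, its \<open>z\<close>-derivative an explicit formula for
  \<open>R^2 * A\<close>; differentiating that formula and using \<open>A_z = g - w\<close> and
  \<open>A_y = f\<close> gives the two equations that contain \<open>Q_zy\<close> and
  \<open>Q_yy\<close>.\<close>

lemma (in degenerate_solution) condition_6_of_solution:
  assumes "nonzero T" "nonzero R" and Py: "vanishes P_y" and P: "\<And>x. x \<in> V \<Longrightarrow> P x \<noteq> 0"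
  shows condition_6
proof -
  have Py': "P_y \<doteq> 0" using Py V_sub by (auto simp: agree_def)
  have P0 [simp]: "P_y x = 0" "P_yy x = 0" "P_zy x = 0" if "x \<in> V" for x
    using agreeD[OF Py' that] agree_y[OF Py' that] agree_z[OF Py' that] Pyz[OF that] that by auto
  have T: "f_y x * w x + T x = 0" if "x \<in> V" for x
    using agreeD[OF constraint that, symmetric] that by simp
  have Rw: "R * w \<doteq> 3 * P * f_y"
  proof (rule agreeI)
    fix x assume x [simp]: "x \<in> V"
    obtain p t where "P_y x = p * f_y x"
      "P_zy x = 3 * P x * f_y x + 3 * f x * (p * f_y x) + R x * t" "w x = p * A x - t"
      by (rule solved[OF x])
    then have "w x + t = 0" "3 * P x * f_y x + R x * t = 0"
      using f_y_nonzero[OF x] by auto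
    then show "(R * w) x = (3 * P * f_y) x"
      unfolding fun_apply by algebra
  qed
  have Ry: "4 * (R x)^2 - 3 * f_y x * R_y x = 0" if x [simp]: "x \<in> V" for x
  proof -
    have "R_y x * w x - R x * P x - 3 * P x * R x = 0"
      using agree_y[OF Rw x] by (simp add: Aw fyy)
    then have "P x * (4 * (R x)^2 - 3 * f_y x * R_y x) = 0"
      using agreeD[OF Rw x, unfolded fun_apply, THEN eq_diff0] by algebra
    then show ?thesis using P[OF x] by simp
  qed
  have RRA: "R^2 * A \<doteq> 3*f_y*Q_y + 9*f_y^3 - 3*f*f_y*R - 3*Q*R"
  proof (rule agreeI)
    fix x assume x [simp]: "x \<in> V"
    have "Q_y x * w x + R x * (f x * w x - A x * P x) - 3 * (T x + 2 * f x * P x) * f_y x - 3 * P x * Q x = 0"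
      using agree_z[OF Rw x] by (simp add: Aw fyz Pz Rz)
    then have "P x * ((R x)^2 * A x - (3*f_y x*Q_y x + 9*(f_y x)^3 - 3*f x*f_y x*R x - 3*Q x*R x)) = 0"
      using agreeD[OF Rw x, unfolded fun_apply, THEN eq_diff0] T[OF x] by algebra
    then show "(R^2 * A) x = (3*f_y*Q_y + 9*f_y^3 - 3*f*f_y*R - 3*Q*R) x"
      using P[OF x] by simp
  qed
  have 1: "vanishes (f_yz - g_yy)"
    by (rule vanishes_from_V[rotated], use fyz gyy in simp) (intro analytic2_intros \<Omega>_analytic)
  have 2: "vanishes ((2*f*g_y - 2*f*f_z + f_zz - g_zy)*R + 3*(f_z - g_y)*f_y^2)"
  proof (rule vanishes_from_V)
    fix x assume x [simp]: "x \<in> V"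
    have T': "2*f x*g_y x - 2*f x*f_z x + f_zz x - g_zy x = T x"
      by (simp add: T_def commute_V)
    show "((2*f*g_y - 2*f*f_z + f_zz - g_zy)*R + 3*(f_z - g_y)*f_y^2) x = 0"
      unfolding fun_apply T' unfolding fz[OF x] using T[OF x] agreeD[OF Rw x, unfolded fun_apply, THEN eq_diff0]
      by algebra
  qed (intro analytic2_intros \<Omega>_analytic)
  have 3: "vanishes (g*R^3 + (3*f_y*g_y + 3*f*Q + 3*Q_z)*R^2 - (27*Q*f_y^2 + 3*f*f_y*Q_y + 3*f_y*Q_zy + 6*Q*Q_y)*R + 6*f_y*Q_y*(3*f_y^2 + Q_y))"
  proof (rule vanishes_from_V)
    fix x assume x [simp]: "x \<in> V"
    have "2 * R x * Q_y x * A x + (R x)^2 * (g x - w x) - (3 * Q x * Q_y x + 3 * f_y x * Q_zy x + 27 * (f_y x)^2 * Q x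
       - 3 * (P x + g_y x) * f_y x * R x - 3 * f x * Q x * R x - 3 * f x * f_y x * Q_y x - 3 * Q_z x * R x - 3 * Q x * Q_y x) = 0"
      using agree_z[OF RRA x]
      by (simp add: Aw fyz fz Rz Qyz power2_eq_square power3_eq_cube algebra_simps)
    then show "(g*R^3 + (3*f_y*g_y + 3*f*Q + 3*Q_z)*R^2 - (27*Q*f_y^2 + 3*f*f_y*Q_y + 3*f_y*Q_zy + 6*Q*Q_y)*R + 6*f_y*Q_y*(3*f_y^2 + Q_y)) x = 0"
      unfolding fun_apply
      using agreeD[OF Rw x, unfolded fun_apply, THEN eq_diff0] agreeD[OF RRA x, unfolded fun_apply, THEN eq_diff0]
      by algebra
  qed (intro analytic2_intros \<Omega>_analytic)
  have 4: "vanishes (4*R^2 - 3*f_y*R_y)"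
    by (rule vanishes_from_V[rotated], use Ry in simp) (intro analytic2_intros \<Omega>_analytic)
  have 5: "vanishes (3*f_y^2*Q_yy + 4*Q*R^2 - 8*R*f_y*Q_y)"
  proof (rule vanishes_from_V)
    fix x assume x [simp]: "x \<in> V"
    have "2 * R x * R_y x * A x + (R x)^2 * f x - (3 * R x * Q_y x + 3 * f_y x * Q_yy x + 27 * (f_y x)^2 * R x
       - 3 * f_y x * f_y x * R x - 3 * f x * R x * R x - 3 * f x * f_y x * R_y x - 3 * Q_y x * R x - 3 * Q x * R_y x) = 0"
      using agree_y[OF RRA x]
      by (simp add: Aw fyy power2_eq_square power3_eq_cube algebra_simps)
    then show "(3*f_y^2*Q_yy + 4*Q*R^2 - 8*R*f_y*Q_y) x = 0"
      unfolding fun_apply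
      using Ry[OF x] agreeD[OF RRA x, unfolded fun_apply, THEN eq_diff0]
      by algebra
  qed (intro analytic2_intros \<Omega>_analytic)
  \<comment> \<open>Here \<open>R * T = - 3 * P * f_y^2\<close>, so \<open>D\<close> collapses to
    \<open>P * f_y^2\<close>.\<close>
  have "nonzero D"
  proof -
    obtain x where x [simp]: "x \<in> V" using V_nonempty by auto
    have "D x - (4 * P x * (f_y x)^2 + R x * T x) = 0"
      using D_eq[OF x] by simp
    then have "D x = P x * (f_y x)^2"
      using T[OF x] agreeD[OF Rw x, unfolded fun_apply, THEN eq_diff0] by algebra
    then have "D x \<noteq> 0" using P[OF x] f_y_nonzero[OF x] by simp
    then show ?thesis using V_sub x by blast
  qed
  then show ?thesis
    unfolding condition_6_def using assms(1,2) 1 2 3 4 5 by blast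
qed

text \<open>\<open>f_y = 0\<close> leads to condition 2, \<open>P = 0\<close> to 4, and otherwise
  \<open>S\<close> nonzero to 1. If \<open>S = 0\<close>, the region is shrunk until
  \<open>f_y\<close> and \<open>P\<close> have no zeros; then \<open>D = 0\<close> leads to 5,
  \<open>P_y = 0\<close> to 6, and the rest to 3. The requirements that \<open>T\<close> and
  \<open>R\<close> be nonzero come from \<open>P_nonzero_imp\<close>.\<close>

theorem (in solution) conditions_of_solution: coefficient_conditions
proof -
  consider "vanishes f_y" | "vanishes P" | "nonzero f_y" "nonzero S"
    | "nonzero f_y" "nonzero P" "vanishes S" by blast
  then show ?thesis
  proof cases
    case 1
    then show ?thesis using condition_2_of_solution by (simp add: coefficient_conditions_def)
  next
    case 2
    then have condition_4 by (simp add: condition_4_def P_def)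
    then show ?thesis by (simp add: coefficient_conditions_def)
  next
    case 3
    then show ?thesis using condition_1_of_solution by (simp add: coefficient_conditions_def)
  next
    case 4
    obtain V1 where V1: "solution \<Omega> f g V1 A w" "\<And>x. x \<in> V1 \<Longrightarrow> f_y x \<noteq> 0"
      by (rule shrink_solution_to_nonzero[OF _ 4(1)]) (intro analytic2_intros \<Omega>_analytic, blast)
    interpret V1: solution \<Omega> f g V1 A w by fact
    obtain V2 where V2: "solution \<Omega> f g V2 A w" "V2 \<subseteq> V1" "\<And>x. x \<in> V2 \<Longrightarrow> P x \<noteq> 0"
      using V1.shrink_to_nonzero[OF \<Omega>_analytic(3) 4(2)] V1.restrict_solution by metis
    interpret V2: solution \<Omega> f g V2 A w by fact
    interpret V2: degenerate \<Omega> f g V2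
      by (rule V2.degenerate_of_solution) (use V2(2) V1(2) V2.V_sub 4(3) in auto)
    interpret V2: degenerate_solution \<Omega> f g V2 A w ..
    note TR = V2.P_nonzero_imp[OF 4(2)]
    consider "vanishes D" | "nonzero D" "nonzero P_y" | "vanishes P_y" by blast
    then show ?thesis
    proof cases
      case 1
      then have condition_5 by (rule V2.condition_5_of_solution[OF 4(1) TR])
      then show ?thesis by (simp add: coefficient_conditions_def)
    next
      case 2
      then have condition_3 by (intro V2.condition_3_of_solution 4 TR)
      then show ?thesis by (simp add: coefficient_conditions_def)
    next
      case 3
      then have condition_6 by (rule V2.condition_6_of_solution[OF TR _ V2(3)])
      then show ?thesis by (simp add: coefficient_conditions_def)
    qed
  qed
qed

section \<open>From the coefficient conditions to a first integral\<close>

lemma analytic2_divide [simp]: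
  fixes h k :: "'a \<times> 'a \<Rightarrow> 'a::{real_normed_field,banach}"
  assumes "h analytic2_on V" "k analytic2_on V" "\<And>x. x \<in> V \<Longrightarrow> k x \<noteq> 0"
  shows "(\<lambda>x. h x / k x) analytic2_on V"
  using analytic2_mult[OF assms(1) analytic2_inverse[OF assms(2,3)]] by (simp add: divide_inverse)

context region
begin

text \<open>The solution may live on another region \<open>W\<close>, since potentials exist only
  after shrinking \<open>V\<close>.\<close>

definition solvable :: bool where
  "solvable \<longleftrightarrow> (\<exists>W A w. solution \<Omega> f g W A w)"

text \<open>The remaining equation \<open>w_y = - P\<close> is the equality of the mixed derivatives
  of \<open>A\<close>.\<close>

lemma solvableI:
  assumes [simp]: "A analytic2_on V" "w analytic2_on V" and Ay: "\<partial>y A \<doteq> f" and Az: "\<partial>z A \<doteq> g - w"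
    and wz: "\<partial>z w \<doteq> f * w - A * P"
  shows solvable
proof -
  have "\<partial>y w \<doteq> - P"
  proof (rule agreeI)
    fix x assume x [simp]: "x \<in> V"
    have "\<partial>z (\<partial>y A) x = \<partial>y (\<partial>z A) x" by (rule commute_V) simp_all
    then have "\<partial>y w x + P x = 0"
      using agree_z[OF Ay x] agree_y[OF Az x] by (simp add: fz algebra_simps)
    then show "\<partial>y w x = (- P) x" by (simp add: eq_neg_iff_add_eq_0)
  qed
  then have "solution \<Omega> f g V A w"
    using assms by unfold_locales
  then show ?thesis unfolding solvable_def by blast
qed

text \<open>\<open>A\<close> is forced to be \<open>- T / Q\<close> by the constraint. The first
  equation of the condition then amounts to \<open>A_y = f\<close> and the second, divided by
  \<open>Q^5\<close>, to the equation for \<open>w_z\<close>.\<close>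

lemma solvable_of_condition_2:
  assumes c: condition_2 and Q: "\<And>x. x \<in> V \<Longrightarrow> Q x \<noteq> 0"
  shows solvable
proof (rule solvableI)
  define A where "A = (\<lambda>x. - T x / Q x)"
  define w where "w = g - \<partial>z A"
  show A [simp]: "A analytic2_on V"
    using Q analytic2_divide[of "- T" V Q] by (simp add: A_def)
  show w [simp]: "w analytic2_on V" by (simp add: w_def)
  note c = c[unfolded condition_2_def]
  have T: "T \<doteq> - (Q * A)" by (rule agreeI) (use Q in \<open>simp add: A_def\<close>)
  have fy0: "f_y \<doteq> 0" using c V_sub by (auto simp: agree_def)
  have fy0' [simp]: "f_y x = 0" "f_yz x = 0" "f_yy x = 0" if "x \<in> V" for x
    using agreeD[OF fy0 that] agree_z[OF fy0 that] agree_y[OF fy0 that] by simp_all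
  have Py: "P_y \<doteq> - Q"
  proof (rule agreeI)
    fix x assume "x \<in> V"
    then show "P_y x = (- Q) x" using fyz[of x] by (simp add: eq_neg_iff_add_eq_0)
  qed
  have Qz: "Q_z \<doteq> 3 * f * Q + Q_y * A"
  proof (rule agreeI)
    fix x assume x [simp]: "x \<in> V"
    have "(2*Q*Q_z + 2*T*Q_y - 6*Q^2*f) x = 0" using c V_sub x by blast
    then have "2 * Q x * (Q_z x - (3 * f x * Q x + Q_y x * A x)) = 0"
      unfolding fun_apply using agreeD[OF T x, unfolded fun_apply, THEN eq_diff0] by algebra
    then show "Q_z x = (3 * f * Q + Q_y * A) x" using Q[OF x] by simp
  qed
  show Ay: "\<partial>y A \<doteq> f"
  proof (rule agreeI)
    fix x assume x [simp]: "x \<in> V"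
    have "T_y x + Q_y x * A x + Q x * \<partial>y A x = 0" using agree_y[OF T x] by simp
    moreover have "P_zy x = - Q_z x" using Pyz[OF x] agree_z[OF Py x] by simp
    then have "T_y x - (2 * f x * Q x - Q_z x) = 0"
      using Pzy[OF x] agreeD[OF Py x] by (simp add: algebra_simps)
    moreover have "Q_z x - (3 * f x * Q x + Q_y x * A x) = 0" using agreeD[OF Qz x] by simp
    ultimately have "Q x * (\<partial>y A x - f x) = 0" by algebra
    then show "\<partial>y A x = f x" using Q[OF x] by simp
  qed
  show Az: "\<partial>z A \<doteq> g - w" by (simp add: w_def agree_def)
  show "\<partial>z w \<doteq> f * w - A * P"
  proof (rule agreeI)
    fix x assume x [simp]: "x \<in> V"
    note Ayx = agreeD[OF Ay x] and Azx = agreeD[OF Az x, unfolded fun_apply]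
    have T': "T x = - Q x * A x" using agreeD[OF T x] by simp
    have Qz': "Q_z x = 3 * f x * Q x + Q_y x * A x" using agreeD[OF Qz x] by simp
    have Qzy: "Q_zy x = 4 * f x * Q_y x + Q_yy x * A x"
      using agree_y[OF Qz x] by (simp add: Ayx)
    have Qzz: "\<partial>z Q_z x = 3 * (P x + g_y x) * Q x + 3 * f x * Q_z x + Q_zy x * A x + Q_y x * (g x - w x)"
      using agree_z[OF Qz x] by (simp add: Azx fz Qyz algebra_simps)
    have Tz: "T_z \<doteq> - (Q_z * A) - Q * (g - w)"
      by (rule agreeI) (simp add: agree_z[OF T] agreeD[OF Az])
    then have Tz': "T_z x = - (Q_z x * A x) - Q x * (g x - w x)"
      by (auto dest: agreeD[OF _ x])
    have Tzz: "T_zz x = - (\<partial>z Q_z x * A x) - 2 * Q_z x * (g x - w x) - Q x * (g_z x - \<partial>z w x)"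
      using agree_z[OF Tz x] by (simp add: Azx algebra_simps)
    have "((f*g - g_z)*Q^5 + 3*Q_y*T*(3*T*f - T_z)*Q^2 + (4*T*f_z - 12*T*f^2 - T*g_y + 7*f*T_z - T_zz)*Q^4 + Q_yy*T^3*Q - 3*Q_y^2*T^3) x = 0" using c V_sub x by blast
    then have "(Q x)^5 * (\<partial>z w x - (f x * w x - A x * P x)) = 0"
      unfolding fun_apply Tzz Tz' T' Qzz Qzy Qz' fz[OF x] by algebra
    then show "\<partial>z w x = (f * w - A * P) x" using Q[OF x] by simp
  qed
qed

text \<open>With \<open>P = 0\<close> the choice \<open>w = 0\<close> solves the equations for
  \<open>w\<close>, and \<open>f_z = g_y\<close> is exactly the closedness needed for a potential
  \<open>A\<close>.\<close>

lemma solvable_of_condition_4: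
  assumes condition_4
  shows solvable
proof -
  have P: "P x = 0" if "x \<in> V" for x
    using assms V_sub that by (auto simp: condition_4_def P_def)
  obtain x where x: "x \<in> V" using V_nonempty by auto
  obtain W A where W: "open W" "x \<in> W" "W \<subseteq> V" "A analytic2_on W"
    "\<And>y. y \<in> W \<Longrightarrow> \<partial>y A y = f y" "\<And>y. y \<in> W \<Longrightarrow> \<partial>z A y = g y"
    by (rule analytic2_potential[OF open_V x, of f g]) (use P fz in auto)
  interpret W: region \<Omega> f g W
    by unfold_locales (use W V_sub in auto)
  have W.solvable
    by (rule W.solvableI[of A 0]) (use W P in \<open>auto simp: W.agree_def\<close>)
  then show ?thesis by (simp add: W.solvable_def solvable_def)
qed

text \<open>\<open>A\<close> and \<open>w\<close> are defined by the two linear relations with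
  determinant \<open>- S\<close>. The second equation of the condition gives \<open>A_y = f\<close>,
  and the \<open>y\<close>-derivative of the constraint gives \<open>w_y\<close>. The two
  \<open>z\<close>-equations are not visible directly; their defects are shown to satisfy a
  homogeneous linear system.\<close>

lemma solvable_of_condition_1:
  assumes c: condition_1 and fy: "\<And>x. x \<in> V \<Longrightarrow> f_y x \<noteq> 0" and S: "\<And>x. x \<in> V \<Longrightarrow> S x \<noteq> 0"
  shows solvable
proof -
  define A where "A = (\<lambda>x. (R * T - f_y * (T_y - f * P_y - P * f_y)) x / S x)"
  have A [simp]: "A analytic2_on V"
    unfolding A_def by (rule analytic2_divide; (intro analytic2_intros coefficients_analytic)?) (rule S)
  define w where "w = (\<lambda>x. (P_y * A - T) x / f_y x)"
  have w [simp]: "w analytic2_on V"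
    unfolding w_def by (rule analytic2_divide; (intro analytic2_intros coefficients_analytic A)?) (rule fy)
  note c = c[unfolded condition_1_def]
  have SA: "S * A \<doteq> R * T - f_y * (T_y - f * P_y - P * f_y)"
    by (rule agreeI) (use S in \<open>simp add: A_def\<close>)
  have constraint: "P_y * A - f_y * w \<doteq> T"
    by (rule agreeI) (use fy in \<open>simp add: w_def\<close>)
  have constraint_y: "P_yy x * A x - R x * w x = T_y x - f x * P_y x - P x * f_y x" if x: "x \<in> V" for x
  proof -
    have "f_y x * (P_yy x * A x - R x * w x - (T_y x - f x * P_y x - P x * f_y x)) = 0"
      using agreeD[OF SA x, unfolded fun_apply, THEN eq_diff0]
        agreeD[OF constraint x, unfolded fun_apply, THEN eq_diff0] unfolding S_eq[OF x] by algebra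
    then show ?thesis using fy[OF x] by simp
  qed
  have Ay: "\<partial>y A \<doteq> f"
  proof (rule agreeI)
    fix x assume x [simp]: "x \<in> V"
    have SA': "S x * A x = R x * T x - f_y x * (T_y x - f x * P_y x - P x * f_y x)"
      using agreeD[OF SA x] by simp
    have SAy: "S_y x * A x + S x * \<partial>y A x = R_y x * T x + R x * T_y x - R x * (T_y x - f x * P_y x - P x * f_y x)
       - f_y x * (\<partial>y T_y x - f_y x * P_y x - f x * P_yy x - P_y x * f_y x - P x * R x)"
      using agree_y[OF SA x] by (simp add: fyy algebra_simps)
    have "(S^2*P_y + (4*f*f_y + Q)*S^2 - S*S_z*f_y + f_y*(2*P*f - P_z)*R_y*S - R*P_y^2*S + (f_y*R_z - 4*R*f*f_y - 6*f_y^3 - Q*R)*P_y*S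
      - f_y*R*(4*P*f_y - P_zy)*S + 3*S_y*f_y^2*f*P_y - S_y*f_y*(2*P*R*f - 3*P*f_y^2 - R*P_z + P_zy*f_y)) x = 0"
      using c V_sub x by blast
    then have "f_y x * (S x)^2 * (\<partial>y A x - f x) = 0"
      unfolding fun_apply
      using SA'[THEN eq_diff0] SAy[THEN eq_diff0] Sz[OF x, THEN eq_diff0] S_eq[OF x, THEN eq_diff0]
      unfolding Pzyy[OF x] Pz[OF x] Pzy[OF x] by algebra
    then show "\<partial>y A x = f x" using fy[OF x] S[OF x] by simp
  qed
  have wy: "\<partial>y w \<doteq> - P"
  proof (rule agreeI)
    fix x assume x [simp]: "x \<in> V"
    have "P_yy x * A x + P_y x * f x - R x * w x - f_y x * \<partial>y w x - T_y x = 0"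
      using agree_y[OF constraint x] by (simp add: fyy agreeD[OF Ay] diff_diff_add)
    then have "f_y x * (\<partial>y w x + P x) = 0" using constraint_y[OF x, THEN eq_diff0] by algebra
    then show "\<partial>y w x = (- P) x" using fy[OF x] by (simp add: eq_neg_iff_add_eq_0)
  qed
  \<comment> \<open>The defects of the two \<open>z\<close>-equations. Both have vanishing
    \<open>y\<close>-derivative, the second one by the constraint.\<close>
  define c' where "c' = \<partial>z A - g + w"
  define d' where "d' = \<partial>z w - f * w + A * P"
  have cd_an [simp]: "c' analytic2_on V" "d' analytic2_on V" by (simp_all add: c'_def d'_def)
  have cdy: "\<partial>y c' x = 0" "\<partial>y d' x = 0" if x [simp]: "x \<in> V" for x
  proof -
    have "\<partial>y (\<partial>z A) x = f_z x" "\<partial>y (\<partial>z w) x = - P_z x"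
      using commute_V[OF A x] commute_V[OF w x] agree_z[OF Ay x] agree_z[OF wy x] by simp_all
    then show "\<partial>y c' x = 0" "\<partial>y d' x = 0"
      using agreeD[OF Ay x] agreeD[OF wy x] agreeD[OF constraint x, symmetric]
      by (simp_all add: c'_def d'_def fz Pz algebra_simps)
  qed
  have cd: "P_y * c' - f_y * d' \<doteq> 0"
  proof (rule agreeI)
    fix x assume x [simp]: "x \<in> V"
    have Y: "S x * A x + (2*P x*R x*f x - 3*P x*(f_y x)^2 - 3*f x*P_y x*f_y x - R x*P_z x + f_y x*P_zy x) = 0"
      using agreeD[OF SA x] by (simp add: Pz Pzy power2_eq_square algebra_simps)
    define X where "X = f x*P_y x*f_y x - P x*(f_y x)^2 + Q x*P_y x + 2*(P_y x)^2 - f_y x*P_zy x"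
    define Z where "Z = 2*P x*(f x)^2*f_y x - 2*(P x)^2*f_y x + 2*P x*Q x*f x + 4*P x*f x*P_y x - 2*P x*f_y x*g_y x - 3*f x*P_z x*f_y x - g x*P_y x*f_y x - Q x*P_z x - 2*P_z x*P_y x + f_y x*P_zz x"
    have "((f*P_y*f_y - P*f_y^2 + Q*P_y + 2*P_y^2 - f_y*P_zy)*(2*P*R*f - 3*P*f_y^2 - 3*f*P_y*f_y - R*P_z + f_y*P_zy)
      - (2*P*f^2*f_y - 2*P^2*f_y + 2*P*Q*f + 4*P*f*P_y - 2*P*f_y*g_y - 3*f*P_z*f_y - g*P_y*f_y - Q*P_z - 2*P_z*P_y + f_y*P_zz)*S) x = 0"
      using c V_sub x by blast
    then have "X * (2*P x*R x*f x - 3*P x*(f_y x)^2 - 3*f x*P_y x*f_y x - R x*P_z x + f_y x*P_zy x) - Z * S x = 0"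
      by (simp add: X_def Z_def)
    then have "S x * (X * A x + Z) = 0" using Y by algebra
    then have XZ: "X * A x + Z = 0" using S[OF x] by simp
    have "P_zy x * A x + P_y x * \<partial>z A x - (P_y x + Q x) * w x - f_y x * \<partial>z w x - T_z x = 0"
      using agree_z[OF constraint x] by (simp add: Pyz fyz diff_diff_add)
    then have "f_y x * (P_y x * c' x - f_y x * d' x) = 0"
      using XZ agreeD[OF constraint x, unfolded fun_apply, THEN eq_diff0]
      unfolding X_def Z_def Pzz[OF x] Pz[OF x] c'_def d'_def fun_apply by algebra
    then show "(P_y * c' - f_y * d') x = 0 x" using fy[OF x] by simp
  qed
  \<comment> \<open>Differentiating \<open>P_y * c' - f_y * d' = 0\<close> in \<open>y\<close>
    leaves \<open>c'\<close> and \<open>d'\<close> untouched and differentiates only the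
    coefficients; the determinant of the two equations is \<open>S\<close> up to sign.\<close>
  have c0: "c' x = 0" and d0: "d' x = 0" if x [simp]: "x \<in> V" for x
  proof -
    have "P_yy x * c' x - R x * d' x = 0" "P_y x * c' x - f_y x * d' x = 0"
      using agree_y[OF cd x] agreeD[OF cd x] by (simp_all add: cdy fyy)
    then have "S x * c' x = 0" unfolding S_eq[OF x] by algebra
    then show "c' x = 0" using S[OF x] by simp
    with agreeD[OF cd x] show "d' x = 0" using fy[OF x] by simp
  qed
  show ?thesis
  proof (rule solvableI[OF A w Ay])
    show "\<partial>z A \<doteq> g - w"
      by (rule agreeI) (use c0 in \<open>simp add: c'_def algebra_simps\<close>)
    show "\<partial>z w \<doteq> f * w - A * P"
      by (rule agreeI) (use d0 in \<open>simp add: d'_def algebra_simps\<close>)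
  qed
qed

end

section \<open>Converse direction in the degenerate case\<close>

context degenerate
begin

lemma Tyz:
  assumes x [simp]: "x \<in> V"
  shows "f_y x * \<partial>y T_z x = P_z x * (f_y x)^2 + 2 * P x * f_y x * f_yz x + f_z x * P_y x * f_y x
    + f x * P_zy x * f_y x + f x * P_y x * f_yz x + R_z x * T x + R x * T_z x - f_yz x * T_y x"
  using agree_z[OF constraint_y_compatible x] by (simp add: Pyz Tyz power2_eq_square algebra_simps)

text \<open>Given the constraint, \<open>D * A = N\<close> expresses its \<open>z\<close>-derivative along the system.\<close>

lemma constraint_z_of_DA:
  assumes x [simp]: "x \<in> V" and constraint: "P_y x * A x - f_y x * w x = T x" and DA: "D x * A x = N x"
  shows "(P_zy x + P x * f_y x) * A x - (2 * P_y x + Q x + f x * f_y x) * w x = T_z x - g x * P_y x"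
proof -
  obtain p t where j: "P_y x = p * f_y x" "T x = t * f_y x"
    "P_zy x = 3 * P x * f_y x + 3 * f x * (p * f_y x) + R x * t"
    by (rule solved_jets[OF x])
  have "f_y x * (w x - (p * A x - t)) = 0" using constraint unfolding j by (simp add: algebra_simps)
  then have w: "w x = p * A x - t" using f_y_nonzero[OF x] by simp
  have N: "N x = f_y x * (T_z x - g x * P_y x) - (2 * P_y x + Q x + f x * f_y x) * T x"
    by (simp add: N_def)
  have "f_y x * ((P_zy x + P x * f_y x) * A x - (2 * P_y x + Q x + f x * f_y x) * w x - (T_z x - g x * P_y x)) = 0"
    using DA[THEN eq_diff0] unfolding w N D_eq[OF x] j by algebra
  then show ?thesis using f_y_nonzero[OF x] by simp
qed

text \<open>The \<open>z\<close>-derivative of the constraint contains \<open>w_z\<close> with the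
  coefficient \<open>- f_y\<close>, and \<open>D * A = N\<close> says what that derivative has to
  be. No division by \<open>D\<close> takes place, so the lemma also serves the case
  \<open>D = 0\<close>.\<close>

lemma solvable_of_linear_system:
  assumes A [simp]: "A analytic2_on V" and w [simp]: "w analytic2_on V"
    and Ay: "\<partial>y A \<doteq> f" and Az: "\<partial>z A \<doteq> g - w"
    and constraint: "P_y * A - f_y * w \<doteq> T" and DA: "D * A \<doteq> N"
  shows solvable
proof (rule solvableI[OF A w Ay Az], rule agreeI)
  fix x assume x [simp]: "x \<in> V"
  have constraint_z: "(P_zy x + P x * f_y x) * A x - (2 * P_y x + Q x + f x * f_y x) * w x = T_z x - g x * P_y x"
    by (rule constraint_z_of_DA[OF x]) (use agreeD[OF constraint x] agreeD[OF DA x] in simp_all)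
  have "P_zy x * A x + P_y x * (g x - w x) - (P_y x + Q x) * w x - f_y x * \<partial>z w x - T_z x = 0"
    using agree_z[OF constraint x] by (simp add: Pyz fyz agreeD[OF Az] diff_diff_add)
  then have "f_y x * (\<partial>z w x - (f x * w x - A x * P x)) = 0"
    using constraint_z[THEN eq_diff0] by algebra
  then show "\<partial>z w x = (f * w - A * P) x" using f_y_nonzero[OF x] by simp
qed

text \<open>\<open>A_y = f\<close> is a consequence of the linear relations: the
  \<open>y\<close>-derivative of the constraint gives \<open>w_y\<close> in terms of
  \<open>A_y\<close>, and the \<open>y\<close>-derivative of the relation equivalent to
  \<open>D * A = N\<close> then reduces, by the third equation of condition 3, to
  \<open>f_y * D * (A_y - f) = 0\<close>.\<close>

lemma solvable_nondegenerate:
  assumes A [simp]: "A analytic2_on V" and w [simp]: "w analytic2_on V"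
    and constraint: "P_y * A - f_y * w \<doteq> T" and DA: "D * A \<doteq> N"
    and D: "\<And>x. x \<in> V \<Longrightarrow> D x \<noteq> 0" and Az: "\<partial>z A \<doteq> g - w"
  shows solvable
proof (rule solvable_of_linear_system[OF A w _ Az constraint DA], rule agreeI)
  fix x assume x [simp]: "x \<in> V"
  obtain p t where j: "P_y x = p * f_y x" "T x = t * f_y x" "P_yy x = R x * p"
    "T_y x = P x * f_y x + f x * (p * f_y x) + R x * t"
    "P_zy x = 3 * P x * f_y x + 3 * f x * (p * f_y x) + R x * t"
    "\<partial>y P_zy x = 4 * P x * R x + 6 * p * (f_y x)^2 + 4 * f x * R x * p + R_y x * t"
    "R_z x = R x * p + Q_y x" "P_z x = t * f_y x + 2 * f x * P x" "f_yz x = p * f_y x + Q x"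
    by (rule solved_jets[OF x])
  have "f_y x * (w x - (p * A x - t)) = 0"
    using agreeD[OF constraint x] unfolding fun_apply j by (simp add: algebra_simps)
  then have wx: "w x = p * A x - t" using f_y_nonzero[OF x] by simp
  have "P_yy x * A x + P_y x * \<partial>y A x - R x * w x - f_y x * \<partial>y w x - T_y x = 0"
    using agree_y[OF constraint x] by (simp add: fyy diff_diff_add)
  then have "f_y x * (\<partial>y w x - (p * (\<partial>y A x - f x) - P x)) = 0"
    unfolding wx j by algebra
  then have wy: "\<partial>y w x = p * (\<partial>y A x - f x) - P x" using f_y_nonzero[OF x] by simp
  have "(P_zy + P * f_y) * A - (2 * P_y + Q + f * f_y) * w \<doteq> T_z - g * P_y"
    by (rule agreeI) (use constraint_z_of_DA agreeD[OF constraint] agreeD[OF DA] in simp)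
  note constraint_z = agreeD[OF this x, unfolded fun_apply] agree_y[OF this x]
  have Tz: "T_z x = g x * P_y x + ((P_zy x + P x * f_y x) * A x - (2 * P_y x + Q x + f x * f_y x) * w x)"
    using constraint_z(1) by simp
  have constraint_zy: "(\<partial>y P_zy x + P_y x * f_y x + P x * R x) * A x + (P_zy x + P x * f_y x) * \<partial>y A x
      - (2 * P_yy x + Q_y x + f_y x * f_y x + f x * R x) * w x - (2 * P_y x + Q x + f x * f_y x) * \<partial>y w x
      - \<partial>y T_z x + g_y x * P_y x + g x * P_yy x = 0"
    using constraint_z(2) by (simp add: fyy algebra_simps)
  have e3: "(Q_y x * P_y x - R x * f x * P_y x - T x * R_y x) * f_y x - 6 * (f_y x)^3 * P_y x
    - R x * (f_y x)^2 * P x - R x * (Q x * P_y x - R x * T x) = 0"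
    using agreeD[OF condition_3_third x] by simp
  have "f_y x * (D x * (\<partial>y A x - f x)) = 0"
    using constraint_zy e3 Tyz[OF x, THEN eq_diff0] unfolding D_eq[OF x] Tz wy wx fz[OF x] j by algebra
  then show "\<partial>y A x = f x" using f_y_nonzero[OF x] D[OF x] by simp
qed

end

lemma (in region) degenerate_of_conditions:
  assumes "\<And>x. x \<in> V \<Longrightarrow> f_y x \<noteq> 0" "vanishes (R*P_y - f_y*P_yy)"
    "vanishes (P*f_y^2 + f*P_y*f_y + R*T - f_y*T_y)"
  shows "degenerate \<Omega> f g V"
  by unfold_locales (use assms V_sub in \<open>auto simp: agree_def\<close>)

text \<open>The fifth equation, divided by \<open>D^2 * f_y\<close>, is \<open>A_z = g - w\<close>
  for the quotient \<open>A = N / D\<close>.\<close>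

lemma (in region) solvable_of_condition_3:
  assumes c: condition_3 and fy: "\<And>x. x \<in> V \<Longrightarrow> f_y x \<noteq> 0" and D: "\<And>x. x \<in> V \<Longrightarrow> D x \<noteq> 0"
  shows solvable
proof -
  note c = c[unfolded condition_3_def]
  interpret degenerate \<Omega> f g V
    by (rule degenerate_of_conditions) (use c fy in simp_all)
  define A where "A = (\<lambda>x. N x / D x)"
  have A [simp]: "A analytic2_on V"
    unfolding A_def by (rule analytic2_divide[OF N_analytic coefficients_analytic(8) D])
  define w where "w = (\<lambda>x. (P_y * A - T) x / f_y x)"
  have w [simp]: "w analytic2_on V"
    unfolding w_def by (rule analytic2_divide; (intro analytic2_intros coefficients_analytic A)?) (rule fy)
  have DA: "D * A \<doteq> N" by (rule agreeI) (use D in \<open>simp add: A_def\<close>)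
  have constraint: "P_y * A - f_y * w \<doteq> T" by (rule agreeI) (use fy in \<open>simp add: w_def\<close>)
  show ?thesis
  proof (rule solvable_nondegenerate[OF A w constraint DA D], assumption, rule agreeI)
    fix x assume x [simp]: "x \<in> V"
    have Nx: "N x = D x * A x" and Nz: "\<partial>z N x = \<partial>z D x * A x + D x * \<partial>z A x"
      using agreeD[OF DA x] agree_z[OF DA x] by simp_all
    have "(28*f_y^5*g*P^2 - 2*P_y^2*(9*P*T - 9*T*f^2 + 3*T*g_y + g_z*P_y)*f_y^2 - 4*T_zz*f_y^4*P
      + 2*P_y*(2*f^2*g*P_y + 18*P*T*f - 6*P*g*P_y + f*P_y*g_z - g*P_y*g_y - 4*T^2 - 3*T*f^3)*f_y^3 - (15*P*T*f + 12*P*g*P_y + 4*T^2)*f_y^3*Q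
      + R*f_y^2*T_z^2 + (18*P*f + 4*T)*f_y^4*T_z + R*Q^2*T^2 + 2*T_zz*f_y^2*P_y^2 - 5*R*f_y*T*P_y*T_z + 15*R*f_y^3*g*T*P - 2*f_y^2*Q*f*P_y*T_z
      - 2*R*f_y*Q*T*T_z - 2*T_zz*f_y^3*f*P_y + 2*R^2*f_y*g*T^2 + T*P_y*(15*T*f - g*P_y)*f_y*R - 12*f_y^2*f*P_y^2*T_z + 2*P_y*(4*f^2 - P + g_y)*f_y^3*T_z
      + 4*Q_z*f_y^3*T*P + 5*f_y^3*Q*P*T_z - 5*f_y^2*Q^2*T*P - 2*Q_y*f_y*T^2*P_y + 2*R*Q*T^2*P_y
      - P_y*(3*T*f^2 + 4*f*g*P_y + 19*P*T + 3*T*g_y + g_z*P_y)*f_y^2*Q - T*(T*f + g*P_y)*f_y^2*Q_y - T_zz*R*f_y^2*T + Q_y*f_y^2*T*T_z - Q_y*f_y*Q*T^2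
      + R*Q_z*f_y*T^2 + P_y*(3*T*f + g*P_y)*Q_z*f_y^2 - R*f_y*Q*g*T*P_y + T*(7*f*g*P_y - 2*T*f^2 + 23*P*T + T*g_y + g_z*P_y)*f_y^2*R
      + (2*T*f - g*P_y)*f_y^2*R*T_z + T_zz*f_y^2*Q*P_y - Q_z*f_y^2*P_y*T_z + 3*R^2*T^3
      + (20*P*f*g*P_y - 14*P*T*f^2 + 44*P^2*T + 4*P*T*g_y + 4*P*P_y*g_z - 4*T^2*f - 4*T*g*P_y)*f_y^4) x = 0"
      using c V_sub x by blast
    then have "(D x)^2 * f_y x * (\<partial>z A x - (g x - w x)) = 0"
      unfolding condition_3_fifth[OF x] Nx Nz
      using agreeD[OF constraint x, unfolded fun_apply, THEN eq_diff0] by algebra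
    then show "\<partial>z A x = (g - w) x" using D[OF x] fy[OF x] by simp
  qed
qed

text \<open>The first equation says \<open>P_y = 0\<close>, and the second says
  \<open>R * T = - 3 * P * f_y^2\<close>; together they imply the degenerate relations and
  \<open>D = P * f_y^2\<close>. The \<open>z\<close>-derivative of the second turns
  \<open>A = N / D\<close> into the formula for \<open>R^2 * A\<close>, whose
  \<open>z\<close>-derivative and the third equation give \<open>A_z = g - w\<close>.\<close>

lemma (in region) solvable_of_condition_6:
  assumes c: condition_6 and fy: "\<And>x. x \<in> V \<Longrightarrow> f_y x \<noteq> 0" and D: "\<And>x. x \<in> V \<Longrightarrow> D x \<noteq> 0"
    and Rnz: "\<And>x. x \<in> V \<Longrightarrow> R x \<noteq> 0"
  shows solvable
proof -
  note c = c[unfolded condition_6_def]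
  have Py: "P_y \<doteq> 0"
  proof (rule agreeI)
    fix x assume x: "x \<in> V"
    have "(f_yz - g_yy) x = 0" using c V_sub x by blast
    then show "P_y x = 0 x" using fyz[OF x] gyy[OF x] by simp
  qed
  have P0 [simp]: "P_y x = 0" "P_yy x = 0" "P_zy x = 0" if "x \<in> V" for x
    using agreeD[OF Py that] agree_y[OF Py that] agree_z[OF Py that] Pyz[OF that] that by auto
  have RT: "R * T + 3 * P * f_y * f_y \<doteq> 0"
  proof (rule agreeI)
    fix x assume x [simp]: "x \<in> V"
    have T': "2*f x*g_y x - 2*f x*f_z x + f_zz x - g_zy x = T x"
      by (simp add: T_def commute_V)
    have "((2*f*g_y - 2*f*f_z + f_zz - g_zy)*R + 3*(f_z - g_y)*f_y^2) x = 0" using c V_sub x by blast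
    then have "T x * R x + 3 * P x * (f_y x)^2 = 0"
      unfolding fun_apply T' unfolding fz[OF x] by simp
    then show "(R * T + 3 * P * f_y * f_y) x = 0 x"
      by (simp add: power2_eq_square algebra_simps)
  qed
  have RT': "R x * T x + 3 * P x * (f_y x)^2 = 0" if "x \<in> V" for x
    using agreeD[OF RT that] by (simp add: power2_eq_square algebra_simps)
  interpret degenerate \<Omega> f g V
  proof
    show "f_y x \<noteq> 0" if "x \<in> V" for x by (rule fy[OF that])
    show "R*P_y - f_y*P_yy \<doteq> 0" by (rule agreeI) simp
    show "P*f_y^2 + f*P_y*f_y + R*T - f_y*T_y \<doteq> 0"
    proof (rule agreeI)
      fix x assume x [simp]: "x \<in> V"
      have "T_y x + 2 * f_y x * P x = 0" using Pzy[OF x] by simp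
      then show "(P*f_y^2 + f*P_y*f_y + R*T - f_y*T_y) x = 0 x"
        using RT'[OF x] unfolding fun_apply P0(1)[OF x] mult_zero_left mult_zero_right add_0_right
        by algebra
    qed
  qed
  define A where "A = (\<lambda>x. N x / D x)"
  have A [simp]: "A analytic2_on V"
    unfolding A_def by (rule analytic2_divide[OF N_analytic coefficients_analytic(8) D])
  define w where "w = (\<lambda>x. (P_y * A - T) x / f_y x)"
  have w [simp]: "w analytic2_on V"
    unfolding w_def by (rule analytic2_divide; (intro analytic2_intros coefficients_analytic A)?) (rule fy)
  have DA: "D * A \<doteq> N" by (rule agreeI) (use D in \<open>simp add: A_def\<close>)
  have constraint: "P_y * A - f_y * w \<doteq> T" by (rule agreeI) (use fy in \<open>simp add: w_def\<close>)
  have Tw: "f_y x * w x + T x = 0" if "x \<in> V" for x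
    using agreeD[OF constraint that, symmetric] that by simp
  have Dx: "D x - P x * (f_y x)^2 = 0" if x: "x \<in> V" for x
  proof -
    have "D x - (4 * P x * (f_y x)^2 + R x * T x) = 0" using D_eq[OF x] x by simp
    then show ?thesis using RT'[OF x] by algebra
  qed
  have RRA: "R^2 * A \<doteq> 3*f_y*Q_y + 9*f_y^3 - 3*f*f_y*R - 3*Q*R"
  proof (rule agreeI)
    fix x assume x [simp]: "x \<in> V"
    have "Q_y x * T x + R x * T_z x + 3 * (T x + 2 * f x * P x) * (f_y x)^2 + 6 * P x * f_y x * Q x = 0"
      using agree_z[OF RT x] by (simp add: fyz Pz Rz power2_eq_square algebra_simps)
    moreover have "D x * A x - (f_y x * T_z x - (Q x + f x * f_y x) * T x) = 0"
      using agreeD[OF DA x] by (simp add: N_def)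
    ultimately have "D x * ((R x)^2 * A x - (3*f_y x*Q_y x + 9*(f_y x)^3 - 3*f x*f_y x*R x - 3*Q x*R x)) = 0"
      using Dx[OF x] RT'[OF x] by algebra
    then show "(R^2 * A) x = (3*f_y*Q_y + 9*f_y^3 - 3*f*f_y*R - 3*Q*R) x"
      using D[OF x] by simp
  qed
  show ?thesis
  proof (rule solvable_nondegenerate[OF A w constraint DA D], assumption, rule agreeI)
    fix x assume x [simp]: "x \<in> V"
    have "f_y x * (R x * w x - 3 * P x * f_y x) = 0"
      using Tw[OF x] RT'[OF x] by algebra
    then have Rw: "R x * w x - 3 * P x * f_y x = 0" using fy[OF x] by simp
    have "2 * R x * Q_y x * A x + (R x)^2 * \<partial>z A x - (3 * Q x * Q_y x + 3 * f_y x * Q_zy x + 27 * (f_y x)^2 * Q x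
       - 3 * (P x + g_y x) * f_y x * R x - 3 * f x * Q x * R x - 3 * f x * f_y x * Q_y x - 3 * Q_z x * R x - 3 * Q x * Q_y x) = 0"
      using agree_z[OF RRA x]
      by (simp add: fyz fz Rz Qyz power2_eq_square power3_eq_cube algebra_simps)
    moreover have "(g*R^3 + (3*f_y*g_y + 3*f*Q + 3*Q_z)*R^2 - (27*Q*f_y^2 + 3*f*f_y*Q_y + 3*f_y*Q_zy + 6*Q*Q_y)*R + 6*f_y*Q_y*(3*f_y^2 + Q_y)) x = 0" using c V_sub x by blast
    ultimately have "(R x)^3 * (\<partial>z A x - (g x - w x)) = 0"
      using Rw agreeD[OF RRA x, unfolded fun_apply, THEN eq_diff0] unfolding fun_apply
      by algebra
    then show "\<partial>z A x = (g - w) x" using Rnz[OF x] by simp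
  qed
qed

lemma (in region) solvable_of_condition_5:
  assumes c: condition_5 and fy: "\<And>x. x \<in> V \<Longrightarrow> f_y x \<noteq> 0" and Rnz: "\<And>x. x \<in> V \<Longrightarrow> R x \<noteq> 0"
  shows solvable
proof -
  note c = c[unfolded condition_5_def]
  have D0: "D \<doteq> 0"
  proof (rule agreeI)
    fix x assume x [simp]: "x \<in> V"
    have "(R*T + 4*f_y^2*P - 2*P_y^2 + (2*f*f_y - Q)*P_y) x = 0" using c V_sub x by blast
    then show "D x = 0 x" unfolding D_eq[OF x] fun_apply by algebra
  qed
  have D0': "4 * P x * (f_y x)\<^sup>2 + 2 * f x * P_y x * f_y x - Q x * P_y x + R x * T x - 2 * (P_y x)\<^sup>2 = 0"
    if x: "x \<in> V" for x
    using agreeD[OF D0 x] D_eq[OF x] by simp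
  have S_zero: "R*P_y - f_y*P_yy \<doteq> 0"
    by (rule agreeI) (use c V_sub in auto)
  interpret degenerate \<Omega> f g V
  proof
    show "f_y x \<noteq> 0" if "x \<in> V" for x by (rule fy[OF that])
    show "R*P_y - f_y*P_yy \<doteq> 0" by (rule S_zero)
    show "P*f_y^2 + f*P_y*f_y + R*T - f_y*T_y \<doteq> 0"
    proof (rule agreeI)
      fix x assume x [simp]: "x \<in> V"
      have Dy: "4 * P_y x * (f_y x)^2 + 8 * P x * f_y x * R x + 2 * f_y x * P_y x * f_y x + 2 * f x * P_yy x * f_y x
        + 2 * f x * P_y x * R x - Q_y x * P_y x - Q x * P_yy x + R_y x * T x + R x * T_y x - 4 * P_y x * P_yy x = 0"
        using agree_y[OF D0 x] by (simp add: D_def fyy power2_eq_square algebra_simps)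
      have "(f_y*(Q*P_y - 4*P*f_y^2 - 2*f*P_y*f_y + 2*P_y^2)*R_y - R*(2*R*P_y^2 - 5*P*R*f_y^2 - 3*R*f*P_y*f_y - 6*P_y*f_y^3 + Q_y*P_y*f_y)) x = 0" using c V_sub x by blast
      \<comment> \<open>Compatibility is not listed in condition 5. In \<open>D_y = 0\<close> the
        derivative \<open>T_y\<close> occurs only as \<open>R * T_y\<close>, so the third equation
        returns compatibility multiplied by \<open>R^2\<close>.\<close>
      then have "(R x)^2 * (P x*(f_y x)^2 + f x*P_y x*f_y x + R x*T x - f_y x*T_y x) = 0"
        unfolding fun_apply using Dy D0'[OF x] agreeD[OF S_zero x, unfolded fun_apply] by algebra
      then show "(P*f_y^2 + f*P_y*f_y + R*T - f_y*T_y) x = 0 x" using Rnz[OF x] by simp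
    qed
  qed
  have N0: "N x = 0" if x [simp]: "x \<in> V" for x
  proof -
    obtain p t where j: "P_y x = p * f_y x" "T x = t * f_y x"
      "P_zy x = 3 * P x * f_y x + 3 * f x * (p * f_y x) + R x * t"
      "R_z x = R x * p + Q_y x"
      "P_z x = t * f_y x + 2 * f x * P x" "f_yz x = p * f_y x + Q x"
      by (rule solved_jets[OF x])
    have Dz: "4 * P_z x * (f_y x)^2 + 8 * P x * f_y x * f_yz x + 2 * f_z x * P_y x * f_y x + 2 * f x * P_zy x * f_y x
      + 2 * f x * P_y x * f_yz x - Q_z x * P_y x - Q x * P_zy x + R_z x * T x + R x * T_z x - 4 * P_y x * P_zy x = 0"
      using agree_z[OF D0 x] by (simp add: D_def Pyz power2_eq_square algebra_simps)
    have "(g*f_y*R^2*P_y + 2*R*f_y^3*f*P + (5*P*Q + 2*P*P_y + 2*g_y*P_y)*R*f_y^2 - 8*f_y^4*f*P_y + P_y*(2*Q*f - 2*f*P_y - Q_z)*R*f_y - P_y^2*(Q + 2*P_y)*R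
      - 16*f_y^5*P + (4*Q*P_y - 4*P*Q_y + 8*P_y^2)*f_y^3 - 2*Q_y*f_y^2*f*P_y + Q_y*P_y*(Q + 2*P_y)*f_y) x = 0" using c V_sub x by blast
    \<comment> \<open>In the same way \<open>T_z\<close> occurs in \<open>D_z = 0\<close> only as
      \<open>R * T_z\<close>, so the fourth equation returns \<open>N = 0\<close>.\<close>
    then have "(R x)^2 * (f_y x * (T_z x - g x * P_y x) - (2 * P_y x + Q x + f x * f_y x) * T x) = 0"
      unfolding fun_apply using D0'[OF x] Dz unfolding j fz[OF x] by algebra
    then show "N x = 0" using Rnz[OF x] by (simp add: N_def)
  qed
  \<comment> \<open>The constraint now reads \<open>w = \<phi> * A - \<tau>\<close>; since
    \<open>D\<close> and \<open>N\<close> vanish, its \<open>z\<close>-derivative adds nothing. The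
    degenerate relations become \<open>\<phi>_y = 0\<close> and
    \<open>\<tau>_y = P + f * \<phi>\<close>.\<close>
  define \<phi> where "\<phi> = (\<lambda>x. P_y x / f_y x)"
  define \<tau> where "\<tau> = (\<lambda>x. T x / f_y x)"
  have an [simp]: "\<phi> analytic2_on V" "\<tau> analytic2_on V"
    unfolding \<phi>_def \<tau>_def by (intro analytic2_divide analytic2_intros coefficients_analytic fy; assumption)+
  have \<phi>: "\<phi> * f_y \<doteq> P_y" and \<tau>: "\<tau> * f_y \<doteq> T"
    by (rule agreeI, use fy in \<open>simp add: \<phi>_def \<tau>_def\<close>)+
  have \<phi>y: "\<partial>y \<phi> x = 0" if x [simp]: "x \<in> V" for x
  proof -
    have "\<partial>y \<phi> x * f_y x + \<phi> x * R x - P_yy x = 0"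
      using agree_y[OF \<phi> x] by (simp add: fyy)
    then have "f_y x * f_y x * \<partial>y \<phi> x = 0"
      using agreeD[OF \<phi> x, unfolded fun_apply, THEN eq_diff0] agreeD[OF S_zero x, unfolded fun_apply zero_fun_apply]
      by algebra
    then show ?thesis using fy[OF x] by simp
  qed
  have \<tau>y: "\<partial>y \<tau> x = P x + f x * \<phi> x" if x [simp]: "x \<in> V" for x
  proof -
    have "\<partial>y \<tau> x * f_y x + \<tau> x * R x - T_y x = 0"
      using agree_y[OF \<tau> x] by (simp add: fyy)
    then have "f_y x * f_y x * (\<partial>y \<tau> x - (P x + f x * \<phi> x)) = 0"
      using agreeD[OF \<phi> x, unfolded fun_apply, THEN eq_diff0] agreeD[OF \<tau> x, unfolded fun_apply, THEN eq_diff0]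
        agreeD[OF constraint_y_compatible x, unfolded fun_apply zero_fun_apply]
      by algebra
    then show ?thesis using fy[OF x] by simp
  qed
  text \<open>Since \<open>\<phi>\<close> does not depend on \<open>y\<close>, the linear system \<open>A_y = f\<close>, \<open>A_z = g + \<tau> - \<phi> * A\<close>
    has the integrating factor \<open>exp H\<close> with \<open>H_z = \<phi>\<close> and \<open>H_y = 0\<close>.\<close>
  obtain x0 where x0: "x0 \<in> V" using V_nonempty by auto
  obtain W H where W: "open W" "x0 \<in> W" "W \<subseteq> V" "H analytic2_on W"
    and H: "\<And>x. x \<in> W \<Longrightarrow> \<partial>y H x = 0" "\<And>x. x \<in> W \<Longrightarrow> \<partial>z H x = \<phi> x"
    by (rule analytic2_potential[OF open_V x0, of 0 \<phi>]) (use \<phi>y in auto)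
  define E where "E = (\<lambda>x. exp (H x))"
  define E' where "E' = (\<lambda>x. exp (- H x))"
  interpret W: region \<Omega> f g W
    by unfold_locales (use W V_sub in auto)
  have anW [simp]: "\<phi> analytic2_on W" "\<tau> analytic2_on W" "H analytic2_on W" "E analytic2_on W" "E' analytic2_on W"
    using W(4) analytic2_exp[OF W(4)] analytic2_exp[OF analytic2_fun_uminus[OF W(4)]]
      analytic2_subset[OF an(1) W(3)] analytic2_subset[OF an(2) W(3)]
    by (simp_all add: E_def E'_def)
  have EE': "E x * E' x = 1" for x by (simp add: E_def E'_def flip: exp_add)
  have Ed: "\<partial>y E x = 0" "\<partial>z E x = \<phi> x * E x" "\<partial>y E' x = 0" "\<partial>z E' x = - \<phi> x * E' x" if x: "x \<in> W" for x
    using partial_exp[OF W(4) x] partial_exp[OF analytic2_fun_uminus[OF W(4)] x] x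
    by (simp_all add: E_def E'_def H)
  \<comment> \<open>\<open>G\<close> stands for \<open>exp H * A\<close>; the form is closed by
    \<open>\<tau>_y = P + f * \<phi>\<close> and \<open>f_z = P + g_y\<close>.\<close>
  obtain W' G where W': "open W'" "x0 \<in> W'" "W' \<subseteq> W" "G analytic2_on W'"
    and G: "\<And>x. x \<in> W' \<Longrightarrow> \<partial>y G x = (E * f) x" "\<And>x. x \<in> W' \<Longrightarrow> \<partial>z G x = (E * (g + \<tau>)) x"
  proof (rule analytic2_potential[OF W(1,2), of "E * f" "E * (g + \<tau>)"])
    fix x assume x [simp]: "x \<in> W"
    then have [simp]: "x \<in> V" using W(3) by auto
    show "\<partial>z (E * f) x = \<partial>y (E * (g + \<tau>)) x"
      by (simp add: Ed \<tau>y fz algebra_simps)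
  qed simp_all
  interpret W': degenerate \<Omega> f g W'
  proof -
    interpret W': region \<Omega> f g W' by unfold_locales (use W W' V_sub in auto)
    show "degenerate \<Omega> f g W'"
      by unfold_locales
        (use W(3) W'(3) fy S_zero constraint_y_compatible in \<open>auto simp: agree_def W'.agree_def\<close>)
  qed
  have [simp]: "\<phi> analytic2_on W'" "\<tau> analytic2_on W'" "G analytic2_on W'" "E' analytic2_on W'"
    using W'(4) anW[THEN analytic2_subset, OF W'(3)] by simp_all
  have W'.solvable
  proof (rule W'.solvable_of_linear_system)
    let ?A = "G * E'" and ?w = "\<phi> * (G * E') - \<tau>"
    show "?A analytic2_on W'" "?w analytic2_on W'" by simp_all
    have V: "x \<in> W" "x \<in> V" if "x \<in> W'" for x using that W W' by auto
    show "W'.agree (\<partial>y ?A) f"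
    proof (rule W'.agreeI)
      fix x assume x [simp]: "x \<in> W'"
      show "\<partial>y ?A x = f x" using EE'[of x] by (simp add: Ed V G algebra_simps)
    qed
    show "W'.agree (\<partial>z ?A) (g - ?w)"
    proof (rule W'.agreeI)
      fix x assume x [simp]: "x \<in> W'"
      have "\<partial>z ?A x = (E x * E' x) * (g x + \<tau> x) - \<phi> x * (G x * E' x)"
        by (simp add: Ed V G algebra_simps)
      then have "\<partial>z ?A x = g x + \<tau> x - \<phi> x * (G x * E' x)" by (simp only: EE' mult_1)
      then show "\<partial>z ?A x = (g - ?w) x" by (simp only: fun_apply) simp
    qed
    show "W'.agree (P_y * ?A - f_y * ?w) T"
    proof (rule W'.agreeI)
      fix x assume x: "x \<in> W'"
      show "(P_y * ?A - f_y * ?w) x = T x"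
        unfolding fun_apply
        using agreeD[OF \<phi> V(2)[OF x], unfolded fun_apply, THEN eq_diff0]
          agreeD[OF \<tau> V(2)[OF x], unfolded fun_apply, THEN eq_diff0] by algebra
    qed
    show "W'.agree (D * ?A) W'.N"
      by (rule W'.agreeI) (use D0 N0 V in \<open>simp add: agree_def W'.N_def N_def\<close>)
  qed
  then show ?thesis by (simp add: W'.solvable_def solvable_def)
qed

section \<open>First integrals and Lax representations\<close>

context analytic_equation
begin

lemma region_\<Omega>: "region \<Omega> f g \<Omega>"
  by unfold_locales (auto simp: open_\<Omega> nonempty_\<Omega>)

lemma conditions_imp_solution:
  assumes coefficient_conditions
  shows "\<exists>V A w. solution \<Omega> f g V A w"
proof -
  interpret O: region \<Omega> f g \<Omega> by (rule region_\<Omega>)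
  note an = analytic2_intros O.\<Omega>_analytic
  have result: ?thesis if "region \<Omega> f g V" "region.solvable \<Omega> f g" for V
    using that region.solvable_def by blast
  \<comment> \<open>Condition 6 does not state that \<open>f_y\<close> is nonzero, but
    \<open>R\<close> is its \<open>y\<close>-derivative.\<close>
  have fy_of_R: "nonzero f_y" if "nonzero R"
  proof (rule ccontr)
    assume "\<not> nonzero f_y"
    then have "O.agree f_y 0" by (auto simp: O.agree_def)
    from O.agree_y[OF this] have "vanishes R" by (simp add: R_def)
    with that show False by blast
  qed
  consider condition_1 | condition_2 | condition_3 | condition_4 | condition_5 | condition_6
    using assms by (auto simp: coefficient_conditions_def)
  then show ?thesis
  proof cases
    case 1
    then have nz: "nonzero f_y" "nonzero S" by (simp_all add: condition_1_def)
    obtain V where V: "region \<Omega> f g V" "\<And>x. x \<in> V \<Longrightarrow> f_y x \<noteq> 0"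
      by (rule O.shrink_to_nonzero[OF _ nz(1)]) (intro an, blast)
    obtain W where W: "region \<Omega> f g W" "W \<subseteq> V" "\<And>x. x \<in> W \<Longrightarrow> S x \<noteq> 0"
      by (rule region.shrink_to_nonzero[OF V(1) _ nz(2)]) (intro an, blast)
    show ?thesis
      by (rule result[OF W(1)], rule region.solvable_of_condition_1[OF W(1) 1]) (use V W in auto)
  next
    case 2
    then have "nonzero Q" by (simp add: condition_2_def Q_def)
    then obtain V where V: "region \<Omega> f g V" "\<And>x. x \<in> V \<Longrightarrow> Q x \<noteq> 0"
      using O.shrink_to_nonzero[OF O.\<Omega>_analytic(4)] by metis
    show ?thesis
      by (rule result[OF V(1)], rule region.solvable_of_condition_2[OF V(1) 2]) (use V in auto)
  next
    case 3
    then have nz: "nonzero f_y" "nonzero D" by (simp_all add: condition_3_def)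
    obtain V where V: "region \<Omega> f g V" "\<And>x. x \<in> V \<Longrightarrow> f_y x \<noteq> 0"
      by (rule O.shrink_to_nonzero[OF _ nz(1)]) (intro an, blast)
    obtain W where W: "region \<Omega> f g W" "W \<subseteq> V" "\<And>x. x \<in> W \<Longrightarrow> D x \<noteq> 0"
      by (rule region.shrink_to_nonzero[OF V(1) _ nz(2)]) (intro an, blast)
    show ?thesis
      by (rule result[OF W(1)], rule region.solvable_of_condition_3[OF W(1) 3]) (use V W in auto)
  next
    case 4
    show ?thesis
      by (rule result[OF region_\<Omega>], rule O.solvable_of_condition_4[OF 4])
  next
    case 5
    then have nz: "nonzero f_y" "nonzero R" by (simp_all add: condition_5_def)
    obtain V where V: "region \<Omega> f g V" "\<And>x. x \<in> V \<Longrightarrow> f_y x \<noteq> 0"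
      by (rule O.shrink_to_nonzero[OF _ nz(1)]) (intro an, blast)
    obtain W where W: "region \<Omega> f g W" "W \<subseteq> V" "\<And>x. x \<in> W \<Longrightarrow> R x \<noteq> 0"
      by (rule region.shrink_to_nonzero[OF V(1) _ nz(2)]) (intro an, blast)
    show ?thesis
      by (rule result[OF W(1)], rule region.solvable_of_condition_5[OF W(1) 5]) (use V W in auto)
  next
    case 6
    then have nz: "nonzero f_y" "nonzero R" "nonzero D" using fy_of_R by (simp_all add: condition_6_def)
    obtain V where V: "region \<Omega> f g V" "\<And>x. x \<in> V \<Longrightarrow> f_y x \<noteq> 0"
      by (rule O.shrink_to_nonzero[OF _ nz(1)]) (intro an, blast)
    obtain W where W: "region \<Omega> f g W" "W \<subseteq> V" "\<And>x. x \<in> W \<Longrightarrow> R x \<noteq> 0"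
      by (rule region.shrink_to_nonzero[OF V(1) _ nz(2)]) (intro an, blast)
    obtain W' where W': "region \<Omega> f g W'" "W' \<subseteq> W" "\<And>x. x \<in> W' \<Longrightarrow> D x \<noteq> 0"
      by (rule region.shrink_to_nonzero[OF W(1) _ nz(3)]) (intro an, blast)
    show ?thesis
      by (rule result[OF W'(1)], rule region.solvable_of_condition_6[OF W'(1) 6]) (use V W W' in auto)
  qed
qed

lemma total_deriv_quadratic:
  assumes "region \<Omega> f g V" and an [simp]: "A analytic2_on V" "B analytic2_on V" and x [simp]: "x \<in> V"
  shows "total_deriv (\<lambda>x v. (v + A x)\<^sup>2 + B x) x v =
    2 * (v + A x) * \<partial>z A x + \<partial>z B x + v * (2 * (v + A x) * \<partial>y A x + \<partial>y B x)
    - (f x * v + g x) * (2 * (v + A x))"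
proof -
  interpret region \<Omega> f g V by fact
  have [simp]: "(\<lambda>_. v) analytic2_on V" by (rule analytic2_const)
  have eq: "(\<lambda>x. (v + A x)\<^sup>2 + B x) = ((\<lambda>_. v) + A) * ((\<lambda>_. v) + A) + B"
    by (simp add: fun_eq_iff power2_eq_square)
  have "((\<lambda>v. (v + A x)\<^sup>2 + B x) has_field_derivative 2 * (v + A x)) (at v)"
    by (auto intro!: derivative_eq_intros)
  then have "deriv (\<lambda>v. (v + A x)\<^sup>2 + B x) v = 2 * (v + A x)" by (rule DERIV_imp_deriv)
  then show ?thesis
    unfolding total_deriv_def eq by (simp add: algebra_simps)
qed

end

lemma (in region) first_integral_imp_solvable:
  assumes an [simp]: "A analytic2_on V" "B analytic2_on V"
    and I: "first_integral_on V (\<lambda>x v. (v + A x)\<^sup>2 + B x)"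
  shows solvable
proof -
  define w where "w = g - \<partial>z A"
  have w [simp]: "w analytic2_on V" by (simp add: w_def)
  have Ay: "\<partial>y A x = f x" and By: "\<partial>y B x = 2 * w x" and Bz: "\<partial>z B x = 2 * A x * w x"
    if x: "x \<in> V" for x
  proof -
    have I': "2 * (v + A x) * \<partial>z A x + \<partial>z B x + v * (2 * (v + A x) * \<partial>y A x + \<partial>y B x)
      - (f x * v + g x) * (2 * (v + A x)) = 0" for v
      using I x total_deriv_quadratic[OF region_axioms _ _ x, of A B v]
      by (simp add: first_integral_on_def)
    \<comment> \<open>The total derivative is a quadratic polynomial in \<open>v\<close>; the values
      at 0, 1 and -1 determine its coefficients.\<close>
    have z: "2 * A x * \<partial>z A x + \<partial>z B x - g x * (2 * A x) = 0"
      using I'[of 0] by simp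
    have p: "2 * (1 + A x) * \<partial>z A x + \<partial>z B x + (2 * (1 + A x) * \<partial>y A x + \<partial>y B x)
      - (f x + g x) * (2 * (1 + A x)) = 0"
      using I'[of 1] by simp
    have m: "2 * (A x - 1) * \<partial>z A x + \<partial>z B x - (2 * (A x - 1) * \<partial>y A x + \<partial>y B x)
      - (g x - f x) * (2 * (A x - 1)) = 0"
      using I'[of "-1"] by (simp add: algebra_simps)
    have "4 * (\<partial>y A x - f x) = 0" using z p m by algebra
    then show Ay: "\<partial>y A x = f x" by simp
    show "\<partial>z B x = 2 * A x * w x" using z by (simp add: w_def algebra_simps)
    have "2 * (\<partial>y B x - 2 * w x) = 0"
      using p m Ay[THEN eq_diff0] unfolding w_def fun_apply by algebra
    then show "\<partial>y B x = 2 * w x" by simp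
  qed
  have agree: "\<partial>y A \<doteq> f" "\<partial>z A \<doteq> g - w" "\<partial>y B \<doteq> 2 * w" "\<partial>z B \<doteq> 2 * A * w"
    by (rule agreeI, simp add: Ay By Bz w_def)+
  have "\<partial>z w \<doteq> f * w - A * P"
  proof (rule agreeI)
    fix x assume x [simp]: "x \<in> V"
    have "\<partial>z (\<partial>y A) x = \<partial>y (\<partial>z A) x" by (rule commute_V) simp_all
    then have wy: "\<partial>y w x + P x = 0"
      using agree_z[OF agree(1) x] agree_y[OF agree(2) x] by (simp add: fz algebra_simps)
    have "\<partial>z (\<partial>y B) x = \<partial>y (\<partial>z B) x" by (rule commute_V) simp_all
    then have "2 * \<partial>z w x - (2 * f x * w x + 2 * A x * \<partial>y w x) = 0"
      using agree_z[OF agree(3) x] agree_y[OF agree(4) x] by (simp add: Ay algebra_simps)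
    then have "2 * (\<partial>z w x - (f x * w x - A x * P x)) = 0" using wy by algebra
    then show "\<partial>z w x = (f * w - A * P) x" unfolding mult_eq_0_iff by simp
  qed
  then show ?thesis using agree by (intro solvableI[of A w]) simp_all
qed

text \<open>The form with components \<open>2 * w\<close> and \<open>2 * A * w\<close> is closed
  because of the equations for \<open>A_y\<close>, \<open>w_y\<close> and \<open>w_z\<close>. The
  normalisation at \<open>x0\<close> allows a constant to be added later.\<close>

lemma (in solution) potential:
  assumes x0: "x0 \<in> V"
  obtains W B where "solution \<Omega> f g W A w" "W \<subseteq> V" "x0 \<in> W" "B analytic2_on W" "B x0 = 0"
    "\<And>x. x \<in> W \<Longrightarrow> \<partial>y B x = 2 * w x" "\<And>x. x \<in> W \<Longrightarrow> \<partial>z B x = 2 * A x * w x"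
proof -
  obtain W B where W: "open W" "x0 \<in> W" "W \<subseteq> V" "B analytic2_on W" "B x0 = 0"
    and B: "\<And>x. x \<in> W \<Longrightarrow> \<partial>y B x = (2 * w) x" "\<And>x. x \<in> W \<Longrightarrow> \<partial>z B x = (2 * A * w) x"
    by (rule analytic2_potential[OF open_V x0, of "2 * w" "2 * A * w"])
      (auto simp: Aw algebra_simps)
  have "region \<Omega> f g W" by unfold_locales (use W V_sub in auto)
  then have "solution \<Omega> f g W A w" using W(3) by (rule restrict_solution)
  then show thesis using W B by (intro that[of W B]) simp_all
qed

lemma (in solution) has_first_integral: has_quadratic_first_integral
proof -
  obtain x0 where x0: "x0 \<in> V" using V_nonempty by auto
  obtain W B where W: "solution \<Omega> f g W A w" "x0 \<in> W" and an: "B analytic2_on W"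
    and B: "\<And>x. x \<in> W \<Longrightarrow> \<partial>y B x = 2 * w x" "\<And>x. x \<in> W \<Longrightarrow> \<partial>z B x = 2 * A x * w x"
    by (rule potential[OF x0]) blast
  interpret W: solution \<Omega> f g W A w by fact
  have "first_integral_on W (\<lambda>x v. (v + A x)\<^sup>2 + B x)"
    unfolding first_integral_on_def
  proof (intro ballI allI)
    fix x v assume x: "x \<in> W"
    show "total_deriv (\<lambda>x v. (v + A x)\<^sup>2 + B x) x v = 0"
      unfolding total_deriv_quadratic[OF W.region_axioms W.A_analytic an x] W.Aw[OF x] B[OF x]
      by algebra
  qed
  then show ?thesis
    unfolding has_quadratic_first_integral_def
    using W.open_V W.V_nonempty W.V_sub W.A_analytic an by blast
qed

text \<open>Working with the power series avoids an integration along paths: vanishing first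
  derivatives kill every coefficient except the constant one.\<close>

lemma constant_near:
  fixes h :: "'a \<times> 'a \<Rightarrow> 'a::{real_normed_field,banach}"
  assumes W: "open W" "x \<in> W" and h: "h analytic2_on W"
    and d0: "\<And>y. y \<in> W \<Longrightarrow> \<partial>z h y = 0" "\<And>y. y \<in> W \<Longrightarrow> \<partial>y h y = 0"
  obtains W' where "open W'" "x \<in> W'" "W' \<subseteq> W" "\<And>y. y \<in> W' \<Longrightarrow> h y = h x"
proof -
  obtain \<rho> where \<rho>: "0 < \<rho>" "\<And>s. s \<in> bidisc \<rho> \<Longrightarrow> x + s \<in> W"
    using open_contains_bidisc[OF W] by blast
  obtain c r' where "expands h x c r'" using h W by (auto simp: analytic2_on_iff_expands)
  then have h: "expands h x c (min \<rho> r')" using \<rho> by (auto intro: expands_shrink simp: expandsD(1))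
  define r where "r = min \<rho> r'"
  note h = h[folded r_def]
  have r: "0 < r" "0 < r / 2" "r / 2 < r" "r \<le> \<rho>" using expandsD(1)[OF h] by (auto simp: r_def)
  have V: "x + s \<in> W" if "s \<in> bidisc r" for s
    using that r by (intro \<rho>(2)) (auto simp: bidisc_def)
  have zero: "expands (\<lambda>_. 0) x (\<lambda>_. 0) (r / 2)"
    using expands_const[OF r(2), of 0 x] by simp
  have "expands (\<partial>z h) x (\<lambda>_. 0) (r / 2)" "expands (\<partial>y h) x (\<lambda>_. 0) (r / 2)"
    by (rule expands_cong[OF zero]; use V r d0 in \<open>auto simp: bidisc_def\<close>)+
  then have cz: "(\<lambda>p. of_nat (Suc (fst p)) * c (Suc (fst p), snd p)) = (\<lambda>_. 0)"
    and cy: "(\<lambda>p. of_nat (Suc (snd p)) * c (fst p, Suc (snd p))) = (\<lambda>_. 0)"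
    using expands_unique expands_partial_z[OF h r(2,3)] expands_partial_y[OF h r(2,3)] by blast+
  have c0: "c p = 0" if "p \<noteq> (0, 0)" for p
  proof (cases p)
    case (Pair i j)
    then show ?thesis
      using that fun_cong[OF cz, of "(i - 1, j)"] fun_cong[OF cy, of "(i, j - 1)"]
      by (cases i; cases j) (auto simp del: of_nat_Suc)
  qed
  show thesis
  proof (rule that[of "(+) x ` bidisc r"])
    show "open ((+) x ` bidisc r)" by (rule open_translated_bidisc)
    show "x \<in> (+) x ` bidisc r" using r by (auto intro!: image_eqI[of _ _ 0])
    show "(+) x ` bidisc r \<subseteq> W" using V by auto
    fix y assume "y \<in> (+) x ` bidisc r"
    then obtain s where s: "s \<in> bidisc r" "y = x + s" by auto
    have "((\<lambda>p. c p * monom2 s p) has_sum c (0, 0)) UNIV"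
      by (rule has_sum_finite_neutralI[of "{(0, 0)}"]) (auto simp: c0 monom2_def)
    then show "h y = h x"
      using has_sum_unique[OF _ expandsD(3)[OF h s(1)]] expands_center[OF h] s(2) by metis
  qed
qed

section \<open>Lax representations\<close>

lemma (in region) lax_representation_iff:
  assumes [simp]: "F analytic2_on V" "U analytic2_on V"
  shows "lax_representation_on V (lax_L F U) (lax_M U) \<longleftrightarrow>
    (\<forall>x\<in>V. \<partial>y F x = f x \<and> \<partial>z F x = g x - U x * \<partial>y U x \<and> \<partial>z U x = F x * \<partial>y U x)"
proof -
  have vc [simp]: "(\<lambda>_. v) analytic2_on V" for v by (rule analytic2_const)
  have entry11: "total_deriv (\<lambda>x v. v + F x) x v = \<partial>z F x + v * \<partial>y F x - (f x * v + g x)"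
    and entry22: "total_deriv (\<lambda>x v. - v - F x) x v = - \<partial>z F x - v * \<partial>y F x + (f x * v + g x)"
    and entry12: "total_deriv (\<lambda>x v. U x) x v = \<partial>z U x + v * \<partial>y U x"
    if x [simp]: "x \<in> V" for x v
  proof -
    have F: "(\<lambda>x. v + F x) = (\<lambda>_. v) + F" "(\<lambda>x. - v - F x) = (\<lambda>_. - v) - F"
      by (simp_all add: fun_eq_iff)
    have "deriv (\<lambda>v. v + F x) v = 1" "deriv (\<lambda>v. - v - F x) v = - 1"
      by (rule DERIV_imp_deriv, auto intro!: derivative_eq_intros)+
    then show "total_deriv (\<lambda>x v. v + F x) x v = \<partial>z F x + v * \<partial>y F x - (f x * v + g x)"
      "total_deriv (\<lambda>x v. - v - F x) x v = - \<partial>z F x - v * \<partial>y F x + (f x * v + g x)"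
      unfolding total_deriv_def F by (simp_all add: algebra_simps)
    show "total_deriv (\<lambda>x v. U x) x v = \<partial>z U x + v * \<partial>y U x"
      by (simp add: total_deriv_def)
  qed
  have "(\<chi> i j. total_deriv (\<lambda>x v. lax_L F U x v $ i $ j) x v)
      = lax_L F U x v ** lax_M U x v - lax_M U x v ** lax_L F U x v \<longleftrightarrow>
    \<partial>z F x + v * \<partial>y F x - (f x * v + g x) = - (U x * \<partial>y U x) \<and>
    \<partial>z U x + v * \<partial>y U x = (v + F x) * \<partial>y U x" if x: "x \<in> V" for x v
  proof -
    \<comment> \<open>The halves in \<open>M\<close> disappear because each entry of the commutator
      collects two equal contributions \<open>m\<close>.\<close>
    define m where "m = 1/2 * \<partial>y U x"
    have m: "\<partial>y U x = m + m" by (simp add: m_def)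
    have M: "lax_M U x v = vector [vector [0, m], vector [- m, 0]]" by (simp add: lax_M_def m_def)
    have "(\<chi> i j. total_deriv (\<lambda>x v. lax_L F U x v $ i $ j) x v)
        = lax_L F U x v ** lax_M U x v - lax_M U x v ** lax_L F U x v \<longleftrightarrow>
      \<partial>z F x + v * \<partial>y F x - (f x * v + g x) = U x * - m - m * U x \<and>
      \<partial>z U x + v * \<partial>y U x = (v + F x) * m - m * (- v - F x) \<and>
      \<partial>z U x + v * \<partial>y U x = (- v - F x) * - m - - m * (v + F x) \<and>
      - \<partial>z F x - v * \<partial>y F x + (f x * v + g x) = U x * m - - m * U x"
      unfolding M
      by (simp add: vec_eq_iff forall_2 matrix_matrix_mult_def sum_2 vector_2 lax_L_def
          entry11[OF x] entry12[OF x] entry22[OF x] conj_assoc)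
    also have "\<dots> \<longleftrightarrow> \<partial>z F x + v * \<partial>y F x - (f x * v + g x) = - (U x * \<partial>y U x) \<and>
      \<partial>z U x + v * \<partial>y U x = (v + F x) * \<partial>y U x"
      unfolding m by (auto simp: algebra_simps)
    finally show ?thesis .
  qed
  moreover have "(\<forall>v. \<partial>z F x + v * \<partial>y F x - (f x * v + g x) = - (U x * \<partial>y U x) \<and>
      \<partial>z U x + v * \<partial>y U x = (v + F x) * \<partial>y U x) \<longleftrightarrow>
    \<partial>y F x = f x \<and> \<partial>z F x = g x - U x * \<partial>y U x \<and> \<partial>z U x = F x * \<partial>y U x" (is "(\<forall>v. ?E v) \<longleftrightarrow> ?R") for x
  proof
    assume E: "\<forall>v. ?E v"
    have 1: "\<partial>z F x = g x - U x * \<partial>y U x" "\<partial>z U x = F x * \<partial>y U x"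
      using spec[OF E, of 0] by (simp_all add: algebra_simps)
    moreover have "\<partial>y F x = f x"
      using spec[OF E, of 1] 1 by simp
    ultimately show ?R by simp
  next
    assume ?R
    then show "\<forall>v. ?E v" by (simp add: algebra_simps)
  qed
  ultimately show ?thesis
    unfolding lax_representation_on_def by auto
qed

lemma (in region) lax_imp_solvable:
  assumes [simp]: "F analytic2_on V" "U analytic2_on V"
    and lax: "lax_representation_on V (lax_L F U) (lax_M U)"
  shows solvable
proof (rule solvableI)
  let ?w = "U * \<partial>y U"
  note lax = lax[unfolded lax_representation_iff[OF assms(1,2)]]
  show Fy: "\<partial>y F \<doteq> f" and Fz: "\<partial>z F \<doteq> g - ?w" using lax by (simp_all add: agree_def)
  have Uz: "\<partial>z U \<doteq> F * \<partial>y U" using lax by (simp add: agree_def)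
  show "\<partial>z ?w \<doteq> f * ?w - F * P"
  proof (rule agreeI)
    fix x assume x [simp]: "x \<in> V"
    have "\<partial>z (\<partial>y F) x = \<partial>y (\<partial>z F) x" by (rule commute_V) simp_all
    then have wy: "\<partial>y U x * \<partial>y U x + U x * \<partial>y (\<partial>y U) x + P x = 0"
      using agree_z[OF Fy x] agree_y[OF Fz x] by (simp add: fz algebra_simps)
    have Uyz: "\<partial>z (\<partial>y U) x = f x * \<partial>y U x + F x * \<partial>y (\<partial>y U) x"
      using agree_y[OF Uz x] agreeD[OF Fy x] by (simp add: commute_V)
    have "\<partial>z ?w x = F x * \<partial>y U x * \<partial>y U x + U x * (f x * \<partial>y U x + F x * \<partial>y (\<partial>y U) x)"
      using agreeD[OF Uz x] by (simp add: Uyz)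
    then show "\<partial>z ?w x = (f * ?w - F * P) x"
      unfolding fun_apply using wy by algebra
  qed
qed simp_all

text \<open>The potential is normalised to \<open>B = 1\<close> at the base point, so that \<open>U = exp (H)\<close> with
  \<open>H = ln B / 2\<close> is available over the reals as well; \<open>H\<close> is obtained as a potential of \<open>dB / (2 B)\<close>.\<close>

lemma (in solution) has_lax: has_lax_representation
proof -
  obtain x0 where x0: "x0 \<in> V" using V_nonempty by auto
  obtain W1 B0 where W1: "solution \<Omega> f g W1 A w" "x0 \<in> W1" and B0: "B0 analytic2_on W1" "B0 x0 = 0"
    and B0': "\<And>x. x \<in> W1 \<Longrightarrow> \<partial>y B0 x = 2 * w x" "\<And>x. x \<in> W1 \<Longrightarrow> \<partial>z B0 x = 2 * A x * w x"
    by (rule potential[OF x0]) blast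
  interpret W1: solution \<Omega> f g W1 A w by fact
  have B1: "(1 + B0) analytic2_on W1" using B0(1) by simp
  obtain W2 where W2: "open W2" "x0 \<in> W2" "W2 \<subseteq> W1" "\<And>x. x \<in> W2 \<Longrightarrow> (1 + B0) x \<noteq> 0"
    using analytic2_nonzero_near[OF B1 W1.open_V W1(2)] B0(2) by auto
  interpret W2: solution \<Omega> f g W2 A w
    by (rule W1.restrict_solution[OF _ W2(3)], unfold_locales) (use W2 W1.V_sub in auto)
  define B where "B = 1 + B0"
  define J where "J = (\<lambda>x. inverse (B x))"
  have [simp]: "B0 analytic2_on W2" by (rule analytic2_subset[OF B0(1) W2(3)])
  then have B [simp]: "B analytic2_on W2" by (simp add: B_def)
  have Bnz: "B x \<noteq> 0" if "x \<in> W2" for x using W2(4)[OF that] by (simp add: B_def)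
  have J [simp]: "J analytic2_on W2" unfolding J_def by (rule analytic2_inverse[OF B Bnz])
  have Bd: "\<partial>y B x = 2 * w x" "\<partial>z B x = 2 * A x * w x" if "x \<in> W2" for x
    using that B0'[OF subsetD[OF W2(3) that]] by (simp_all add: B_def)
  have JB: "W2.agree (J * B) 1" by (rule W2.agreeI) (simp add: J_def Bnz)
  have Jd: "\<partial>y J x = - (2 * w x * J x * J x)" "\<partial>z J x = - (2 * A x * w x * J x * J x)"
    if x [simp]: "x \<in> W2" for x
  proof -
    have "J x * B x - 1 = 0" using W2.agreeD[OF JB x] by simp
    moreover have "\<partial>y J x * B x + J x * (2 * w x) = 0" "\<partial>z J x * B x + J x * (2 * A x * w x) = 0"
      using W2.agree_y[OF JB x] W2.agree_z[OF JB x] by (simp_all add: Bd)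
    ultimately show "\<partial>y J x = - (2 * w x * J x * J x)" "\<partial>z J x = - (2 * A x * w x * J x * J x)"
      by algebra+
  qed
  obtain W3 H where W3: "open W3" "x0 \<in> W3" "W3 \<subseteq> W2" "H analytic2_on W3" "H x0 = 0"
    and H: "\<And>x. x \<in> W3 \<Longrightarrow> \<partial>y H x = (w * J) x" "\<And>x. x \<in> W3 \<Longrightarrow> \<partial>z H x = (A * w * J) x"
  proof (rule analytic2_potential[OF W2(1,2), of "w * J" "A * w * J"])
    fix x assume x [simp]: "x \<in> W2"
    show "\<partial>z (w * J) x = \<partial>y (A * w * J) x"
      by (simp add: Jd W2.Aw algebra_simps)
  qed simp_all
  interpret W3: solution \<Omega> f g W3 A w
    by (rule W2.restrict_solution[OF _ W3(3)], unfold_locales) (use W3 W2.V_sub in auto)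
  define U where "U = (\<lambda>x. exp (H x))"
  have U [simp]: "U analytic2_on W3" unfolding U_def by (rule analytic2_exp[OF W3(4)])
  have J3 [simp]: "J analytic2_on W3" by (rule analytic2_subset[OF J W3(3)])
  have Ud: "\<partial>y U x = U x * w x * J x" "\<partial>z U x = U x * A x * w x * J x" if "x \<in> W3" for x
    using partial_exp[OF W3(4) that] H that by (simp_all add: U_def)
  \<comment> \<open>This identifies \<open>U^2\<close> with \<open>B\<close> without a logarithm:
    \<open>U^2 / B\<close> is locally constant, and at \<open>x0\<close> both \<open>U\<close> and
    \<open>J\<close> equal 1.\<close>
  have const: "\<partial>z (U * U * J) x = 0" "\<partial>y (U * U * J) x = 0" if x [simp]: "x \<in> W3" for x
  proof -
    have x2 [simp]: "x \<in> W2" using W3(3) x by blast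
    show "\<partial>z (U * U * J) x = 0" "\<partial>y (U * U * J) x = 0"
      by (simp_all add: Ud Jd algebra_simps)
  qed
  have "(U * U * J) analytic2_on W3" by simp
  obtain W4 where W4: "open W4" "x0 \<in> W4" "W4 \<subseteq> W3"
    "\<And>x. x \<in> W4 \<Longrightarrow> (U * U * J) x = (U * U * J) x0"
    by (rule constant_near[OF W3(1,2) \<open>(U * U * J) analytic2_on W3\<close> const]) (assumption | rule that)+
  interpret W4: solution \<Omega> f g W4 A w
    by (rule W3.restrict_solution[OF _ W4(3)], unfold_locales) (use W4 W3.V_sub in auto)
  have UJ: "U x * U x * J x = 1" if "x \<in> W4" for x
    using W4(4)[OF that] W3(5) B0(2) by (simp add: U_def J_def B_def)
  have U4 [simp]: "U analytic2_on W4" by (rule analytic2_subset[OF U W4(3)])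
  have "lax_representation_on W4 (lax_L A U) (lax_M U)"
    unfolding W4.lax_representation_iff[OF W4.A_analytic U4]
  proof
    fix x assume x: "x \<in> W4"
    then have x3: "x \<in> W3" using W4(3) by blast
    have UU: "U x * \<partial>y U x = w x"
      unfolding Ud[OF x3] using UJ[OF x, THEN eq_diff0] by algebra
    then show "\<partial>y A x = f x \<and> \<partial>z A x = g x - U x * \<partial>y U x \<and> \<partial>z U x = A x * \<partial>y U x"
      unfolding UU by (simp add: W4.Aw[OF x] Ud[OF x3] algebra_simps)
  qed
  \<comment> \<open>If \<open>A\<close> vanished on \<open>W4\<close>, so would
    \<open>f = A_y\<close>, and then \<open>f\<close> would vanish on \<open>\<Omega>\<close> by the
    identity theorem.\<close>
  moreover have "\<exists>x\<in>W4. A x \<noteq> 0"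
  proof (rule ccontr)
    assume "\<not> (\<exists>x\<in>W4. A x \<noteq> 0)"
    then have "W4.agree A 0" by (auto simp: W4.agree_def)
    from W4.agree_y[OF this] have "f x = 0" if "x \<in> W4" for x using that by (simp add: W4.Aw)
    then show False using W4.vanishes_from_V[OF f_analytic] f_nonzero by blast
  qed
  moreover have "\<exists>x\<in>W4. U x \<noteq> 0" by (rule bexI[OF _ W4(2)]) (simp add: U_def)
  ultimately show ?thesis
    unfolding has_lax_representation_def
    using W4.open_V W4.V_nonempty W4.V_sub W4.A_analytic U4 by blast
qed

text \<open>All three statements are compared with one intermediate statement, the local solvability
  of the system for \<open>(A, w)\<close>.\<close>

theorem (in analytic_equation) equivalence:
  "has_quadratic_first_integral \<longleftrightarrow> has_lax_representation"
  "has_lax_representation \<longleftrightarrow> coefficient_conditions"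
proof -
  have region: "region \<Omega> f g V" if "open V" "V \<noteq> {}" "V \<subseteq> \<Omega>" for V
    by unfold_locales (use that in auto)
  have 1: "\<exists>V A w. solution \<Omega> f g V A w" if I: has_quadratic_first_integral
  proof -
    obtain V A B where V: "open V" "V \<noteq> {}" "V \<subseteq> \<Omega>" and an: "A analytic2_on V" "B analytic2_on V"
      and I: "first_integral_on V (\<lambda>x v. (v + A x)\<^sup>2 + B x)"
      using I unfolding has_quadratic_first_integral_def by blast
    interpret region \<Omega> f g V by (rule region[OF V])
    show ?thesis using first_integral_imp_solvable[OF an I] by (simp add: solvable_def)
  qed
  have 2: "\<exists>V A w. solution \<Omega> f g V A w" if II: has_lax_representation
  proof -
    obtain V F U where V: "open V" "V \<noteq> {}" "V \<subseteq> \<Omega>" and an: "F analytic2_on V" "U analytic2_on V"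
      and II: "lax_representation_on V (lax_L F U) (lax_M U)"
      using II unfolding has_lax_representation_def by blast
    interpret region \<Omega> f g V by (rule region[OF V])
    show ?thesis using lax_imp_solvable[OF an II] by (simp add: solvable_def)
  qed
  have "has_quadratic_first_integral \<longleftrightarrow> (\<exists>V A w. solution \<Omega> f g V A w)"
    using 1 solution.has_first_integral by metis
  moreover have "has_lax_representation \<longleftrightarrow> (\<exists>V A w. solution \<Omega> f g V A w)"
    using 2 solution.has_lax by metis
  moreover have "coefficient_conditions \<longleftrightarrow> (\<exists>V A w. solution \<Omega> f g V A w)"
    using conditions_imp_solution solution.conditions_of_solution by metis
  ultimately show "has_quadratic_first_integral \<longleftrightarrow> has_lax_representation"
    "has_lax_representation \<longleftrightarrow> coefficient_conditions"
    by simp_all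
qed

theorem proposition1:
  shows "(\<forall>(\<Omega> :: (real \<times> real) set) (f :: real \<times> real \<Rightarrow> real) (g :: real \<times> real \<Rightarrow> real).
      open \<Omega> \<longrightarrow> connected \<Omega> \<longrightarrow> \<Omega> \<noteq> {} \<longrightarrow> f analytic2_on \<Omega> \<longrightarrow> g analytic2_on \<Omega> \<longrightarrow>
      (\<exists>x\<in>\<Omega>. f x \<noteq> 0) \<longrightarrow> (\<exists>x\<in>\<Omega>. g x \<noteq> 0) \<longrightarrow>
      \<not> ((\<forall>x\<in>\<Omega>. \<partial>y f x = 0) \<and> (\<forall>x\<in>\<Omega>. \<partial>y (\<partial>y g) x = 0)) \<longrightarrow>
      (equation.has_quadratic_first_integral \<Omega> f g \<longleftrightarrow> equation.has_lax_representation \<Omega> f g) \<and>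
      (equation.has_lax_representation \<Omega> f g \<longleftrightarrow> equation.coefficient_conditions \<Omega> f g)) \<and>
    (\<forall>(\<Omega> :: (complex \<times> complex) set) (f :: complex \<times> complex \<Rightarrow> complex) (g :: complex \<times> complex \<Rightarrow> complex).
      open \<Omega> \<longrightarrow> connected \<Omega> \<longrightarrow> \<Omega> \<noteq> {} \<longrightarrow> f analytic2_on \<Omega> \<longrightarrow> g analytic2_on \<Omega> \<longrightarrow>
      (\<exists>x\<in>\<Omega>. f x \<noteq> 0) \<longrightarrow> (\<exists>x\<in>\<Omega>. g x \<noteq> 0) \<longrightarrow>
      \<not> ((\<forall>x\<in>\<Omega>. \<partial>y f x = 0) \<and> (\<forall>x\<in>\<Omega>. \<partial>y (\<partial>y g) x = 0)) \<longrightarrow>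
      (equation.has_quadratic_first_integral \<Omega> f g \<longleftrightarrow> equation.has_lax_representation \<Omega> f g) \<and>
      (equation.has_lax_representation \<Omega> f g \<longleftrightarrow> equation.coefficient_conditions \<Omega> f g))"
  by (intro conjI allI impI; rule analytic_equation.equivalence; unfold_locales; assumption)

end
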